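(* There exists a closed combinatory term $H$ such that $H\Vdash(\gimel\kappa\text{ is countable})\to\mathrm{NEAC}$, where NEAC is the formula $$\forall z\,\exists f\big(f\subseteq z\wedge\mathrm{Func}(f)\wedge\forall x\forall y\,\exists y'((x,y)\,\varepsilon\,z\to(x,y')\,\varepsilon\,f)\big).$$
   Context: Realizability algebra $\mathcal A$ (terms $\Lambda$, stacks $\Pi$, instructions $B,C,I,K,W,\mathrm{cc}$, continuations $k_\pi$, execution $\succ$ given by $(\xi)\eta\star\pi\succ\xi\star\eta\cdot\pi$, $I\star\xi\cdot\pi\succ\xi\star\pi$, $K\star\xi\cdot\eta\cdot\pi\succ\xi\star\pi$, $W\star\xi\cdot\eta\cdot\pi\succ\xi\star\eta\cdot\eta\cdot\pi$, $C\star\xi\cdot\eta\cdot\zeta\cdot\pi\succ\xi\star\zeta\cdot\eta\cdot\pi$, $B\star\xi\cdot\eta\cdot\zeta\cdot\pi\succ\xi\star(\eta)\zeta\cdot\pi$, $\mathrm{cc}\star\xi\cdot\pi\succ\xi\star k_\pi\cdot\pi$, $k_\pi\star\xi\cdot\varpi\succ\xi\star\pi$; set $\perp\!\!\!\perp$ of processes closed under anti-execution), coherent, in a ground model $\mathcal M\models$ ZF+$V=L$. Closed combinatory terms are built from the instructions by application and have values in $\Lambda$. Realizability model $\mathcal N_{\mathcal A}$: individuals of $\mathcal M$; $\|\top\|=\emptyset$, $\|\bot\|=\Pi$, $\|a\not\varepsilon b\|=\{\pi:(a,\pi)\in b\}$, $\|a\subset b\|=\bigcup_c\{\xi\cdot\pi:(c,\pi)\in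 a,\xi\Vdash c\notin b\}$, $\|a\notin b\|=\bigcup_c\{\xi\cdot\xi'\cdot\pi:(c,\pi)\in b,\xi\Vdash a\subset c,\xi'\Vdash c\subset a\}$, $\|A\to B\|=\{\xi\cdot\pi:\xi\Vdash A,\pi\in\|B\|\}$, $\|\forall xA\|=\bigcup_a\|A[a/x]\|$; $\xi\Vdash F$ iff $\xi\star\pi\in\perp\!\!\!\perp$ for all $\pi\in\|F\|$. $\neg A:=A\to\bot$, $\exists xA:=\neg\forall x\neg A$, $A\wedge B:=(A\to B\to\bot)\to\bot$, $a\,\varepsilon\,b:=\neg(a\not\varepsilon b)$; $x=y$ is $\forall z(x\not\varepsilon z\to y\not\varepsilon z)$; $(x,y)$ is the ordered pair function of $\mathcal M$ (with $(\emptyset,\emptyset)=\emptyset$). $f\subseteq z$ is $\forall w(w\not\varepsilon z\to w\not\varepsilon f)$; $\mathrm{Func}(f)$ is $\forall x\forall y\forall y'((x,y)\,\varepsilon\,f,(x,y')\,\varepsilon\,f\to y=y')$. $\gimel\kappa=\kappa\times\Pi$ where $\kappa=\mathrm{card}(\Lambda\cup\Pi\cup\mathbb N)$ in $\mathcal M$; "countable" is the usual ZF formula interpreted in $\mathcal N_{\mathcal A}$. *)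

theory Defs
  imports Main
begin

section \<open>First-order set theory\<close>

text \<open>
  Formulas are needed as syntax only for the schemas of separation and replacement. Variables
  are numbered; the assignment supplies the parameters.
\<close>

datatype fm = Mem nat nat | Eq nat nat | Neg fm | Conj fm fm | Forall nat fm

text \<open>
  A model of set theory is a type with a binary relation. It need not be standard: the relation
  may be ill-founded from outside, and all notions below are the internal ones, that is, they
  quantify only over elements of the model.
\<close>

locale set_structure =
  fixes mem :: "'v \<Rightarrow> 'v \<Rightarrow> bool" (infix \<open>\<in>\<^sub>M\<close> 50)
begin

primrec sat :: "(nat \<Rightarrow> 'v) \<Rightarrow> fm \<Rightarrow> bool" where
  "sat e (Mem i j) \<longleftrightarrow> e i \<in>\<^sub>M e j"
| "sat e (Eq i j) \<longleftrightarrow> e i = e j"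
| "sat e (Neg \<phi>) \<longleftrightarrow> \<not> sat e \<phi>"
| "sat e (Conj \<phi> \<psi>) \<longleftrightarrow> sat e \<phi> \<and> sat e \<psi>"
| "sat e (Forall i \<phi>) \<longleftrightarrow> (\<forall>a. sat (e(i := a)) \<phi>)"

definition subset :: "'v \<Rightarrow> 'v \<Rightarrow> bool" where
  "subset a b \<longleftrightarrow> (\<forall>x. x \<in>\<^sub>M a \<longrightarrow> x \<in>\<^sub>M b)"

text \<open>The element of the model whose members are exactly the \<open>x\<close> with \<open>P x\<close>, if there is one.\<close>

definition the_set :: "('v \<Rightarrow> bool) \<Rightarrow> 'v" where
  "the_set P = (THE b. \<forall>x. x \<in>\<^sub>M b \<longleftrightarrow> P x)"

definition empty :: 'v where
  "empty = the_set (\<lambda>x. False)"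

definition upair :: "'v \<Rightarrow> 'v \<Rightarrow> 'v" where
  "upair a b = the_set (\<lambda>x. x = a \<or> x = b)"

definition kpair :: "'v \<Rightarrow> 'v \<Rightarrow> 'v" where
  "kpair a b = upair (upair a a) (upair a b)"

definition succ :: "'v \<Rightarrow> 'v" where
  "succ a = the_set (\<lambda>x. x \<in>\<^sub>M a \<or> x = a)"

definition is_inductive :: "'v \<Rightarrow> bool" where
  "is_inductive w \<longleftrightarrow>
     (\<exists>e. e \<in>\<^sub>M w \<and> (\<forall>x. \<not> x \<in>\<^sub>M e)) \<and>
     (\<forall>x. x \<in>\<^sub>M w \<longrightarrow> (\<exists>y. y \<in>\<^sub>M w \<and> (\<forall>u. u \<in>\<^sub>M y \<longleftrightarrow> u \<in>\<^sub>M x \<or> u = x)))"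

definition omega :: 'v where
  "omega = the_set (\<lambda>n. \<forall>w. is_inductive w \<longrightarrow> n \<in>\<^sub>M w)"

definition transitive :: "'v \<Rightarrow> bool" where
  "transitive a \<longleftrightarrow> (\<forall>x. x \<in>\<^sub>M a \<longrightarrow> subset x a)"

definition Ord :: "'v \<Rightarrow> bool" where
  "Ord a \<longleftrightarrow> transitive a \<and> (\<forall>x. x \<in>\<^sub>M a \<longrightarrow> transitive x)"

text \<open>\<open>f\<close> is an element of the model which is a function with domain \<open>d\<close>, as a set of pairs.\<close>

definition fun_on :: "'v \<Rightarrow> 'v \<Rightarrow> bool" where
  "fun_on f d \<longleftrightarrow>
     (\<forall>p. p \<in>\<^sub>M f \<longrightarrow> (\<exists>x y. x \<in>\<^sub>M d \<and> p = kpair x y)) \<and>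
     (\<forall>x. x \<in>\<^sub>M d \<longrightarrow> (\<exists>!y. kpair x y \<in>\<^sub>M f))"

definition ap :: "'v \<Rightarrow> 'v \<Rightarrow> 'v" where
  "ap f x = (THE y. kpair x y \<in>\<^sub>M f)"

definition bijection :: "'v \<Rightarrow> 'v \<Rightarrow> 'v \<Rightarrow> bool" where
  "bijection f a b \<longleftrightarrow> fun_on f a \<and>
     (\<forall>x. x \<in>\<^sub>M a \<longrightarrow> ap f x \<in>\<^sub>M b) \<and>
     (\<forall>y. y \<in>\<^sub>M b \<longrightarrow> (\<exists>!x. x \<in>\<^sub>M a \<and> ap f x = y))"

definition is_card :: "'v \<Rightarrow> 'v \<Rightarrow> bool" where
  "is_card k a \<longleftrightarrow> Ord k \<and> (\<exists>f. bijection f k a) \<and>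
     (\<forall>b. b \<in>\<^sub>M k \<longrightarrow> \<not> (\<exists>f. bijection f b a))"

definition ZF :: bool where
  "ZF \<longleftrightarrow>
     \<comment> \<open>extensionality\<close>
     (\<forall>a b. (\<forall>x. x \<in>\<^sub>M a \<longleftrightarrow> x \<in>\<^sub>M b) \<longrightarrow> a = b) \<and>
     \<comment> \<open>foundation\<close>
     (\<forall>a. (\<exists>x. x \<in>\<^sub>M a) \<longrightarrow> (\<exists>x. x \<in>\<^sub>M a \<and> \<not> (\<exists>y. y \<in>\<^sub>M x \<and> y \<in>\<^sub>M a))) \<and>
     \<comment> \<open>pairing\<close>
     (\<forall>a b. \<exists>c. \<forall>x. x \<in>\<^sub>M c \<longleftrightarrow> x = a \<or> x = b) \<and>
     \<comment> \<open>union\<close>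
     (\<forall>a. \<exists>b. \<forall>x. x \<in>\<^sub>M b \<longleftrightarrow> (\<exists>y. y \<in>\<^sub>M a \<and> x \<in>\<^sub>M y)) \<and>
     \<comment> \<open>power set\<close>
     (\<forall>a. \<exists>b. \<forall>x. x \<in>\<^sub>M b \<longleftrightarrow> subset x a) \<and>
     \<comment> \<open>infinity\<close>
     (\<exists>w. is_inductive w) \<and>
     \<comment> \<open>separation\<close>
     (\<forall>\<phi> e a. \<exists>b. \<forall>x. x \<in>\<^sub>M b \<longleftrightarrow> x \<in>\<^sub>M a \<and> sat (e(0 := x)) \<phi>) \<and>
     \<comment> \<open>replacement\<close>
     (\<forall>\<phi> e a. (\<forall>x. x \<in>\<^sub>M a \<longrightarrow> (\<exists>!y. sat (e(0 := x, 1 := y)) \<phi>)) \<longrightarrow>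
        (\<exists>b. \<forall>y. y \<in>\<^sub>M b \<longleftrightarrow> (\<exists>x. x \<in>\<^sub>M a \<and> sat (e(0 := x, 1 := y)) \<phi>)))"


subsection \<open>The axiom of constructibility\<close>

text \<open>
  The definable power set is formulated inside the model without coding formulas, following
  Kunen: the definable \<open>n\<close>-ary relations on \<open>a\<close> are those generated from the relations
  \<open>s\<^sub>i \<in> s\<^sub>j\<close> and \<open>s\<^sub>i = s\<^sub>j\<close> by complement, intersection and projection, where \<open>n\<close> ranges over
  the natural numbers of the model and \<open>s\<close> over the \<open>n\<close>-tuples, which are functions on \<open>n\<close>.
\<close>

definition tuple :: "'v \<Rightarrow> 'v \<Rightarrow> 'v \<Rightarrow> bool" where
  "tuple a n s \<longleftrightarrow> fun_on s n \<and> (\<forall>i. i \<in>\<^sub>M n \<longrightarrow> ap s i \<in>\<^sub>M a)"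

text \<open>The \<open>n\<close>-tuple \<open>s\<close> extended by the last component \<open>x\<close>.\<close>

definition snoc :: "'v \<Rightarrow> 'v \<Rightarrow> 'v \<Rightarrow> 'v" where
  "snoc n s x = the_set (\<lambda>p. p \<in>\<^sub>M s \<or> p = kpair n x)"

text \<open>\<open>D\<close> is a set of pairs \<open>\<langle>n, R\<rangle>\<close> with the closure properties of the definable relations.\<close>

definition Df_closed :: "'v \<Rightarrow> 'v \<Rightarrow> bool" where
  "Df_closed a D \<longleftrightarrow> (\<forall>n. n \<in>\<^sub>M omega \<longrightarrow>
     (\<forall>i j. i \<in>\<^sub>M n \<longrightarrow> j \<in>\<^sub>M n \<longrightarrow>
        kpair n (the_set (\<lambda>s. tuple a n s \<and> ap s i \<in>\<^sub>M ap s j)) \<in>\<^sub>M D \<and>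
        kpair n (the_set (\<lambda>s. tuple a n s \<and> ap s i = ap s j)) \<in>\<^sub>M D) \<and>
     (\<forall>R. kpair n R \<in>\<^sub>M D \<longrightarrow>
        kpair n (the_set (\<lambda>s. tuple a n s \<and> \<not> s \<in>\<^sub>M R)) \<in>\<^sub>M D) \<and>
     (\<forall>R S. kpair n R \<in>\<^sub>M D \<longrightarrow> kpair n S \<in>\<^sub>M D \<longrightarrow>
        kpair n (the_set (\<lambda>s. s \<in>\<^sub>M R \<and> s \<in>\<^sub>M S)) \<in>\<^sub>M D) \<and>
     (\<forall>R. kpair (succ n) R \<in>\<^sub>M D \<longrightarrow>
        kpair n (the_set (\<lambda>s. tuple a n s \<and> (\<exists>x. x \<in>\<^sub>M a \<and> snoc n s x \<in>\<^sub>M R))) \<in>\<^sub>M D))"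

definition Df :: "'v \<Rightarrow> 'v \<Rightarrow> 'v \<Rightarrow> bool" where
  "Df a n R \<longleftrightarrow> (\<forall>D. Df_closed a D \<longrightarrow> kpair n R \<in>\<^sub>M D)"

text \<open>\<open>X\<close> is a subset of \<open>a\<close> which is definable over \<open>a\<close> with parameters \<open>s\<close> from \<open>a\<close>.\<close>

definition definable_subset :: "'v \<Rightarrow> 'v \<Rightarrow> bool" where
  "definable_subset a X \<longleftrightarrow> (\<exists>n s R. n \<in>\<^sub>M omega \<and> tuple a n s \<and> Df a (succ n) R \<and>
     (\<forall>x. x \<in>\<^sub>M X \<longleftrightarrow> x \<in>\<^sub>M a \<and> snoc n s x \<in>\<^sub>M R))"

text \<open>\<open>g\<close> is the sequence of the \<open>L\<^sub>\<beta>\<close> for \<open>\<beta> \<le> \<alpha>\<close>, where \<open>L\<^sub>\<beta>\<close> is the union of the definable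
  power sets of the \<open>L\<^sub>\<gamma>\<close> for \<open>\<gamma> < \<beta>\<close>.\<close>

definition L_sequence :: "'v \<Rightarrow> 'v \<Rightarrow> bool" where
  "L_sequence \<alpha> g \<longleftrightarrow> fun_on g (succ \<alpha>) \<and>
     (\<forall>\<beta>. \<beta> \<in>\<^sub>M succ \<alpha> \<longrightarrow>
        (\<forall>x. x \<in>\<^sub>M ap g \<beta> \<longleftrightarrow> (\<exists>\<gamma>. \<gamma> \<in>\<^sub>M \<beta> \<and> definable_subset (ap g \<gamma>) x)))"

definition V_eq_L :: bool where
  "V_eq_L \<longleftrightarrow> (\<forall>x. \<exists>\<alpha> g. Ord \<alpha> \<and> L_sequence \<alpha> g \<and> x \<in>\<^sub>M ap g \<alpha>)"


subsection \<open>The pairing function used for falsity values\<close>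

text \<open>The Kuratowski pair, modified at one point so that \<open>(\<emptyset>, \<emptyset>) = \<emptyset>\<close>. It remains injective,
  because no Kuratowski pair is empty.\<close>

definition opair :: "'v \<Rightarrow> 'v \<Rightarrow> 'v" where
  "opair a b = (if a = empty \<and> b = empty then empty else kpair a b)"

end


section \<open>Realizability algebras\<close>

datatype cterm = B | C | I | K | W | CC | App cterm cterm

text \<open>The four carriers are elements of the ground model; the operations matter only on them.\<close>

record 'v ralg =
  Terms :: 'v
  Stacks :: 'v
  Procs :: 'v
  Pole :: 'v
  app :: "'v \<Rightarrow> 'v \<Rightarrow> 'v"
  push :: "'v \<Rightarrow> 'v \<Rightarrow> 'v"
  proc :: "'v \<Rightarrow> 'v \<Rightarrow> 'v"
  kont :: "'v \<Rightarrow> 'v"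
  instr_B :: 'v
  instr_C :: 'v
  instr_I :: 'v
  instr_K :: 'v
  instr_W :: 'v
  instr_cc :: 'v

primrec val :: "'v ralg \<Rightarrow> cterm \<Rightarrow> 'v" where
  "val A B = instr_B A"
| "val A C = instr_C A"
| "val A I = instr_I A"
| "val A K = instr_K A"
| "val A W = instr_W A"
| "val A CC = instr_cc A"
| "val A (App t u) = app A (val A t) (val A u)"

locale realizability_structure = set_structure mem
  for mem :: "'v \<Rightarrow> 'v \<Rightarrow> bool" (infix \<open>\<in>\<^sub>M\<close> 50) +
  fixes A :: "'v ralg"
begin

abbreviation Terms_A (\<open>\<Lambda>\<close>) where "\<Lambda> \<equiv> Terms A"
abbreviation Stacks_A (\<open>\<Pi>\<close>) where "\<Pi> \<equiv> Stacks A"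
abbreviation app_A (infixl \<open>\<bullet>\<close> 80) where "\<xi> \<bullet> \<eta> \<equiv> app A \<xi> \<eta>"
abbreviation push_A (infixr \<open>\<cdot>\<close> 75) where "\<xi> \<cdot> \<pi> \<equiv> push A \<xi> \<pi>"
abbreviation proc_A (infix \<open>\<star>\<close> 70) where "\<xi> \<star> \<pi> \<equiv> proc A \<xi> \<pi>"

inductive step :: "'v \<Rightarrow> 'v \<Rightarrow> bool" where
  "\<lbrakk>\<xi> \<in>\<^sub>M \<Lambda>; \<eta> \<in>\<^sub>M \<Lambda>; \<pi> \<in>\<^sub>M \<Pi>\<rbrakk> \<Longrightarrow> step (\<xi> \<bullet> \<eta> \<star> \<pi>) (\<xi> \<star> \<eta> \<cdot> \<pi>)"
| "\<lbrakk>\<xi> \<in>\<^sub>M \<Lambda>; \<pi> \<in>\<^sub>M \<Pi>\<rbrakk> \<Longrightarrow> step (instr_I A \<star> \<xi> \<cdot> \<pi>) (\<xi> \<star> \<pi>)"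
| "\<lbrakk>\<xi> \<in>\<^sub>M \<Lambda>; \<eta> \<in>\<^sub>M \<Lambda>; \<pi> \<in>\<^sub>M \<Pi>\<rbrakk> \<Longrightarrow> step (instr_K A \<star> \<xi> \<cdot> \<eta> \<cdot> \<pi>) (\<xi> \<star> \<pi>)"
| "\<lbrakk>\<xi> \<in>\<^sub>M \<Lambda>; \<eta> \<in>\<^sub>M \<Lambda>; \<pi> \<in>\<^sub>M \<Pi>\<rbrakk> \<Longrightarrow> step (instr_W A \<star> \<xi> \<cdot> \<eta> \<cdot> \<pi>) (\<xi> \<star> \<eta> \<cdot> \<eta> \<cdot> \<pi>)"
| "\<lbrakk>\<xi> \<in>\<^sub>M \<Lambda>; \<eta> \<in>\<^sub>M \<Lambda>; \<zeta> \<in>\<^sub>M \<Lambda>; \<pi> \<in>\<^sub>M \<Pi>\<rbrakk>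
     \<Longrightarrow> step (instr_C A \<star> \<xi> \<cdot> \<eta> \<cdot> \<zeta> \<cdot> \<pi>) (\<xi> \<star> \<zeta> \<cdot> \<eta> \<cdot> \<pi>)"
| "\<lbrakk>\<xi> \<in>\<^sub>M \<Lambda>; \<eta> \<in>\<^sub>M \<Lambda>; \<zeta> \<in>\<^sub>M \<Lambda>; \<pi> \<in>\<^sub>M \<Pi>\<rbrakk>
     \<Longrightarrow> step (instr_B A \<star> \<xi> \<cdot> \<eta> \<cdot> \<zeta> \<cdot> \<pi>) (\<xi> \<star> (\<eta> \<bullet> \<zeta>) \<cdot> \<pi>)"
| "\<lbrakk>\<xi> \<in>\<^sub>M \<Lambda>; \<pi> \<in>\<^sub>M \<Pi>\<rbrakk> \<Longrightarrow> step (instr_cc A \<star> \<xi> \<cdot> \<pi>) (\<xi> \<star> kont A \<pi> \<cdot> \<pi>)"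
| "\<lbrakk>\<xi> \<in>\<^sub>M \<Lambda>; \<pi> \<in>\<^sub>M \<Pi>; \<rho> \<in>\<^sub>M \<Pi>\<rbrakk> \<Longrightarrow> step (kont A \<pi> \<star> \<xi> \<cdot> \<rho>) (\<xi> \<star> \<pi>)"

abbreviation executes (infix \<open>\<succ>\<close> 50) where "p \<succ> q \<equiv> step\<^sup>*\<^sup>* p q"

text \<open>The operation \<open>f\<close> on \<open>a \<times> b\<close> with values in \<open>c\<close> is an element of the model.\<close>

definition operation :: "'v \<Rightarrow> 'v \<Rightarrow> 'v \<Rightarrow> ('v \<Rightarrow> 'v \<Rightarrow> 'v) \<Rightarrow> bool" where
  "operation a b c f \<longleftrightarrow>
     (\<forall>x y. x \<in>\<^sub>M a \<longrightarrow> y \<in>\<^sub>M b \<longrightarrow> f x y \<in>\<^sub>M c) \<and>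
     (\<exists>g. \<forall>p. p \<in>\<^sub>M g \<longleftrightarrow> (\<exists>x y. x \<in>\<^sub>M a \<and> y \<in>\<^sub>M b \<and> p = kpair (kpair x y) (f x y)))"

definition realizability_algebra :: bool where
  "realizability_algebra \<longleftrightarrow>
     operation \<Lambda> \<Lambda> \<Lambda> (app A) \<and>
     operation \<Lambda> \<Pi> \<Pi> (push A) \<and>
     operation \<Lambda> \<Pi> (Procs A) (proc A) \<and>
     (\<forall>\<pi>. \<pi> \<in>\<^sub>M \<Pi> \<longrightarrow> kont A \<pi> \<in>\<^sub>M \<Lambda>) \<and>
     (\<exists>g. \<forall>p. p \<in>\<^sub>M g \<longleftrightarrow> (\<exists>\<pi>. \<pi> \<in>\<^sub>M \<Pi> \<and> p = kpair \<pi> (kont A \<pi>))) \<and>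
     instr_B A \<in>\<^sub>M \<Lambda> \<and> instr_C A \<in>\<^sub>M \<Lambda> \<and> instr_I A \<in>\<^sub>M \<Lambda> \<and>
     instr_K A \<in>\<^sub>M \<Lambda> \<and> instr_W A \<in>\<^sub>M \<Lambda> \<and> instr_cc A \<in>\<^sub>M \<Lambda> \<and>
     subset (Pole A) (Procs A) \<and>
     (\<forall>p q. p \<in>\<^sub>M Procs A \<longrightarrow> p \<succ> q \<longrightarrow> q \<in>\<^sub>M Pole A \<longrightarrow> p \<in>\<^sub>M Pole A)"

definition coherent :: bool where
  "coherent \<longleftrightarrow> (\<forall>t. \<exists>\<pi>. \<pi> \<in>\<^sub>M \<Pi> \<and> \<not> val A t \<star> \<pi> \<in>\<^sub>M Pole A)"


subsection \<open>Falsity values\<close>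

text \<open>
  A closed formula with parameters in the model is represented by its falsity value, a set of
  stacks; a formula with free variables is a function from individuals to falsity values.
\<close>

definition realizes :: "'v \<Rightarrow> 'v set \<Rightarrow> bool" (infix \<open>\<tturnstile>\<close> 50) where
  "\<xi> \<tturnstile> F \<longleftrightarrow> (\<forall>\<pi>\<in>F. \<xi> \<star> \<pi> \<in>\<^sub>M Pole A)"

definition Bot :: "'v set" where
  "Bot = {\<pi>. \<pi> \<in>\<^sub>M \<Pi>}"

definition Imp :: "'v set \<Rightarrow> 'v set \<Rightarrow> 'v set" (infixr \<open>\<^bold>\<longrightarrow>\<close> 25) where
  "(F \<^bold>\<longrightarrow> G) = {\<xi> \<cdot> \<pi> | \<xi> \<pi>. \<xi> \<in>\<^sub>M \<Lambda> \<and> \<xi> \<tturnstile> F \<and> \<pi> \<in> G}"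

definition All :: "('v \<Rightarrow> 'v set) \<Rightarrow> 'v set" (binder \<open>\<^bold>\<forall>\<close> 10) where
  "All F = (\<Union>a. F a)"

definition Not :: "'v set \<Rightarrow> 'v set" (\<open>\<^bold>\<not> _\<close> [40] 40) where
  "(\<^bold>\<not> F) = (F \<^bold>\<longrightarrow> Bot)"

definition Ex :: "('v \<Rightarrow> 'v set) \<Rightarrow> 'v set" (binder \<open>\<^bold>\<exists>\<close> 10) where
  "Ex F = (\<^bold>\<not> (\<^bold>\<forall>a. \<^bold>\<not> F a))"

definition And :: "'v set \<Rightarrow> 'v set \<Rightarrow> 'v set" (infixr \<open>\<^bold>\<and>\<close> 35) where
  "(F \<^bold>\<and> G) = ((F \<^bold>\<longrightarrow> G \<^bold>\<longrightarrow> Bot) \<^bold>\<longrightarrow> Bot)"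

definition Or :: "'v set \<Rightarrow> 'v set \<Rightarrow> 'v set" (infixr \<open>\<^bold>\<or>\<close> 30) where
  "(F \<^bold>\<or> G) = ((F \<^bold>\<longrightarrow> Bot) \<^bold>\<longrightarrow> (G \<^bold>\<longrightarrow> Bot) \<^bold>\<longrightarrow> Bot)"

definition Iff :: "'v set \<Rightarrow> 'v set \<Rightarrow> 'v set" (infix \<open>\<^bold>\<longleftrightarrow>\<close> 25) where
  "(F \<^bold>\<longleftrightarrow> G) = ((F \<^bold>\<longrightarrow> G) \<^bold>\<and> (G \<^bold>\<longrightarrow> F))"

definition not_eps :: "'v \<Rightarrow> 'v \<Rightarrow> 'v set" where
  "not_eps a b = {\<pi>. \<pi> \<in>\<^sub>M \<Pi> \<and> opair a \<pi> \<in>\<^sub>M b}"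

text \<open>
  The falsity values of \<open>a \<subset> b\<close> and \<open>a \<notin> b\<close> are defined by simultaneous recursion on the ranks
  of \<open>a\<close> and \<open>b\<close>. The recursion takes place inside the model (whose membership may be ill-founded
  from outside), hence by approximations: elements \<open>s\<close> and \<open>n\<close> of the model which satisfy both
  recursion equations on a transitive set \<open>T\<close>.
\<close>

definition section_at :: "'v \<Rightarrow> 'v \<Rightarrow> 'v \<Rightarrow> 'v set" where
  "section_at s a b = {\<pi>. \<pi> \<in>\<^sub>M \<Pi> \<and> kpair (kpair a b) \<pi> \<in>\<^sub>M s}"

definition incl_clause :: "('v \<Rightarrow> 'v \<Rightarrow> 'v set) \<Rightarrow> 'v \<Rightarrow> 'v \<Rightarrow> 'v set" where
  "incl_clause N a b = {\<xi> \<cdot> \<pi> | \<xi> \<pi> c.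
     \<xi> \<in>\<^sub>M \<Lambda> \<and> \<pi> \<in>\<^sub>M \<Pi> \<and> opair c \<pi> \<in>\<^sub>M a \<and> \<xi> \<tturnstile> N c b}"

definition not_in_clause :: "('v \<Rightarrow> 'v \<Rightarrow> 'v set) \<Rightarrow> 'v \<Rightarrow> 'v \<Rightarrow> 'v set" where
  "not_in_clause S a b = {\<xi> \<cdot> \<xi>' \<cdot> \<pi> | \<xi> \<xi>' \<pi> c.
     \<xi> \<in>\<^sub>M \<Lambda> \<and> \<xi>' \<in>\<^sub>M \<Lambda> \<and> \<pi> \<in>\<^sub>M \<Pi> \<and> opair c \<pi> \<in>\<^sub>M b \<and> \<xi> \<tturnstile> S a c \<and> \<xi>' \<tturnstile> S c a}"

definition approximation :: "'v \<Rightarrow> 'v \<Rightarrow> 'v \<Rightarrow> bool" where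
  "approximation T s n \<longleftrightarrow> transitive T \<and>
     (\<forall>a b. a \<in>\<^sub>M T \<longrightarrow> b \<in>\<^sub>M T \<longrightarrow>
        section_at s a b = incl_clause (section_at n) a b \<and>
        section_at n a b = not_in_clause (section_at s) a b)"

definition incl :: "'v \<Rightarrow> 'v \<Rightarrow> 'v set" where
  "incl a b = {\<pi>. \<exists>T s n. approximation T s n \<and> a \<in>\<^sub>M T \<and> b \<in>\<^sub>M T \<and> \<pi> \<in> section_at s a b}"

definition not_in :: "'v \<Rightarrow> 'v \<Rightarrow> 'v set" where
  "not_in a b = {\<pi>. \<exists>T s n. approximation T s n \<and> a \<in>\<^sub>M T \<and> b \<in>\<^sub>M T \<and> \<pi> \<in> section_at n a b}"

definition eps :: "'v \<Rightarrow> 'v \<Rightarrow> 'v set" where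
  "eps a b = (\<^bold>\<not> not_eps a b)"

definition eq :: "'v \<Rightarrow> 'v \<Rightarrow> 'v set" where
  "eq a b = (\<^bold>\<forall>z. not_eps a z \<^bold>\<longrightarrow> not_eps b z)"

text \<open>Extensional membership and extensional equality, in which the axioms of ZF hold.\<close>

definition ext_in :: "'v \<Rightarrow> 'v \<Rightarrow> 'v set" where
  "ext_in a b = (\<^bold>\<not> not_in a b)"

definition ext_eq :: "'v \<Rightarrow> 'v \<Rightarrow> 'v set" where
  "ext_eq a b = (incl a b \<^bold>\<and> incl b a)"


subsection \<open>The formulas\<close>

definition eps_subset :: "'v \<Rightarrow> 'v \<Rightarrow> 'v set" where
  "eps_subset f z = (\<^bold>\<forall>w. not_eps w z \<^bold>\<longrightarrow> not_eps w f)"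

definition Func :: "'v \<Rightarrow> 'v set" where
  "Func f = (\<^bold>\<forall>x. \<^bold>\<forall>y. \<^bold>\<forall>y'. eps (opair x y) f \<^bold>\<longrightarrow> eps (opair x y') f \<^bold>\<longrightarrow> eq y y')"

definition NEAC :: "'v set" where
  "NEAC = (\<^bold>\<forall>z. \<^bold>\<exists>f. eps_subset f z \<^bold>\<and> Func f \<^bold>\<and>
     (\<^bold>\<forall>x. \<^bold>\<forall>y. \<^bold>\<exists>y'. eps (opair x y) z \<^bold>\<longrightarrow> eps (opair x y') f))"

definition Inductive :: "'v \<Rightarrow> 'v set" where
  "Inductive w =
     ((\<^bold>\<exists>e. ext_in e w \<^bold>\<and> (\<^bold>\<forall>u. not_in u e)) \<^bold>\<and>
      (\<^bold>\<forall>x. ext_in x w \<^bold>\<longrightarrow>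
         (\<^bold>\<exists>y. ext_in y w \<^bold>\<and> (\<^bold>\<forall>u. ext_in u y \<^bold>\<longleftrightarrow> ext_in u x \<^bold>\<or> ext_eq u x))))"

definition Natural :: "'v \<Rightarrow> 'v set" where
  "Natural n = (\<^bold>\<forall>w. Inductive w \<^bold>\<longrightarrow> ext_in n w)"

text \<open>
  There is a function \<open>g\<close> from \<open>X\<close> to \<open>\<omega>\<close> which is total, single-valued and injective. Here \<open>\<omega>\<close>
  is the extensional set of integers of ZF, hence integers are compared by extensional equality.
  The elements of \<open>X\<close> are its \<open>\<epsilon>\<close>-elements, compared by Leibniz equality, and \<open>g\<close> is
  an \<open>\<epsilon>\<close>-set of pairs: for \<open>X = \<gimel>\<kappa>\<close>, the use of extensional equality on \<open>X\<close> would make the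
  formula trivially realized, since all nonzero ordinals of the ground model have, as
  individuals, the same \<open>\<epsilon>\<close>-elements (no nonempty ordinal is a pair).
\<close>

definition Countable :: "'v \<Rightarrow> 'v set" where
  "Countable X = (\<^bold>\<exists>g.
     (\<^bold>\<forall>x. eps x X \<^bold>\<longrightarrow> (\<^bold>\<exists>n. Natural n \<^bold>\<and> eps (opair x n) g)) \<^bold>\<and>
     (\<^bold>\<forall>x. \<^bold>\<forall>n. \<^bold>\<forall>n'. eps (opair x n) g \<^bold>\<longrightarrow> eps (opair x n') g \<^bold>\<longrightarrow> ext_eq n n') \<^bold>\<and>
     (\<^bold>\<forall>x. \<^bold>\<forall>x'. \<^bold>\<forall>n. \<^bold>\<forall>n'. eps (opair x n) g \<^bold>\<longrightarrow> eps (opair x' n') g \<^bold>\<longrightarrow>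
        ext_eq n n' \<^bold>\<longrightarrow> eq x x'))"

definition gimel :: "'v \<Rightarrow> 'v" where
  "gimel a = the_set (\<lambda>p. \<exists>x \<pi>. x \<in>\<^sub>M a \<and> \<pi> \<in>\<^sub>M \<Pi> \<and> p = opair x \<pi>)"

definition is_kappa :: "'v \<Rightarrow> bool" where
  "is_kappa \<kappa> \<longleftrightarrow> is_card \<kappa> (the_set (\<lambda>x. x \<in>\<^sub>M \<Lambda> \<or> x \<in>\<^sub>M \<Pi> \<or> x \<in>\<^sub>M omega))"

end

end

theory Submission
  imports Defs "HOL-Library.Countable"
begin

text \<open>
  Realizability by the value of a closed term satisfies modus ponens, generalization and the axioms
  of classical logic, so it can replace provability in Henkin's completeness proof: a formula is
  realized if it holds in every two-valued structure satisfying finitely many realized axiom schemes.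
  In such a structure one may argue as in ordinary mathematics.

  Since \<open>V = L\<close>, the ground model can choose, for all \<open>x\<close> and \<open>\<pi>\<close> with \<open>\<pi> \<in> \<parallel>(x, y) \<notin> z\<parallel>\<close> for some
  \<open>y\<close> (membership being nonextensional), one such \<open>y\<close>. Stacks can be numbered by elements \<open>\<nu>\<close> of \<open>\<kappa>\<close>.
  Hence in the realizability model, if some \<open>(x, y)\<close> belongs to \<open>z\<close>, so does \<open>(x, y')\<close> where \<open>y'\<close> is the
  value chosen for \<open>x\<close> and some \<open>\<nu>\<close> in \<open>\<gimel>\<kappa>\<close>. If \<open>\<gimel>\<kappa>\<close> is countable, the \<open>\<nu>\<close> whose number is least, as
  an extensional ordinal, determines \<open>y'\<close> from \<open>x\<close>.
\<close>

section \<open>Definability with parameters\<close>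

text \<open>Membership of the ground model may be ill-founded from outside, and separation and
  replacement are available only for formulas with parameters. Hence every recursion, induction and
  choice takes place inside the model, and each predicate used there is first shown definable
  (\<open>dfn\<close>, \<open>tm\<close>, \<open>fdfn\<close>). The choice is made per stack because
  a realizer meets the assumption that (x, y) belongs to z only through a stack \<pi> of the falsity
  value of its negation. It captures \<pi> as a continuation, and the same continuation serves for
  (x, y'); \<nu> is a name of \<pi> that formulas can speak about. Numbers can be compared only up
  to extensional equality, under which nonextensional membership is not invariant. Therefore
  minimality is expressed in the extensional order, which is linear on ordinals, and injectivity of
  the numbering leads back to Leibniz equality of the \<nu>, hence of the chosen values.
  Completeness removes the need to write the term of this derivation: only the schemes in
  \<open>ax\<close> get explicit realizers, each of which has to work for all values of the
  variables at once.\<close>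

primrec rename :: "(nat => nat) => fm => fm" where
  "rename f (Mem i j) = Mem (f i) (f j)"
| "rename f (Eq i j) = Eq (f i) (f j)"
| "rename f (Neg \<phi>) = Neg (rename f \<phi>)"
| "rename f (Conj \<phi> \<psi>) = Conj (rename f \<phi>) (rename f \<psi>)"
| "rename f (Forall i \<phi>) = Forall (f i) (rename f \<phi>)"

context set_structure
begin

text \<open>Bound variables are renamed as well, so updating at \<open>f i\<close> must not touch
  any other renamed variable; this is what injectivity provides.\<close>

lemma sat_rename:
  assumes "inj f"
  shows "sat e (rename f \<phi>) = sat (\<lambda>i. e (f i)) \<phi>"
proof (induction \<phi> arbitrary: e)
  case (Forall i \<phi>)
  have "(\<lambda>j. (e(f i := a)) (f j)) = (\<lambda>j. e (f j))(i := a)" for a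
    using assms by (auto simp: fun_eq_iff inj_eq)
  with Forall show ?case by simp
qed auto

text \<open>Even variables are proper variables, odd ones carry parameters of the model.\<close>

definition mix :: "(nat => 'v) => (nat => 'v) => nat => 'v" where
  "mix e p i = (if even i then e (i div 2) else p (i div 2))"

definition dfn :: "((nat => 'v) => bool) => bool" where
  "dfn P \<longleftrightarrow> (\<exists>\<phi> p. \<forall>e. sat (mix e p) \<phi> = P e)"

text \<open>The syntax has no function symbols, so a term is represented by its graph: variable 0 is
  the value and the remaining variables are shifted arguments.\<close>

definition tm :: "((nat => 'v) => 'v) => bool" where
  "tm t \<longleftrightarrow> dfn (\<lambda>e. e 0 = t (\<lambda>i. e (Suc i)))"

named_theorems dfn_intros

lemma dfn_rename:
  assumes "inj f" "dfn P"
  shows "dfn (\<lambda>e. P (\<lambda>i. e (f i)))"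
proof -
  obtain \<phi> p where \<phi>: "\<And>e. sat (mix e p) \<phi> = P e"
    using assms(2) by (auto simp: dfn_def)
  define g where "g i = (if even i then 2 * f (i div 2) else i)" for i
  have "inj g"
  proof (rule injI)
    fix x y assume "g x = g y"
    then show "x = y" unfolding g_def using injD[OF assms(1)]
      by (metis dvd_mult_div_cancel dvd_triv_left mult_left_cancel zero_neq_numeral)
  qed
  moreover have "(\<lambda>i. mix e p (g i)) = mix (\<lambda>i. e (f i)) p" for e
    by (auto simp: mix_def g_def fun_eq_iff)
  ultimately have "sat (mix e p) (rename g \<phi>) = P (\<lambda>i. e (f i))" for e
    by (simp add: sat_rename \<phi>)
  then show ?thesis unfolding dfn_def by blast
qed

lemma dfn_not [dfn_intros]: "dfn P ==> dfn (\<lambda>e. \<not> P e)"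
  unfolding dfn_def by (metis sat.simps(3))

lemma dfn_conj [dfn_intros]:
  assumes "dfn P" "dfn Q" shows "dfn (\<lambda>e. P e \<and> Q e)"
proof -
  obtain \<phi> p \<psi> q where *: "\<And>e. sat (mix e p) \<phi> = P e" "\<And>e. sat (mix e q) \<psi> = Q e"
    using assms by (auto simp: dfn_def)
  \<comment> \<open>Both formulas keep their even variables; the parameter variable 2k+1 goes to
    4k+1 for \<open>\<phi>\<close> and to 4k+3 for \<open>\<psi>\<close>, the places where
    \<open>mix p q\<close> stores the two parameter sequences.\<close>
  define f :: "nat => nat" where "f i = (if even i then i else 2 * i - 1)" for i
  define g :: "nat => nat" where "g i = (if even i then i else 2 * i + 1)" for i
  define r where "r = mix p q"
  have "inj f" "inj g"
    unfolding f_def g_def by (rule injI; simp split: if_splits; presburger)+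
  moreover have "mix e r (f i) = mix e p i" "mix e r (g i) = mix e q i" for e i
  proof -
    have "mix e r (f i) = mix e p i \<and> mix e r (g i) = mix e q i"
    proof (cases "even i")
      case False
      then obtain k where k: "i = 2 * k + 1" by (elim oddE)
      have "f i = Suc (2 * (2 * k))" "g i = Suc (2 * Suc (2 * k))" by (simp_all add: f_def g_def k)
      then show ?thesis by (simp add: mix_def r_def k del: mult_Suc_right)
    qed (simp add: mix_def f_def g_def)
    then show "mix e r (f i) = mix e p i" "mix e r (g i) = mix e q i" by auto
  qed
  ultimately have "sat (mix e r) (Conj (rename f \<phi>) (rename g \<psi>)) = (P e \<and> Q e)" for e
    by (simp add: sat_rename *)
  then show ?thesis unfolding dfn_def by blast
qed

lemma dfn_all [dfn_intros]:
  assumes "dfn (\<lambda>e. P (e 0) (\<lambda>i. e (Suc i)))" shows "dfn (\<lambda>e. \<forall>x. P x e)"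
proof -
  obtain \<phi> p where \<phi>: "\<And>e. sat (mix e p) \<phi> = P (e 0) (\<lambda>i. e (Suc i))"
    using assms by (auto simp: dfn_def)
  \<comment> \<open>The bound variable moves to the odd place 1, freed by shifting all parameters up
    by one, and the other proper variables move down to fill the gap at 0.\<close>
  define f :: "nat => nat" where "f i = (if i = 0 then 1 else if even i then i - 2 else i + 2)" for i
  have "inj f" unfolding f_def by (rule injI; simp split: if_splits; presburger)
  moreover have "(\<lambda>i. ((mix e (\<lambda>i. p (i - 1)))(1 := x)) (f i)) = mix (case_nat x e) p" for e x
  proof
    fix i
    consider "i = 0" | k where "i = 2 * Suc k" | k where "i = 2 * k + 1"
      by (metis evenE oddE not0_implies_Suc mult_0_right)
    then show "((mix e (\<lambda>i. p (i - 1)))(1 := x)) (f i) = mix (case_nat x e) p i"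
    proof cases
      case 2
      then have "f i = 2 * k" by (simp add: f_def)
      with 2 show ?thesis by (simp add: mix_def del: mult_Suc_right)
    next
      case 3
      then have "f i = Suc (2 * Suc k)" by (simp add: f_def)
      with 3 show ?thesis by (simp add: mix_def del: mult_Suc_right)
    qed (simp add: f_def mix_def)
  qed
  ultimately have "sat (mix e (\<lambda>i. p (i - 1))) (Forall 1 (rename f \<phi>)) = (\<forall>x. P x e)" for e
    by (simp add: sat_rename \<phi> del: One_nat_def)
  then show ?thesis unfolding dfn_def by blast
qed

lemma dfn_disj [dfn_intros]: "dfn P ==> dfn Q ==> dfn (\<lambda>e. P e \<or> Q e)"
  using dfn_not[OF dfn_conj[OF dfn_not[of P] dfn_not[of Q]]] by simp

lemma dfn_imp [dfn_intros]: "dfn P ==> dfn Q ==> dfn (\<lambda>e. P e --> Q e)"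
  unfolding imp_conv_disj by (intro dfn_disj dfn_not)

lemma dfn_iff: "dfn P ==> dfn Q ==> dfn (\<lambda>e. P e \<longleftrightarrow> Q e)"
  unfolding iff_conv_conj_imp by (intro dfn_conj dfn_imp)

lemma dfn_ex [dfn_intros]:
  assumes "dfn (\<lambda>e. P (e 0) (\<lambda>i. e (Suc i)))" shows "dfn (\<lambda>e. \<exists>x. P x e)"
  using dfn_not[OF dfn_all[OF dfn_not[OF assms]]] by simp

lemma tm_var [dfn_intros]: "tm (\<lambda>e. e i)"
proof -
  have "sat (mix e p) (Eq 0 (2 * Suc i)) = (e 0 = e (Suc i))" for e p
    by (simp add: mix_def)
  then show ?thesis unfolding tm_def dfn_def by blast
qed

lemma tm_const [dfn_intros]: "tm (\<lambda>e. c)"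
proof -
  have "sat (mix e (\<lambda>_. c)) (Eq 0 1) = (e 0 = c)" for e
    by (simp add: mix_def)
  then show ?thesis unfolding tm_def dfn_def by blast
qed

lemma dfn_const [dfn_intros]: "dfn (\<lambda>e. c)"
proof -
  have "sat (mix e (\<lambda>_. undefined)) (if c then Eq 0 0 else Neg (Eq 0 0)) = c" for e
    by simp
  then show ?thesis unfolding dfn_def by blast
qed

text \<open>The value sits at variable \<open>k\<close> among \<open>n\<close> variables added in
  front; \<open>k < n\<close> keeps the renaming injective.\<close>

lemma dfn_graph:
  assumes "tm t" "k < n" shows "dfn (\<lambda>e. e k = t (\<lambda>i. e (i + n)))"
proof -
  have "inj (case_nat k (\<lambda>i. i + n))" using assms(2)
    by (auto simp: inj_def split: nat.splits)
  from dfn_rename[OF this assms(1)[unfolded tm_def]] show ?thesis by simp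
qed

text \<open>A term is eliminated by quantifying over its value. The same device with several
  quantifiers gives the versions for more arguments.\<close>

lemma dfn1:
  assumes "dfn (\<lambda>e. Q (e 0))" "tm t" shows "dfn (\<lambda>e. Q (t e))"
proof -
  have "dfn (\<lambda>e. \<exists>x. x = t e \<and> Q x)"
    using dfn_graph[OF assms(2), of 0 1] assms(1) by (intro dfn_ex dfn_conj) simp_all
  then show ?thesis by simp
qed

lemma dfn2:
  assumes "dfn (\<lambda>e. Q (e 0) (e 1))" "tm t" "tm u" shows "dfn (\<lambda>e. Q (t e) (u e))"
proof -
  \<comment> \<open>Under nested quantifiers the innermost variable has number 0, so the arguments
    appear in reverse order.\<close>
  have "dfn (\<lambda>e. Q (e (Suc 0)) (e 0))"
    using dfn_rename[OF _ assms(1), of "\<lambda>i. if i = 0 then 1 else if i = 1 then 0 else i"]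
    by (simp add: inj_def)
  then have "dfn (\<lambda>e. \<exists>x y. x = t e \<and> y = u e \<and> Q x y)"
    using dfn_graph[OF assms(2), of 1 2] dfn_graph[OF assms(3), of 0 2]
    by (intro dfn_ex dfn_conj) simp_all
  then show ?thesis by simp
qed

lemma dfn3:
  assumes "dfn (\<lambda>e. Q (e 0) (e 1) (e 2))" "tm t" "tm u" "tm v"
  shows "dfn (\<lambda>e. Q (t e) (u e) (v e))"
proof -
  have "inj (\<lambda>i::nat. if i \<le> 2 then 2 - i else i)"
    by (rule injI) (simp split: if_splits)
  then have "dfn (\<lambda>e. Q (e (Suc (Suc 0))) (e (Suc 0)) (e 0))"
    using dfn_rename[OF _ assms(1)] by (fastforce simp: numeral_2_eq_2)
  then have "dfn (\<lambda>e. \<exists>x y z. x = t e \<and> y = u e \<and> z = v e \<and> Q x y z)"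
    using dfn_graph[OF assms(2), of 2 3] dfn_graph[OF assms(3), of 1 3] dfn_graph[OF assms(4), of 0 3]
    by (intro dfn_ex dfn_conj) (simp_all add: eval_nat_numeral)
  then show ?thesis by simp
qed

lemma dfn4:
  assumes "dfn (\<lambda>e. Q (e 0) (e 1) (e 2) (e 3))" "tm t" "tm u" "tm v" "tm w"
  shows "dfn (\<lambda>e. Q (t e) (u e) (v e) (w e))"
proof -
  have "inj (\<lambda>i::nat. if i \<le> 3 then 3 - i else i)"
    by (rule injI) (simp split: if_splits)
  then have "dfn (\<lambda>e. Q (e (Suc (Suc (Suc 0)))) (e (Suc (Suc 0))) (e (Suc 0)) (e 0))"
    using dfn_rename[OF _ assms(1)] by (fastforce simp: numeral_2_eq_2 numeral_3_eq_3)
  then have "dfn (\<lambda>e. \<exists>x y z a. x = t e \<and> y = u e \<and> z = v e \<and> a = w e \<and> Q x y z a)"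
    using dfn_graph[OF assms(2), of 3 4] dfn_graph[OF assms(3), of 2 4] dfn_graph[OF assms(4), of 1 4]
      dfn_graph[OF assms(5), of 0 4]
    by (intro dfn_ex dfn_conj) (simp_all add: eval_nat_numeral)
  then show ?thesis by simp
qed

lemma tm_shift:
  assumes "tm t" shows "tm (\<lambda>e. t (\<lambda>i. e (Suc i)))"
  using dfn_graph[OF assms, of 0 2] unfolding tm_def by simp

lemma tm1:
  assumes "tm (\<lambda>e. F (e 0))" "tm t" shows "tm (\<lambda>e. F (t e))"
  using dfn2[OF _ tm_var tm_shift[OF assms(2)], of "\<lambda>x y. x = F y" 0] assms(1)
  by (simp add: tm_def)

lemma tm2:
  assumes "tm (\<lambda>e. F (e 0) (e 1))" "tm t" "tm u" shows "tm (\<lambda>e. F (t e) (u e))"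
  using dfn3[OF _ tm_var tm_shift[OF assms(2)] tm_shift[OF assms(3)], of "\<lambda>x y z. x = F y z" 0] assms(1)
  by (simp add: tm_def numeral_2_eq_2)

lemma dfn_mem [dfn_intros]: "tm t ==> tm u ==> dfn (\<lambda>e. t e \<in>\<^sub>M u e)"
proof (rule dfn2)
  \<comment> \<open>Proper variables 0 and 1 are stored at the even places 0 and 2.\<close>
  have "sat (mix e p) (Mem 0 2) = (e 0 \<in>\<^sub>M e 1)" for e p
    by (simp add: mix_def)
  then show "dfn (\<lambda>e. e 0 \<in>\<^sub>M e 1)" unfolding dfn_def by blast
qed

lemma dfn_eq [dfn_intros]: "tm t ==> tm u ==> dfn (\<lambda>e. t e = u e)"
proof (rule dfn2)
  have "sat (mix e p) (Eq 0 2) = (e 0 = e 1)" for e p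
    by (simp add: mix_def)
  then show "dfn (\<lambda>e. e 0 = e 1)" unfolding dfn_def by blast
qed

lemma dfn_if [dfn_intros]: "dfn (\<lambda>e. b e) ==> dfn P ==> dfn Q ==> dfn (\<lambda>e. if b e then P e else Q e)"
  unfolding if_bool_eq_disj by (intro dfn_disj dfn_conj dfn_not)

end

locale zf = set_structure mem for mem :: "'v => 'v => bool" (infix \<open>\<in>\<^sub>M\<close> 50) +
  assumes zf: ZF
begin

lemma
  extensionality: "\<forall>a b. (\<forall>x. x \<in>\<^sub>M a \<longleftrightarrow> x \<in>\<^sub>M b) --> a = b" and
  pairing: "\<forall>a b. \<exists>c. \<forall>x. x \<in>\<^sub>M c \<longleftrightarrow> x = a \<or> x = b" and
  union: "\<forall>a. \<exists>b. \<forall>x. x \<in>\<^sub>M b \<longleftrightarrow> (\<exists>y. y \<in>\<^sub>M a \<and> x \<in>\<^sub>M y)" and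
  power_set: "\<forall>a. \<exists>b. \<forall>x. x \<in>\<^sub>M b \<longleftrightarrow> subset x a" and
  infinity: "\<exists>w. is_inductive w"
  by (insert zf[unfolded ZF_def]) (elim conjE, assumption)+

lemma ext: "(\<And>x. x \<in>\<^sub>M a \<longleftrightarrow> x \<in>\<^sub>M b) ==> a = b"
  using extensionality by blast

lemma foundation:
  assumes "x \<in>\<^sub>M a"
  obtains y where "y \<in>\<^sub>M a" "\<And>z. z \<in>\<^sub>M y ==> \<not> z \<in>\<^sub>M a"
proof -
  have "\<forall>a. (\<exists>x. x \<in>\<^sub>M a) --> (\<exists>x. x \<in>\<^sub>M a \<and> \<not> (\<exists>y. y \<in>\<^sub>M x \<and> y \<in>\<^sub>M a))"
    using zf unfolding ZF_def by (elim conjE)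
  with assms that show thesis by blast
qed

lemma separation:
  assumes "dfn (\<lambda>e. P (e 0))" shows "\<exists>b. \<forall>x. x \<in>\<^sub>M b \<longleftrightarrow> x \<in>\<^sub>M a \<and> P x"
proof -
  obtain \<phi> p where \<phi>: "\<And>e. sat (mix e p) \<phi> = P (e 0)"
    using assms by (auto simp: dfn_def)
  have "(mix (\<lambda>_. a) p)(0 := x) = mix ((\<lambda>_. a)(0 := x)) p" for x
    by (auto simp: mix_def fun_eq_iff)
  then have *: "sat ((mix (\<lambda>_. a) p)(0 := x)) \<phi> = P x" for x
    by (simp add: \<phi>)
  have "\<forall>\<phi> e a. \<exists>b. \<forall>x. x \<in>\<^sub>M b \<longleftrightarrow> x \<in>\<^sub>M a \<and> sat (e(0 := x)) \<phi>"
    using zf unfolding ZF_def by (elim conjE)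
  from this[rule_format, of a "mix (\<lambda>_. a) p" \<phi>] show ?thesis by (simp add: *)
qed

lemma replacement:
  assumes "dfn (\<lambda>e. R (e 0) (e 1))" "\<And>x. x \<in>\<^sub>M a ==> \<exists>!y. R x y"
  shows "\<exists>b. \<forall>y. y \<in>\<^sub>M b \<longleftrightarrow> (\<exists>x. x \<in>\<^sub>M a \<and> R x y)"
proof -
  obtain \<phi> p where \<phi>: "\<And>e. sat (mix e p) \<phi> = R (e 0) (e 1)"
    using assms(1) by (auto simp: dfn_def)
  \<comment> \<open>The schema expects its second variable at place 1, whereas \<open>mix\<close>
    keeps it at 2; the two places are exchanged.\<close>
  define f :: "nat => nat" where "f i = (if i = 1 then 2 else if i = 2 then 1 else i)" for i
  have inj: "inj f" unfolding f_def by (rule injI) presburger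
  have "(\<lambda>i. ((\<lambda>i. mix (\<lambda>_. a) p (f i))(0 := x, 1 := y)) (f i)) = mix ((\<lambda>_. a)(0 := x, 1 := y)) p" for x y
    by (auto simp: mix_def f_def fun_eq_iff elim!: evenE)
  then have *: "sat ((\<lambda>i. mix (\<lambda>_. a) p (f i))(0 := x, 1 := y)) (rename f \<phi>) = R x y" for x y
    by (simp only: sat_rename[OF inj] \<phi>) simp
  have "\<forall>\<phi> e a. (\<forall>x. x \<in>\<^sub>M a --> (\<exists>!y. sat (e(0 := x, 1 := y)) \<phi>)) -->
        (\<exists>b. \<forall>y. y \<in>\<^sub>M b \<longleftrightarrow> (\<exists>x. x \<in>\<^sub>M a \<and> sat (e(0 := x, 1 := y)) \<phi>))"
    using zf unfolding ZF_def by (elim conjE)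
  from this[rule_format, of a "\<lambda>i. mix (\<lambda>_. a) p (f i)" "rename f \<phi>"] show ?thesis
    using assms(2) unfolding * by blast
qed

section \<open>Elementary set theory\<close>

lemma mem_the_set:
  assumes "\<exists>b. \<forall>x. x \<in>\<^sub>M b \<longleftrightarrow> P x" shows "x \<in>\<^sub>M the_set P \<longleftrightarrow> P x"
proof -
  obtain b where b: "\<forall>x. x \<in>\<^sub>M b \<longleftrightarrow> P x" using assms by blast
  then have "the_set P = b" unfolding the_set_def by (intro the_equality) (auto intro: ext)
  with b show ?thesis by simp
qed

text \<open>By extensionality the graph of a set term is the formula stating which members the value
  has.\<close>

lemma tm_the_set:
  assumes "\<And>e. \<exists>b. \<forall>x. x \<in>\<^sub>M b \<longleftrightarrow> P x e" "dfn (\<lambda>e. P (e 0) (\<lambda>i. e (Suc i)))"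
  shows "tm (\<lambda>e. the_set (\<lambda>x. P x e))"
proof -
  have "y = the_set (\<lambda>x. P x e) \<longleftrightarrow> (\<forall>x. x \<in>\<^sub>M y \<longleftrightarrow> P x e)" for y e
    using mem_the_set[OF assms(1)] by (auto intro: ext)
  moreover have "dfn (\<lambda>e. \<forall>x. x \<in>\<^sub>M e 0 \<longleftrightarrow> P x (\<lambda>i. e (Suc i)))"
  proof (intro dfn_intros dfn_iff)
    have "inj (case_nat 0 (\<lambda>i. Suc (Suc i)))" by (auto simp: inj_def split: nat.splits)
    from dfn_rename[OF this assms(2)] show "dfn (\<lambda>e. P (e 0) (\<lambda>i. e (Suc (Suc i))))" by simp
  qed
  ultimately show ?thesis unfolding tm_def by simp
qed

lemma separationE:
  "(\<And>b. (\<And>x. x \<in>\<^sub>M b \<longleftrightarrow> x \<in>\<^sub>M a \<and> P x) ==> thesis) ==> dfn (\<lambda>e. P (e 0)) ==> thesis"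
  using separation[of P a] by blast

lemma set_of_bounded:
  assumes "dfn (\<lambda>e. P (e 0))" "\<And>x. P x ==> x \<in>\<^sub>M a" shows "\<exists>b. \<forall>x. x \<in>\<^sub>M b \<longleftrightarrow> P x"
  using separation[OF assms(1), of a] assms(2) by blast

lemma ex_upair: "\<exists>c. \<forall>x. x \<in>\<^sub>M c \<longleftrightarrow> x = a \<or> x = b"
  using pairing by blast

lemma mem_upair [simp]: "x \<in>\<^sub>M upair a b \<longleftrightarrow> x = a \<or> x = b"
  unfolding upair_def by (rule mem_the_set, rule ex_upair)

lemma mem_empty [simp]: "\<not> x \<in>\<^sub>M empty"
proof -
  have "\<exists>b. \<forall>x. x \<in>\<^sub>M b \<longleftrightarrow> False"
    using separation[of "\<lambda>_. False" undefined] by (simp add: dfn_const)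
  from mem_the_set[OF this] show ?thesis unfolding empty_def by simp
qed

definition bigun :: "'v => 'v" where
  "bigun a = the_set (\<lambda>x. \<exists>y. y \<in>\<^sub>M a \<and> x \<in>\<^sub>M y)"

definition pow :: "'v => 'v" where
  "pow a = the_set (\<lambda>x. subset x a)"

definition un :: "'v => 'v => 'v" where
  "un a b = bigun (upair a b)"

lemma ex_bigun: "\<exists>b. \<forall>x. x \<in>\<^sub>M b \<longleftrightarrow> (\<exists>y. y \<in>\<^sub>M a \<and> x \<in>\<^sub>M y)"
  using union by blast

lemma mem_bigun [simp]: "x \<in>\<^sub>M bigun a \<longleftrightarrow> (\<exists>y. y \<in>\<^sub>M a \<and> x \<in>\<^sub>M y)"
  unfolding bigun_def by (rule mem_the_set, rule ex_bigun)

lemma mem_pow [simp]: "x \<in>\<^sub>M pow a \<longleftrightarrow> subset x a"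
  unfolding pow_def by (rule mem_the_set) (use power_set in simp)

lemma mem_un [simp]: "x \<in>\<^sub>M un a b \<longleftrightarrow> x \<in>\<^sub>M a \<or> x \<in>\<^sub>M b"
  by (auto simp: un_def)

lemma ex_succ: "\<exists>b. \<forall>x. x \<in>\<^sub>M b \<longleftrightarrow> x \<in>\<^sub>M a \<or> x = a"
  by (rule exI[of _ "un a (upair a a)"]) auto

lemma mem_succ [simp]: "x \<in>\<^sub>M succ a \<longleftrightarrow> x \<in>\<^sub>M a \<or> x = a"
  unfolding succ_def by (rule mem_the_set, rule ex_succ)

abbreviation rel :: "'v => 'v => 'v => bool" where
  "rel r x y \<equiv> kpair x y \<in>\<^sub>M r"

lemma upair_eq_iff: "upair a b = upair c d \<longleftrightarrow> (a = c \<and> b = d) \<or> (a = d \<and> b = c)"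
proof
  assume "upair a b = upair c d"
  then have "x = a \<or> x = b \<longleftrightarrow> x = c \<or> x = d" for x
    using mem_upair[of x a b] mem_upair[of x c d] by simp
  then show "(a = c \<and> b = d) \<or> (a = d \<and> b = c)" by metis
qed (auto intro: ext)

lemma kpair_eq_iff [simp]: "kpair a b = kpair c d \<longleftrightarrow> a = c \<and> b = d"
  unfolding kpair_def upair_eq_iff by auto

lemma kpair_neq_empty [simp]: "kpair a b \<noteq> empty" "empty \<noteq> kpair a b"
  by (metis kpair_def mem_empty mem_upair)+

lemma opair_eq_iff [simp]: "opair a b = opair c d \<longleftrightarrow> a = c \<and> b = d"
  unfolding opair_def by auto

lemma dfn_subset [dfn_intros]: "tm t ==> tm u ==> dfn (\<lambda>e. subset (t e) (u e))"
  by (rule dfn2) (unfold subset_def, intro dfn_intros)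

lemma tm_upair [dfn_intros]: "tm t ==> tm u ==> tm (\<lambda>e. upair (t e) (u e))"
  by (rule tm2) (unfold upair_def, intro tm_the_set ex_upair dfn_intros)

lemma tm_kpair [dfn_intros]: "tm t ==> tm u ==> tm (\<lambda>e. kpair (t e) (u e))"
  unfolding kpair_def by (intro dfn_intros)

lemma tm_succ [dfn_intros]: "tm t ==> tm (\<lambda>e. succ (t e))"
  by (rule tm1) (unfold succ_def, intro tm_the_set ex_succ dfn_intros)

lemma tm_bigun [dfn_intros]: "tm t ==> tm (\<lambda>e. bigun (t e))"
  by (rule tm1) (unfold bigun_def, intro tm_the_set ex_bigun dfn_intros)

lemma tm_opair [dfn_intros]: "tm t ==> tm u ==> tm (\<lambda>e. opair (t e) (u e))"
  by (rule tm2) (unfold tm_def opair_def if_distrib[where f="(=) _"], intro dfn_intros)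

lemma ex_prod: "\<exists>c. \<forall>p. p \<in>\<^sub>M c \<longleftrightarrow> (\<exists>x y. x \<in>\<^sub>M a \<and> y \<in>\<^sub>M b \<and> p = kpair x y)"
proof (rule set_of_bounded)
  show "dfn (\<lambda>e. \<exists>x y. x \<in>\<^sub>M a \<and> y \<in>\<^sub>M b \<and> e 0 = kpair x y)" by (intro dfn_intros)
  show "p \<in>\<^sub>M pow (pow (un a b))" if "\<exists>x y. x \<in>\<^sub>M a \<and> y \<in>\<^sub>M b \<and> p = kpair x y" for p
    using that by (auto simp: subset_def kpair_def)
qed

definition prod :: "'v => 'v => 'v" where
  "prod a b = the_set (\<lambda>p. \<exists>x y. x \<in>\<^sub>M a \<and> y \<in>\<^sub>M b \<and> p = kpair x y)"

lemma mem_prod: "p \<in>\<^sub>M prod a b \<longleftrightarrow> (\<exists>x y. x \<in>\<^sub>M a \<and> y \<in>\<^sub>M b \<and> p = kpair x y)"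
  unfolding prod_def by (rule mem_the_set, rule ex_prod)

lemma kpair_mem_prod [simp]: "kpair x y \<in>\<^sub>M prod a b \<longleftrightarrow> x \<in>\<^sub>M a \<and> y \<in>\<^sub>M b"
  unfolding mem_prod by auto

lemma ex_relation:
  assumes "dfn (\<lambda>e. M (e 0) (e 1))"
  obtains r where "\<And>x y. rel r x y \<longleftrightarrow> x \<in>\<^sub>M a \<and> y \<in>\<^sub>M b \<and> M x y"
    "\<And>p. p \<in>\<^sub>M r ==> \<exists>x y. p = kpair x y"
proof -
  obtain r where "\<And>p. p \<in>\<^sub>M r \<longleftrightarrow> p \<in>\<^sub>M prod a b \<and> (\<exists>x y. p = kpair x y \<and> M x y)"
    by (rule separationE, erule that) (intro dfn_intros dfn2[OF assms])
  then show thesis by (intro that[of r]) auto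
qed

text \<open>Usually c lies three membership steps below a, through the singleton of c. The
  exceptional pair has no members, but there c is the pair itself.\<close>

lemma transitive_opair:
  assumes "transitive T" "a \<in>\<^sub>M T" "opair c \<pi> \<in>\<^sub>M a" shows "c \<in>\<^sub>M T"
proof (cases "c = empty \<and> \<pi> = empty")
  case True
  with assms show ?thesis by (auto simp: transitive_def subset_def opair_def)
next
  case False
  have "upair c c \<in>\<^sub>M opair c \<pi>" "c \<in>\<^sub>M upair c c" using False by (auto simp: opair_def kpair_def)
  with assms show ?thesis unfolding transitive_def subset_def by blast
qed

section \<open>Ordinals and natural numbers\<close>

lemma mem_irrefl [simp]: "\<not> x \<in>\<^sub>M x"
  by (rule foundation[of x "upair x x"]) auto

lemma mem_asym: "x \<in>\<^sub>M y ==> \<not> y \<in>\<^sub>M x"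
  by (rule foundation[of x "upair x y"]) auto

lemma succ_inject: "succ a = succ b ==> a = b"
  by (metis mem_asym mem_succ)

lemma succ_neq_empty [simp]: "succ a \<noteq> empty" "empty \<noteq> succ a"
  by (metis mem_empty mem_succ)+

lemma dfn_transitive [dfn_intros]: "tm t ==> dfn (\<lambda>e. transitive (t e))"
  by (rule dfn1) (unfold transitive_def, intro dfn_intros)

lemma dfn_Ord [dfn_intros]: "tm t ==> dfn (\<lambda>e. Ord (t e))"
  by (rule dfn1) (unfold Ord_def, intro dfn_intros)

lemma Ord_mem: "Ord a ==> b \<in>\<^sub>M a ==> Ord b"
  unfolding Ord_def transitive_def subset_def by blast

lemma Ord_trans: "Ord a ==> b \<in>\<^sub>M a ==> c \<in>\<^sub>M b ==> c \<in>\<^sub>M a"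
  unfolding Ord_def transitive_def subset_def by blast

lemma Ord_succ: "Ord a ==> Ord (succ a)"
  unfolding Ord_def transitive_def subset_def mem_succ by blast

lemma Ord_empty: "Ord empty"
  unfolding Ord_def transitive_def by auto

lemma Ord_un: "Ord a ==> Ord b ==> Ord (un a b)"
  unfolding Ord_def transitive_def subset_def mem_un by blast

lemma Ord_least:
  assumes "dfn (\<lambda>e. P (e 0))" "Ord a" "P a"
  obtains b where "Ord b" "P b" "\<And>c. c \<in>\<^sub>M b ==> \<not> P c"
proof -
  obtain s where s: "\<And>x. x \<in>\<^sub>M s \<longleftrightarrow> x \<in>\<^sub>M succ a \<and> P x"
    by (rule separationE, erule that) (rule assms(1))
  obtain b where b: "b \<in>\<^sub>M s" "\<And>c. c \<in>\<^sub>M b ==> \<not> c \<in>\<^sub>M s"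
    by (rule foundation[of a s]) (use s assms in auto)
  have "Ord b" using b(1) s Ord_succ[OF assms(2)] Ord_mem by blast
  moreover have "\<not> P c" if "c \<in>\<^sub>M b" for c
    using b that s Ord_succ[OF assms(2)] Ord_trans by blast
  ultimately show thesis using that b(1) s by blast
qed

lemma Ord_induct:
  assumes "dfn (\<lambda>e. P (e 0))" "Ord a" "\<And>a. Ord a ==> (\<And>b. b \<in>\<^sub>M a ==> P b) ==> P a"
  shows "P a"
proof (rule ccontr)
  assume "\<not> P a"
  then obtain b where "Ord b" "\<not> P b" "\<And>c. c \<in>\<^sub>M b ==> \<not> \<not> P c"
    using Ord_least[of "\<lambda>x. \<not> P x" a] assms(1,2) dfn_not by blast
  then show False using assms(3) by blast
qed

lemma Ord_linear:
  assumes "Ord a" "Ord b" shows "a \<in>\<^sub>M b \<or> a = b \<or> b \<in>\<^sub>M a"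
proof -
  have "\<forall>b. Ord b --> a \<in>\<^sub>M b \<or> a = b \<or> b \<in>\<^sub>M a"
  proof (rule Ord_induct[where P="\<lambda>a. \<forall>b. Ord b --> a \<in>\<^sub>M b \<or> a = b \<or> b \<in>\<^sub>M a"])
    show "dfn (\<lambda>e. \<forall>b. Ord b --> e 0 \<in>\<^sub>M b \<or> e 0 = b \<or> b \<in>\<^sub>M e 0)" by (intro dfn_intros)
    fix a assume a: "Ord a" "\<And>a'. a' \<in>\<^sub>M a ==> \<forall>b. Ord b --> a' \<in>\<^sub>M b \<or> a' = b \<or> b \<in>\<^sub>M a'"
    show "\<forall>b. Ord b --> a \<in>\<^sub>M b \<or> a = b \<or> b \<in>\<^sub>M a"
    proof (intro allI impI)
      fix b assume "Ord b"
      then show "a \<in>\<^sub>M b \<or> a = b \<or> b \<in>\<^sub>M a"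
      proof (rule Ord_induct[rotated])
        show "dfn (\<lambda>e. a \<in>\<^sub>M e 0 \<or> a = e 0 \<or> e 0 \<in>\<^sub>M a)" by (intro dfn_intros)
        fix b assume b: "Ord b" "\<And>b'. b' \<in>\<^sub>M b ==> a \<in>\<^sub>M b' \<or> a = b' \<or> b' \<in>\<^sub>M a"
        show "a \<in>\<^sub>M b \<or> a = b \<or> b \<in>\<^sub>M a"
        proof (rule ccontr)
          assume *: "\<not> ?thesis"
          have "x \<in>\<^sub>M b" if "x \<in>\<^sub>M a" for x using a(2)[OF that] b(1) * that Ord_trans[OF a(1) that] by blast
          moreover have "x \<in>\<^sub>M a" if "x \<in>\<^sub>M b" for x using b(2)[OF that] * that Ord_trans[OF b(1) that] by blast
          ultimately have "a = b" by (blast intro: ext)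
          with * show False by blast
        qed
      qed
    qed
  qed (rule assms(1))
  with assms(2) show ?thesis by blast
qed

lemma is_inductive_iff:
  "is_inductive w \<longleftrightarrow> empty \<in>\<^sub>M w \<and> (\<forall>x. x \<in>\<^sub>M w --> succ x \<in>\<^sub>M w)"
proof -
  have "(\<forall>x. \<not> x \<in>\<^sub>M e) \<longleftrightarrow> e = empty" for e by (auto intro: ext)
  moreover have "(\<forall>u. u \<in>\<^sub>M y \<longleftrightarrow> u \<in>\<^sub>M x \<or> u = x) \<longleftrightarrow> y = succ x" for x y by (auto intro: ext)
  ultimately show ?thesis unfolding is_inductive_def by simp
qed

lemma mem_omega: "n \<in>\<^sub>M omega \<longleftrightarrow> (\<forall>w. is_inductive w --> n \<in>\<^sub>M w)"
proof -
  obtain w where w: "is_inductive w" using infinity ..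
  show ?thesis unfolding omega_def
  proof (rule mem_the_set, rule set_of_bounded)
    show "dfn (\<lambda>e. \<forall>w. is_inductive w --> e 0 \<in>\<^sub>M w)"
      unfolding is_inductive_iff by (intro dfn_intros)
  qed (use w in blast)
qed

lemma empty_omega [simp]: "empty \<in>\<^sub>M omega"
  by (simp add: mem_omega is_inductive_iff)

lemma succ_omega: "n \<in>\<^sub>M omega ==> succ n \<in>\<^sub>M omega"
  by (simp add: mem_omega is_inductive_iff)

lemma omega_induct [consumes 2, case_names zero Suc]:
  assumes "dfn (\<lambda>e. P (e 0))" "n \<in>\<^sub>M omega" "P empty" "\<And>n. n \<in>\<^sub>M omega ==> P n ==> P (succ n)"
  shows "P n"
proof -
  obtain s where s: "\<And>x. x \<in>\<^sub>M s \<longleftrightarrow> x \<in>\<^sub>M omega \<and> P x"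
    by (rule separationE, erule that) (rule assms(1))
  then have "is_inductive s"
    using assms(3,4) succ_omega by (simp add: is_inductive_iff)
  then have "n \<in>\<^sub>M s" using assms(2) by (simp add: mem_omega)
  with s show ?thesis by simp
qed

lemma Ord_omega_mem: "n \<in>\<^sub>M omega ==> Ord n"
  by (rule omega_induct[of Ord]) (auto intro: dfn_intros Ord_empty Ord_succ)

lemma omega_transitive: "n \<in>\<^sub>M omega ==> \<forall>m. m \<in>\<^sub>M n --> m \<in>\<^sub>M omega"
  by (rule omega_induct[where P="\<lambda>n. \<forall>m. m \<in>\<^sub>M n --> m \<in>\<^sub>M omega"]) (auto intro!: dfn_intros)

lemma Ord_omega: "Ord omega"
  using omega_transitive Ord_omega_mem unfolding Ord_def transitive_def subset_def by blast

text \<open>Iteration of \<open>G\<close> along the natural numbers of the model: the iterates form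
  a set by replacement.\<close>

lemma ex_closed:
  assumes "tm (\<lambda>e. G (e 0))"
  obtains u where "a \<in>\<^sub>M u" "\<And>x. x \<in>\<^sub>M u ==> G x \<in>\<^sub>M u"
proof -
  note [dfn_intros] = tm1[OF assms]
  \<comment> \<open>A partial history only has to justify each of its pairs by an earlier one.
    Totality and uniqueness are not demanded, so a history can be extended by one pair without
    further checks; uniqueness follows later by induction on n.\<close>
  define H where "H h \<longleftrightarrow> (\<forall>p. p \<in>\<^sub>M h --> p = kpair empty a \<or>
      (\<exists>k v. rel h k v \<and> p = kpair (succ k) (G v)))" for h
  define R where "R n y \<longleftrightarrow> (\<exists>h. H h \<and> rel h n y)" for n y
  have H0: "dfn (\<lambda>e. H (e 0))" unfolding H_def by (intro dfn_intros)
  note [dfn_intros] = dfn1[OF H0]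
  have R0: "dfn (\<lambda>e. R (e 0) (e 1))" unfolding R_def by (intro dfn_intros)
  note [dfn_intros] = dfn2[OF R0]
  have R_0: "R empty y \<longleftrightarrow> y = a" for y
  proof
    show "y = a" if "R empty y" using that unfolding R_def H_def by auto
    have "H (upair (kpair empty a) (kpair empty a))" by (auto simp: H_def)
    then show "R empty y" if "y = a" using that unfolding R_def by fastforce
  qed
  have R_Suc: "R (succ n) y \<longleftrightarrow> (\<exists>v. R n v \<and> y = G v)" for n y
  proof
    show "\<exists>v. R n v \<and> y = G v" if "R (succ n) y"
      using that unfolding R_def H_def by (metis kpair_eq_iff succ_inject succ_neq_empty(1))
    assume "\<exists>v. R n v \<and> y = G v"
    then obtain v h where vh: "H h" "rel h n v" "y = G v" unfolding R_def by blast
    define k where "k = un h (upair (kpair (succ n) y) (kpair (succ n) y))"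
    have "H k" using vh unfolding H_def k_def by fastforce
    then show "R (succ n) y" unfolding R_def k_def by fastforce
  qed
  have ex1: "\<exists>!y. R n y" if "n \<in>\<^sub>M omega" for n
    by (rule omega_induct[where P="\<lambda>n. \<exists>!y. R n y"])
      (use that in \<open>auto simp: R_0 R_Suc Ex1_def intro!: dfn_intros\<close>)
  obtain u where u: "\<And>y. y \<in>\<^sub>M u \<longleftrightarrow> (\<exists>n. n \<in>\<^sub>M omega \<and> R n y)"
    using replacement[OF R0 ex1, of omega] by blast
  show thesis
  proof
    show "a \<in>\<^sub>M u" unfolding u using R_0 empty_omega by blast
    show "G x \<in>\<^sub>M u" if "x \<in>\<^sub>M u" for x using that succ_omega unfolding u by (metis R_Suc)
  qed
qed

text \<open>The members of the iterated unions of the singleton of a, collected, form a transitive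
  set.\<close>

lemma ex_transitive:
  obtains T where "transitive T" "a \<in>\<^sub>M T"
proof -
  have "tm (\<lambda>e. bigun (e 0))" by (intro dfn_intros)
  then obtain u where u: "upair a a \<in>\<^sub>M u" "\<And>x. x \<in>\<^sub>M u ==> bigun x \<in>\<^sub>M u"
    using ex_closed by blast
  show thesis
  proof
    show "transitive (bigun u)" unfolding transitive_def subset_def
      using u(2) by (metis mem_bigun)
    show "a \<in>\<^sub>M bigun u" using u(1) by auto
  qed
qed

end

section \<open>Enumeration of constructible sets\<close>

context zf
begin

text \<open>Only the places below \<open>\<eta>\<close> are visible, which makes the enumeration a
  course-of-values recursion.\<close>

definition seg :: "'v => 'v => 'v => 'v => bool" where
  "seg h \<eta> i y \<longleftrightarrow> i \<in>\<^sub>M \<eta> \<and> rel h i y"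

definition new :: "'v => ('v => 'v => bool) => 'v => bool" where
  "new U r y \<longleftrightarrow> y \<in>\<^sub>M U \<and> \<not> (\<exists>i. r i y)"

definition new_pair :: "'v => ('v => 'v => bool) => 'v => 'v => bool" where
  "new_pair U r i j \<longleftrightarrow> (\<exists>u v. r i u \<and> r j v \<and> new U r (kpair u v))"

definition new_val :: "('v => 'v) => 'v => ('v => 'v => bool) => 'v => bool" where
  "new_val G U r i \<longleftrightarrow> (\<exists>u. r i u \<and> new U r (G u))"

text \<open>The lexicographically least new pair of listed elements or, if the list is closed under pairs, the
  first new value of \<open>G\<close>. As pairs are listed, a unary \<open>G\<close> can encode operations of any arity.\<close>

definition least_new :: "('v => 'v) => 'v => ('v => 'v => bool) => 'v => bool" where
  "least_new G U r x \<longleftrightarrow>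
     (\<exists>i j u v. new_pair U r i j \<and> (\<forall>i'. i' \<in>\<^sub>M i --> \<not> (\<exists>j'. new_pair U r i' j')) \<and>
        (\<forall>j'. j' \<in>\<^sub>M j --> \<not> new_pair U r i j') \<and> r i u \<and> r j v \<and> x = kpair u v) \<or>
     (\<not> (\<exists>i j. new_pair U r i j) \<and>
        (\<exists>i u. new_val G U r i \<and> (\<forall>i'. i' \<in>\<^sub>M i --> \<not> new_val G U r i') \<and> r i u \<and> x = G u))"

definition nxt :: "('v => 'v) => 'v => 'v => 'v => 'v => 'v => bool" where
  "nxt G U lam h \<eta> x \<longleftrightarrow> (if \<eta> \<in>\<^sub>M lam then x = \<eta> else least_new G U (seg h \<eta>) x)"

text \<open>An attempt is an initial piece, of length \<open>\<xi>\<close>, of the enumeration. The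
  transfinite recursion is the union of all attempts, which agree where they overlap.\<close>

definition att :: "('v => 'v) => 'v => 'v => 'v => 'v => bool" where
  "att G U lam h \<xi> \<longleftrightarrow> Ord \<xi> \<and> (\<forall>p. p \<in>\<^sub>M h --> (\<exists>\<eta> x. \<eta> \<in>\<^sub>M \<xi> \<and> p = kpair \<eta> x)) \<and>
     (\<forall>\<eta>. \<eta> \<in>\<^sub>M \<xi> --> (\<exists>x. rel h \<eta> x)) \<and>
     (\<forall>\<eta> x y. rel h \<eta> x --> rel h \<eta> y --> x = y) \<and>
     (\<forall>\<eta> x. rel h \<eta> x --> nxt G U lam h \<eta> x)"

lemma nxt_cong:
  assumes "\<And>i y. i \<in>\<^sub>M \<eta> ==> rel h i y \<longleftrightarrow> rel h' i y" "nxt G U lam h \<eta> x"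
  shows "nxt G U lam h' \<eta> x"
proof -
  have "seg h \<eta> = seg h' \<eta>" using assms(1) by (auto simp: seg_def fun_eq_iff)
  with assms(2) show ?thesis by (cases "\<eta> \<in>\<^sub>M lam") (simp_all add: nxt_def)
qed

lemma least_new_fun:
  assumes r: "\<And>i y. r i y ==> Ord i" "\<And>i y z. r i y ==> r i z ==> y = z"
    and "least_new G U r x" "least_new G U r y"
  shows "x = y"
proof -
  have o: "i \<in>\<^sub>M i' \<or> i = i' \<or> i' \<in>\<^sub>M i" if "r i u" "r i' u'" for i i' u u'
    using Ord_linear r(1) that by blast
  show ?thesis
  proof (cases "\<exists>i j. new_pair U r i j")
    case True
    obtain i j u v where 1: "new_pair U r i j" "\<And>i' j'. i' \<in>\<^sub>M i ==> \<not> new_pair U r i' j'"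
      "\<And>j'. j' \<in>\<^sub>M j ==> \<not> new_pair U r i j'" "r i u" "r j v" "x = kpair u v"
      using assms(3) True unfolding least_new_def by blast
    obtain i' j' u' v' where 2: "new_pair U r i' j'" "\<And>i'' j'. i'' \<in>\<^sub>M i' ==> \<not> new_pair U r i'' j'"
      "\<And>j''. j'' \<in>\<^sub>M j' ==> \<not> new_pair U r i' j''" "r i' u'" "r j' v'" "y = kpair u' v'"
      using assms(4) True unfolding least_new_def by blast
    have "i = i'" using o[OF 1(4) 2(4)] 1(1,2) 2(1,2) by blast
    moreover have "j = j'" using o[OF 1(5) 2(5)] 1(1,3) 2(1,3) \<open>i = i'\<close> by blast
    ultimately show ?thesis using 1(4-) 2(4-) r(2) by blast
  next
    case False
    obtain i u where 1: "new_val G U r i" "\<And>i'. i' \<in>\<^sub>M i ==> \<not> new_val G U r i'" "r i u" "x = G u"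
      using assms(3) False unfolding least_new_def by blast
    obtain i' u' where 2: "new_val G U r i'" "\<And>i''. i'' \<in>\<^sub>M i' ==> \<not> new_val G U r i''" "r i' u'" "y = G u'"
      using assms(4) False unfolding least_new_def by blast
    have "i = i'" using o[OF 1(3) 2(3)] 1(1,2) 2(1,2) by blast
    then show ?thesis using 1(3-) 2(3-) r(2) by blast
  qed
qed

lemma nxt_fun:
  assumes "Ord \<eta>" "\<And>i y z. rel h i y ==> rel h i z ==> y = z"
    "nxt G U lam h \<eta> x" "nxt G U lam h \<eta> y"
  shows "x = y"
proof (cases "\<eta> \<in>\<^sub>M lam")
  case False
  show ?thesis
    by (rule least_new_fun[of "seg h \<eta>" G U])
      (use assms False Ord_mem[OF assms(1)] in \<open>auto simp: nxt_def seg_def\<close>)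
qed (use assms in \<open>simp add: nxt_def\<close>)

end

text \<open>The set \<open>U\<close> confines the enumeration, so that it must come to an end. The
  ordinals below \<open>lam\<close> are listed at their own places and serve as starting
  material.\<close>

locale enumeration = zf +
  fixes G U lam
  assumes tm_G: "tm (\<lambda>e. G (e 0))" and lam: "Ord lam" "subset lam U"
begin

abbreviation "next_val \<equiv> nxt G U lam"
abbreviation "attempt \<equiv> att G U lam"

lemma dfn_seg [dfn_intros]:
  "tm t ==> tm u ==> tm v ==> tm w ==> dfn (\<lambda>e. seg (t e) (u e) (v e) (w e))"
  unfolding seg_def by (intro dfn_intros)

lemma dfn_new_pair [dfn_intros]:
  "tm t ==> tm u ==> tm v ==> tm w ==> dfn (\<lambda>e. new_pair U (seg (t e) (u e)) (v e) (w e))"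
  by (rule dfn4) (unfold new_pair_def new_def, intro dfn_intros)

lemma dfn_new_val [dfn_intros]:
  "tm t ==> tm u ==> tm v ==> dfn (\<lambda>e. new_val G U (seg (t e) (u e)) (v e))"
  by (rule dfn3) (unfold new_val_def new_def, intro dfn_intros tm1[OF tm_G])

lemma dfn_next_val [dfn_intros]:
  "tm t ==> tm u ==> tm v ==> dfn (\<lambda>e. next_val (t e) (u e) (v e))"
  by (rule dfn3) (unfold nxt_def least_new_def, intro dfn_intros tm1[OF tm_G])

lemma dfn_attempt [dfn_intros]: "tm t ==> tm u ==> dfn (\<lambda>e. attempt (t e) (u e))"
  by (rule dfn2) (unfold att_def, intro dfn_intros)

lemma attempt_Ord: "attempt h \<xi> ==> Ord \<xi>"
  and attempt_dom: "attempt h \<xi> ==> rel h \<eta> x ==> \<eta> \<in>\<^sub>M \<xi>"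
  and attempt_total: "attempt h \<xi> ==> \<eta> \<in>\<^sub>M \<xi> ==> \<exists>x. rel h \<eta> x"
  and attempt_fun: "attempt h \<xi> ==> rel h \<eta> x ==> rel h \<eta> y ==> x = y"
  and attempt_next: "attempt h \<xi> ==> rel h \<eta> x ==> next_val h \<eta> x"
  unfolding att_def by (blast, metis kpair_eq_iff, blast+)

lemma attempt_agree:
  assumes "attempt h \<xi>" "attempt h' \<xi>'" "\<eta> \<in>\<^sub>M \<xi>" "\<eta> \<in>\<^sub>M \<xi>'" "rel h \<eta> x"
  shows "rel h' \<eta> x"
proof -
  have "Ord \<eta>" using assms(1,3) attempt_Ord Ord_mem by blast
  then have "\<eta> \<in>\<^sub>M \<xi> --> \<eta> \<in>\<^sub>M \<xi>' --> (\<forall>x. rel h \<eta> x \<longleftrightarrow> rel h' \<eta> x)"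
  proof (rule Ord_induct[rotated])
    show "dfn (\<lambda>e. e 0 \<in>\<^sub>M \<xi> --> e 0 \<in>\<^sub>M \<xi>' --> (\<forall>x. kpair (e 0) x \<in>\<^sub>M h \<longleftrightarrow> kpair (e 0) x \<in>\<^sub>M h'))"
      by (intro dfn_intros dfn_iff)
    fix \<eta> assume \<eta>: "Ord \<eta>" and IH: "\<And>i. i \<in>\<^sub>M \<eta> ==>
      i \<in>\<^sub>M \<xi> --> i \<in>\<^sub>M \<xi>' --> (\<forall>x. rel h i x \<longleftrightarrow> rel h' i x)"
    show "\<eta> \<in>\<^sub>M \<xi> --> \<eta> \<in>\<^sub>M \<xi>' --> (\<forall>x. rel h \<eta> x \<longleftrightarrow> rel h' \<eta> x)"
    proof (intro impI)
      assume *: "\<eta> \<in>\<^sub>M \<xi>" "\<eta> \<in>\<^sub>M \<xi>'"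
      have agree: "rel h i y \<longleftrightarrow> rel h' i y" if "i \<in>\<^sub>M \<eta>" for i y
        using IH[OF that] * that Ord_trans[OF attempt_Ord[OF assms(1)]] Ord_trans[OF attempt_Ord[OF assms(2)]]
        by blast
      obtain x x' where x: "rel h \<eta> x" "rel h' \<eta> x'"
        using * attempt_total assms(1,2) by blast
      have "next_val h' \<eta> x"
        using nxt_cong[OF agree] attempt_next[OF assms(1) x(1)] by blast
      then have "x = x'"
        using attempt_next[OF assms(2) x(2)]
        by (rule nxt_fun[OF \<eta>, rotated]) (rule attempt_fun[OF assms(2)])
      then show "\<forall>x. rel h \<eta> x \<longleftrightarrow> rel h' \<eta> x"
        using x attempt_fun[OF assms(1)] attempt_fun[OF assms(2)] by blast
    qed
  qed
  with assms show ?thesis by blast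
qed

text \<open>Repetitions are excluded: the places below \<open>lam\<close> carry distinct ordinals,
  and every later value is new by the choice of the next value.\<close>

lemma attempt_new:
  assumes "attempt h \<xi>" "rel h \<eta> x"
  shows "x \<in>\<^sub>M U" "i \<in>\<^sub>M \<eta> ==> \<not> rel h i x"
proof -
  have n: "next_val h \<eta> x" using attempt_next[OF assms] .
  have "x \<in>\<^sub>M U \<and> (i \<in>\<^sub>M \<eta> --> \<not> rel h i x)"
  proof (cases "\<eta> \<in>\<^sub>M lam")
    case True
    then have "x = \<eta>" using n by (simp add: nxt_def)
    moreover have "False" if "i \<in>\<^sub>M \<eta>" "rel h i \<eta>"
    proof -
      have "i \<in>\<^sub>M lam" using Ord_trans[OF lam(1) True that(1)] .
      then have "\<eta> = i" using attempt_next[OF assms(1) that(2)] by (simp add: nxt_def)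
      with that show False by simp
    qed
    ultimately show ?thesis using True lam(2) by (auto simp: subset_def)
  next
    case False
    then have "least_new G U (seg h \<eta>) x" using n by (simp add: nxt_def)
    then have "new U (seg h \<eta>) x"
      using attempt_fun[OF assms(1)] unfolding least_new_def new_pair_def new_val_def seg_def by blast
    then show ?thesis unfolding new_def seg_def by blast
  qed
  then show "x \<in>\<^sub>M U" "i \<in>\<^sub>M \<eta> ==> \<not> rel h i x" by auto
qed

definition enum :: "'a => 'a => bool" where
  "enum \<eta> x \<longleftrightarrow> (\<exists>h \<xi>. attempt h \<xi> \<and> rel h \<eta> x)"

lemma dfn_enum [dfn_intros]: "tm t ==> tm u ==> dfn (\<lambda>e. enum (t e) (u e))"
  by (rule dfn2) (unfold enum_def, intro dfn_intros)

lemma enum_Ord: "enum \<eta> x ==> Ord \<eta>"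
  unfolding enum_def using attempt_Ord attempt_dom Ord_mem by blast

lemma enum_fun: "enum \<eta> x ==> enum \<eta> y ==> x = y"
  unfolding enum_def using attempt_agree attempt_dom attempt_fun by metis

lemma enum_attempt: "attempt h \<xi> ==> \<eta> \<in>\<^sub>M \<xi> ==> enum \<eta> x \<longleftrightarrow> rel h \<eta> x"
  unfolding enum_def using attempt_agree attempt_dom by metis

lemma enum_less: "enum \<eta> x ==> i \<in>\<^sub>M \<eta> ==> \<exists>y. enum i y"
  unfolding enum_def using attempt_total attempt_dom attempt_Ord Ord_trans by meson

lemma enum_less_neq:
  assumes "enum \<eta> x" "i \<in>\<^sub>M \<eta>" shows "\<not> enum i x"
proof -
  obtain h \<xi> where h: "attempt h \<xi>" "rel h \<eta> x" using assms(1) by (auto simp: enum_def)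
  then have "i \<in>\<^sub>M \<xi>" using attempt_dom attempt_Ord Ord_trans assms(2) by blast
  then show ?thesis using enum_attempt[OF h(1)] attempt_new(2)[OF h assms(2)] by blast
qed

lemma enum_inj: "enum \<eta> x ==> enum i x ==> \<eta> = i"
  using Ord_linear[OF enum_Ord enum_Ord] enum_less_neq by blast

lemma enum_U: "enum \<eta> x ==> x \<in>\<^sub>M U"
  unfolding enum_def using attempt_new(1) by blast

text \<open>As in Hartogs' argument, an injective enumeration of members of \<open>U\<close> by
  ordinals has a set of places, by replacement. This set is an ordinal \<theta>; if a next value
  existed at \<theta>, then \<theta> would be one of the places.\<close>

lemma ex_max_attempt:
  obtains h \<theta> where "attempt h \<theta>" "\<And>x. \<not> next_val h \<theta> x"
proof -
  obtain V where V: "\<And>x. x \<in>\<^sub>M V \<longleftrightarrow> x \<in>\<^sub>M U \<and> (\<exists>\<eta>. enum \<eta> x)"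
    by (rule separationE, erule that) (intro dfn_intros)
  obtain \<theta> where "\<And>\<eta>. \<eta> \<in>\<^sub>M \<theta> \<longleftrightarrow> (\<exists>x. x \<in>\<^sub>M V \<and> enum \<eta> x)"
  proof -
    have "dfn (\<lambda>e. enum (e 1) (e 0))" by (intro dfn_intros)
    then have "\<exists>b. \<forall>\<eta>. \<eta> \<in>\<^sub>M b \<longleftrightarrow> (\<exists>x. x \<in>\<^sub>M V \<and> enum \<eta> x)"
      by (rule replacement) (use V enum_inj in blast)
    then show thesis using that by blast
  qed
  then have \<theta>: "\<eta> \<in>\<^sub>M \<theta> \<longleftrightarrow> (\<exists>x. enum \<eta> x)" for \<eta> using V enum_U by blast
  have O: "Ord \<theta>" unfolding Ord_def transitive_def subset_def
    using \<theta> enum_less enum_Ord Ord_trans by meson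
  have "dfn (\<lambda>e. enum (e 0) (e 1))" by (intro dfn_intros)
  then obtain h where "\<And>\<eta> x. rel h \<eta> x \<longleftrightarrow> \<eta> \<in>\<^sub>M \<theta> \<and> x \<in>\<^sub>M U \<and> enum \<eta> x"
    and h': "\<And>p. p \<in>\<^sub>M h ==> \<exists>\<eta> x. p = kpair \<eta> x" by (rule ex_relation) blast
  then have h: "rel h \<eta> x \<longleftrightarrow> enum \<eta> x" for \<eta> x using \<theta> enum_U by blast
  have "next_val h \<eta> x" if en: "enum \<eta> x" for \<eta> x
  proof -
    obtain k \<xi> where k: "attempt k \<xi>" "rel k \<eta> x" using en by (auto simp: enum_def)
    have "rel k i y \<longleftrightarrow> rel h i y" if "i \<in>\<^sub>M \<eta>" for i y
      using enum_attempt[OF k(1)] Ord_trans[OF attempt_Ord[OF k(1)] attempt_dom[OF k]] that h by blast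
    from nxt_cong[OF this attempt_next[OF k]] show ?thesis by blast
  qed
  moreover have "\<exists>\<eta> x. \<eta> \<in>\<^sub>M \<theta> \<and> p = kpair \<eta> x" if p: "p \<in>\<^sub>M h" for p
  proof -
    obtain \<eta> x where "p = kpair \<eta> x" using h'[OF p] by blast
    then show ?thesis using p h \<theta> by blast
  qed
  ultimately have att: "attempt h \<theta>" unfolding att_def h \<theta> using O enum_fun by blast
  have False if n: "next_val h \<theta> x" for x
  proof -
    define k where "k = un h (upair (kpair \<theta> x) (kpair \<theta> x))"
    have k: "p \<in>\<^sub>M k \<longleftrightarrow> p \<in>\<^sub>M h \<or> p = kpair \<theta> x" for p by (simp add: k_def)
    have n\<theta>: "\<not> rel h \<theta> y" for y using attempt_dom[OF att] by (metis mem_irrefl)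
    have eq: "rel h i y \<longleftrightarrow> rel k i y" if "i \<noteq> \<theta>" for i y
      using that by (simp add: k)
    have "next_val k \<eta> y" if "rel k \<eta> y" for \<eta> y
    proof (cases "\<eta> = \<theta>")
      case True
      with that n\<theta> have "y = x" by (simp add: k)
      moreover have "rel h i z \<longleftrightarrow> rel k i z" if "i \<in>\<^sub>M \<theta>" for i z
        using eq[of i z] mem_irrefl that by blast
      from nxt_cong[OF this n] have "next_val k \<theta> x" .
      ultimately show ?thesis using True by simp
    next
      case False
      then have *: "rel h \<eta> y" using that by (simp add: k)
      have "i \<noteq> \<theta>" if "i \<in>\<^sub>M \<eta>" for i
        using mem_asym[OF that] attempt_dom[OF att *] by blast
      then show ?thesis using nxt_cong[OF _ attempt_next[OF att *], of k] eq by blast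
    qed
    moreover have "y = z" if "rel k \<eta> y" "rel k \<eta> z" for \<eta> y z
      using that n\<theta> attempt_fun[OF att] by (auto simp: k)
    moreover have "\<exists>y. rel k \<eta> y" if "\<eta> \<in>\<^sub>M succ \<theta>" for \<eta>
      using that attempt_total[OF att] k by (metis mem_succ)
    moreover have "\<exists>\<eta> y. \<eta> \<in>\<^sub>M succ \<theta> \<and> p = kpair \<eta> y" if "p \<in>\<^sub>M k" for p
      using that att unfolding k att_def by (metis mem_succ)
    ultimately have "attempt k (succ \<theta>)" unfolding att_def using Ord_succ[OF O] by blast
    then have "enum \<theta> x" unfolding enum_def using k by blast
    then show False using \<theta> by (metis mem_irrefl)
  qed
  then show thesis using that[OF att] by blast
qed

text \<open>A maximal attempt has no next value. Unfolding this says that the list is closed under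
  pairing and under \<open>G\<close>, as far as the results lie in \<open>U\<close>: otherwise a
  least new pair or value would exist.\<close>

theorem enumeration:
  obtains h \<theta> where "Ord \<theta>" "\<And>\<eta> x. rel h \<eta> x ==> \<eta> \<in>\<^sub>M \<theta>"
    "\<And>\<eta> x y. rel h \<eta> x ==> rel h \<eta> y ==> x = y"
    "\<And>x. x \<in>\<^sub>M lam ==> \<exists>\<eta>. rel h \<eta> x"
    "\<And>\<eta> i u v. rel h \<eta> u ==> rel h i v ==> kpair u v \<in>\<^sub>M U ==> \<exists>j. kpair j (kpair u v) \<in>\<^sub>M h"
    "\<And>\<eta> u. rel h \<eta> u ==> G u \<in>\<^sub>M U ==> \<exists>j. kpair j (G u) \<in>\<^sub>M h"
proof -
  obtain h \<theta> where h: "attempt h \<theta>" and max: "\<And>x. \<not> next_val h \<theta> x" by (rule ex_max_attempt) blast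
  have O: "Ord \<theta>" by (rule attempt_Ord[OF h])
  \<comment> \<open>Below \<open>lam\<close> the place itself would be a next value.\<close>
  have n: "\<not> \<theta> \<in>\<^sub>M lam" using max[of \<theta>] by (auto simp: nxt_def)
  have lam_h: "\<exists>\<eta>. rel h \<eta> x" if x: "x \<in>\<^sub>M lam" for x
  proof -
    have "Ord x" using Ord_mem[OF lam(1) x] .
    then have "x \<in>\<^sub>M \<theta>" using Ord_linear[OF _ O] n x Ord_trans[OF lam(1) x] by blast
    then obtain y where y: "rel h x y" using attempt_total[OF h] by blast
    then have "y = x" using attempt_next[OF h y] x by (simp add: nxt_def)
    with y show ?thesis by blast
  qed
  let ?r = "seg h \<theta>"
  have r: "?r i u \<longleftrightarrow> rel h i u" for i u using attempt_dom[OF h] unfolding seg_def by blast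
  have r_Ord: "Ord i" if "?r i u" for i u using that Ord_mem[OF O] unfolding seg_def by blast
  have no_least: "\<not> least_new G U ?r x" for x using max n unfolding nxt_def by simp
  have no_pair: "\<not> new_pair U ?r i j" for i j
  proof
    assume *: "new_pair U ?r i j"
    obtain i where i: "\<exists>j. new_pair U ?r i j" "\<And>i'. i' \<in>\<^sub>M i ==> \<not> (\<exists>j. new_pair U ?r i' j)"
    proof (rule Ord_least[of "\<lambda>i. \<exists>j. new_pair U ?r i j" i])
      show "dfn (\<lambda>e. \<exists>j. new_pair U ?r (e 0) j)" by (intro dfn_intros)
      show "Ord i" using * r_Ord unfolding new_pair_def by blast
    qed (use * in blast)+
    then obtain j0 where j0: "new_pair U ?r i j0" by blast
    obtain j where j: "new_pair U ?r i j" "\<And>j'. j' \<in>\<^sub>M j ==> \<not> new_pair U ?r i j'"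
    proof (rule Ord_least[of "\<lambda>j. new_pair U ?r i j" j0])
      show "dfn (\<lambda>e. new_pair U ?r i (e 0))" by (intro dfn_intros)
      show "Ord j0" using j0 r_Ord unfolding new_pair_def by blast
    qed (use j0 in blast)+
    obtain u v where "?r i u" "?r j v" using j(1) unfolding new_pair_def by blast
    then have "least_new G U ?r (kpair u v)" unfolding least_new_def using i(2) j by blast
    with no_least show False by blast
  qed
  have no_val: "\<not> new_val G U ?r i" for i
  proof
    assume *: "new_val G U ?r i"
    obtain i where i: "new_val G U ?r i" "\<And>i'. i' \<in>\<^sub>M i ==> \<not> new_val G U ?r i'"
    proof (rule Ord_least[of "\<lambda>i. new_val G U ?r i" i])
      show "dfn (\<lambda>e. new_val G U ?r (e 0))" by (intro dfn_intros)
      show "Ord i" using * r_Ord unfolding new_val_def by blast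
    qed (use * in blast)+
    obtain u where "?r i u" using i(1) unfolding new_val_def by blast
    then have "least_new G U ?r (G u)" unfolding least_new_def using i no_pair by blast
    with no_least show False by blast
  qed
  show thesis
  proof
    show "\<exists>j. rel h j (kpair u v)" if "rel h \<eta> u" "rel h i v" "kpair u v \<in>\<^sub>M U" for \<eta> i u v
      using no_pair[of \<eta> i] that unfolding new_pair_def new_def r by blast
    show "\<exists>j. rel h j (G u)" if "rel h \<eta> u" "G u \<in>\<^sub>M U" for \<eta> u
      using no_val[of \<eta>] that unfolding new_val_def new_def r by blast
  qed (use O attempt_dom[OF h] attempt_fun[OF h] lam_h in blast)+
qed

end

section \<open>Generation of the constructible sets and choice from V = L\<close>

context zf
begin

lemma the_set_eq: "(\<And>x. x \<in>\<^sub>M b \<longleftrightarrow> P x) ==> the_set P = b"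
  using mem_the_set[of P] by (intro ext) blast

lemma ap_iff: "fun_on f d ==> x \<in>\<^sub>M d ==> rel f x y \<longleftrightarrow> ap f x = y"
proof -
  assume "fun_on f d" "x \<in>\<^sub>M d"
  then have 1: "\<exists>!y. rel f x y" unfolding fun_on_def by blast
  from theI'[OF this] have "kpair x (ap f x) \<in>\<^sub>M f" unfolding ap_def .
  with 1 show "rel f x y \<longleftrightarrow> ap f x = y" by blast
qed

lemma fun_on_fun: "fun_on f d ==> rel f x y ==> x \<in>\<^sub>M d"
  unfolding fun_on_def by (metis kpair_eq_iff)

lemma tuple_iff: "tuple a n s \<longleftrightarrow> fun_on s n \<and> (\<forall>i y. rel s i y --> y \<in>\<^sub>M a)"
  unfolding tuple_def using ap_iff fun_on_fun by metis

lemma snoc_eq: "snoc n s x = un s (upair (kpair n x) (kpair n x))"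
  unfolding snoc_def by (rule the_set_eq) auto

lemma mem_snoc [simp]: "p \<in>\<^sub>M snoc n s x \<longleftrightarrow> p \<in>\<^sub>M s \<or> p = kpair n x"
  by (simp add: snoc_eq)

lemma dfn_fun_on [dfn_intros]: "tm t ==> tm u ==> dfn (\<lambda>e. fun_on (t e) (u e))"
  by (rule dfn2) (unfold fun_on_def Ex1_def, intro dfn_intros)

lemma dfn_tuple [dfn_intros]: "tm t ==> tm u ==> tm v ==> dfn (\<lambda>e. tuple (t e) (u e) (v e))"
  by (rule dfn3) (unfold tuple_iff, intro dfn_intros)

lemma tm_un [dfn_intros]: "tm t ==> tm u ==> tm (\<lambda>e. un (t e) (u e))"
  unfolding un_def by (intro dfn_intros)

lemma tm_snoc [dfn_intros]: "tm t ==> tm u ==> tm v ==> tm (\<lambda>e. snoc (t e) (u e) (v e))"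
  unfolding snoc_eq by (intro dfn_intros)

lemma tuple_snocE:
  assumes "tuple a (succ n) s"
  obtains t y where "tuple a n t" "y \<in>\<^sub>M a" "s = snoc n t y"
proof -
  have f: "fun_on s (succ n)" and a: "\<And>i y. rel s i y ==> y \<in>\<^sub>M a"
    using assms unfolding tuple_iff by blast+
  obtain t where t: "\<And>p. p \<in>\<^sub>M t \<longleftrightarrow> p \<in>\<^sub>M s \<and> (\<exists>i y. i \<in>\<^sub>M n \<and> p = kpair i y)"
    by (rule separationE, erule that) (intro dfn_intros)
  obtain y where y: "rel s n y" using f unfolding fun_on_def by (metis mem_succ)
  show thesis
  proof
    have "\<exists>!y. rel t i y" if "i \<in>\<^sub>M n" for i
      using f that unfolding fun_on_def t by (metis kpair_eq_iff mem_succ)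
    then have "fun_on t n" unfolding fun_on_def using t by blast
    then show "tuple a n t" unfolding tuple_iff using a t by blast
    show "y \<in>\<^sub>M a" using a y .
    show "s = snoc n t y"
    proof (rule ext)
      fix p show "p \<in>\<^sub>M s \<longleftrightarrow> p \<in>\<^sub>M snoc n t y"
        using f y unfolding fun_on_def mem_snoc t by (metis mem_succ)
    qed
  qed
qed

text \<open>Finitely many power sets over a transitive set are a substitute for ranks: they bound
  the pairs, tuples and codes that occur.\<close>

definition level :: "'v => nat => 'v" where
  "level T m = (pow ^^ m) T"

lemma level_Suc: "x \<in>\<^sub>M level T (Suc m) \<longleftrightarrow> (\<forall>y. y \<in>\<^sub>M x --> y \<in>\<^sub>M level T m)"
  by (simp add: level_def subset_def)

lemma level_transitive: "transitive T ==> transitive (level T m)"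
proof (induction m)
  case 0
  then show ?case by (simp add: level_def)
next
  case (Suc m)
  then show ?case unfolding transitive_def subset_def level_Suc by blast
qed

lemma level_mono:
  assumes "transitive T" "x \<in>\<^sub>M level T m" "m \<le> n" shows "x \<in>\<^sub>M level T n"
  using assms(3,2)
proof (induction rule: dec_induct)
  case (step n)
  then show ?case using level_transitive[OF assms(1)] unfolding level_Suc transitive_def subset_def by blast
qed

lemma level_kpair: "x \<in>\<^sub>M level T m ==> y \<in>\<^sub>M level T m ==> kpair x y \<in>\<^sub>M level T (Suc (Suc m))"
  by (auto simp: level_Suc kpair_def)

definition num :: "nat => 'v" where
  "num k = (succ ^^ k) empty"

lemma num_eq_iff [simp]: "num j = num k \<longleftrightarrow> j = k"
proof (induction j arbitrary: k)
  case 0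
  show ?case by (cases k) (simp_all add: num_def)
next
  case (Suc j)
  then show ?case by (cases k) (auto simp: num_def dest: succ_inject)
qed

lemma num_omega: "num k \<in>\<^sub>M omega"
  by (induction k) (simp_all add: num_def succ_omega)

definition code :: "nat => 'v => 'v => 'v => 'v => 'v" where
  "code k a n i j = kpair (num k) (kpair a (kpair n (kpair i j)))"

lemma code_eq_iff [simp]:
  "code k a n i j = code k' a' n' i' j' \<longleftrightarrow> k = k' \<and> a = a' \<and> n = n' \<and> i = i' \<and> j = j'"
  by (simp add: code_def)

text \<open>With \<open>g\<close> a sequence of the \<open>L\<^sub>\<beta>\<close>, operation \<open>0\<close> yields \<open>L\<^sub>a\<close>, operations \<open>1\<close> to \<open>5\<close> are the closure
  conditions of \<open>Df_closed\<close>, \<open>6\<close> builds tuples and \<open>7\<close> definable subsets.\<close>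

definition op_mem :: "'v => 'v => 'v => bool" where
  "op_mem g q x \<longleftrightarrow> (\<exists>a n i j.
     (q = code 0 a n i j \<and> (\<exists>l. rel g a l \<and> x \<in>\<^sub>M l)) \<or>
     (q = code 1 a n i j \<and> tuple a n x \<and> (\<exists>u v. rel x i u \<and> rel x j v \<and> u \<in>\<^sub>M v)) \<or>
     (q = code 2 a n i j \<and> tuple a n x \<and> (\<exists>u. rel x i u \<and> rel x j u)) \<or>
     (q = code 3 a n i j \<and> tuple a n x \<and> \<not> x \<in>\<^sub>M i) \<or>
     (q = code 4 a n i j \<and> x \<in>\<^sub>M i \<and> x \<in>\<^sub>M j) \<or>
     (q = code 5 a n i j \<and> tuple a n x \<and> (\<exists>y. y \<in>\<^sub>M a \<and> snoc n x y \<in>\<^sub>M i)) \<or>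
     (q = code 6 a n i j \<and> (x \<in>\<^sub>M i \<or> x = kpair n j)) \<or>
     (q = code 7 a n i j \<and> x \<in>\<^sub>M a \<and> snoc n i x \<in>\<^sub>M j))"

lemma dfn_op_mem [dfn_intros]: "tm t ==> tm u ==> dfn (\<lambda>e. op_mem g (t e) (u e))"
  by (rule dfn2) (unfold op_mem_def code_def, intro dfn_intros)

text \<open>Cutting down to \<open>U\<close> yields a set for every \<open>q\<close> without a
  separate bound for each operation.\<close>

definition opval :: "'v => 'v => 'v => 'v" where
  "opval g U q = the_set (\<lambda>x. x \<in>\<^sub>M U \<and> op_mem g q x)"

lemma mem_opval: "x \<in>\<^sub>M opval g U q \<longleftrightarrow> x \<in>\<^sub>M U \<and> op_mem g q x"
  unfolding opval_def by (rule mem_the_set, rule separation) (intro dfn_intros)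

lemma tm_opval: "tm (\<lambda>e. opval g U (e 0))"
  unfolding opval_def
  by (rule tm_the_set[OF separation]) (intro dfn_intros)+

text \<open>The operations \<open>opval\<close> generate \<open>L\<^sub>\<alpha>\<close> from the ordinals below \<open>\<alpha>\<close> and \<open>\<omega>\<close>; sets are listed in the
  order of generation.\<close>

theorem ex_listing:
  assumes V_eq_L
  obtains h \<theta> where "Ord \<theta>" "\<And>\<eta> x. rel h \<eta> x ==> \<eta> \<in>\<^sub>M \<theta>"
    "\<And>\<eta> x y. rel h \<eta> x ==> rel h \<eta> y ==> x = y"
    "\<And>x. x \<in>\<^sub>M S ==> \<exists>\<eta>. rel h \<eta> x"
proof -
  obtain \<alpha> g where \<alpha>: "Ord \<alpha>" "L_sequence \<alpha> g" "S \<in>\<^sub>M ap g \<alpha>"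
    using assms unfolding V_eq_L_def by blast
  define L where "L = ap g"
  have g: "rel g \<beta> l \<longleftrightarrow> L \<beta> = l" if "\<beta> \<in>\<^sub>M succ \<alpha>" for \<beta> l
    unfolding L_def by (rule ap_iff) (use \<alpha>(2) that in \<open>auto simp: L_sequence_def\<close>)
  have L: "x \<in>\<^sub>M L \<beta> \<longleftrightarrow> (\<exists>\<gamma>. \<gamma> \<in>\<^sub>M \<beta> \<and> definable_subset (L \<gamma>) x)" if "\<beta> \<in>\<^sub>M succ \<alpha>" for x \<beta>
    using \<alpha>(2) that unfolding L_def L_sequence_def by blast
  obtain T where T: "transitive T" "un (upair \<alpha> g) (upair omega omega) \<in>\<^sub>M T" by (rule ex_transitive)
  have Tt: "x \<in>\<^sub>M T" if "x \<in>\<^sub>M y" "y \<in>\<^sub>M T" for x y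
    using T(1) that unfolding transitive_def subset_def by blast
  have T': "\<alpha> \<in>\<^sub>M T" "g \<in>\<^sub>M T" "omega \<in>\<^sub>M T" using Tt[OF _ T(2)] by auto
  let ?V = "level T"
  have V0: "?V 0 = T" by (simp add: level_def)
  have Vm: "x \<in>\<^sub>M ?V n" if "x \<in>\<^sub>M ?V m" "m \<le> n" for x m n using level_mono[OF T(1) that] .
  have VT: "x \<in>\<^sub>M ?V n" if "x \<in>\<^sub>M T" for x n using Vm[of x 0 n] that V0 by simp
  have omT: "n \<in>\<^sub>M T" if "n \<in>\<^sub>M omega" for n using Tt[OF that T'(3)] .
  have LT: "L \<beta> \<in>\<^sub>M T" if "\<beta> \<in>\<^sub>M succ \<alpha>" for \<beta>
  proof -
    have "kpair \<beta> (L \<beta>) \<in>\<^sub>M T" using g[OF that] Tt[OF _ T'(2)] by blast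
    moreover have "upair \<beta> (L \<beta>) \<in>\<^sub>M kpair \<beta> (L \<beta>)" by (simp add: kpair_def)
    ultimately have "upair \<beta> (L \<beta>) \<in>\<^sub>M T" using Tt by blast
    then show ?thesis using Tt[of "L \<beta>" "upair \<beta> (L \<beta>)"] by simp
  qed
  \<comment> \<open>Over members of \<open>T\<close>, pairs are at level 2, tuples at 3 and sets of
    tuples at 4. A code nests four pairs over arguments of level 4, and each pairing costs two
    levels.\<close>
  define U where "U = ?V 12"
  define lam where "lam = un \<alpha> omega"
  interpret enumeration mem "opval g U" U lam
  proof
    show "tm (\<lambda>e. opval g U (e 0))" by (rule tm_opval)
    show "Ord lam" unfolding lam_def using \<alpha>(1) Ord_omega by (rule Ord_un)
    show "subset lam U" unfolding lam_def subset_def U_def using Tt T' VT by auto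
  qed
  obtain h \<theta> where h: "Ord \<theta>" "\<And>\<eta> x. rel h \<eta> x ==> \<eta> \<in>\<^sub>M \<theta>"
    "\<And>\<eta> x y. rel h \<eta> x ==> rel h \<eta> y ==> x = y"
    "\<And>x. x \<in>\<^sub>M lam ==> \<exists>\<eta>. rel h \<eta> x"
    "\<And>\<eta> i u v. rel h \<eta> u ==> rel h i v ==> kpair u v \<in>\<^sub>M U ==> \<exists>j. kpair j (kpair u v) \<in>\<^sub>M h"
    "\<And>\<eta> u. rel h \<eta> u ==> opval g U u \<in>\<^sub>M U ==> \<exists>j. kpair j (opval g U u) \<in>\<^sub>M h"
    by (rule enumeration) blast
  define X where "X x \<longleftrightarrow> (\<exists>\<eta>. rel h \<eta> x)" for x
  have X0: "dfn (\<lambda>e. X (e 0))" unfolding X_def by (intro dfn_intros)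
  note [dfn_intros] = dfn1[OF X0]
  have X_om: "X n" if "n \<in>\<^sub>M omega" for n using h(4)[of n] that unfolding X_def lam_def by simp
  have X_pair: "X (kpair u v)" if "X u" "X v" "kpair u v \<in>\<^sub>M U" for u v using h(5) that unfolding X_def by blast
  \<comment> \<open>The code of an operation on listed arguments is listed by closure under pairing,
    and then its value by closure under \<open>opval\<close>.\<close>
  have X_op: "X r" if "X a" "X n" "X i" "X j" "a \<in>\<^sub>M ?V 4" "n \<in>\<^sub>M ?V 4" "i \<in>\<^sub>M ?V 4" "j \<in>\<^sub>M ?V 4"
    and r: "r \<in>\<^sub>M ?V 4" "\<And>x. x \<in>\<^sub>M r \<longleftrightarrow> op_mem g (code k a n i j) x" for k a n i j r
  proof -
    have k: "num k \<in>\<^sub>M ?V 10" "X (num k)" using num_omega X_om omT VT by blast+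
    have 1: "kpair i j \<in>\<^sub>M ?V 6" using level_kpair[OF that(7,8)] by (simp add: eval_nat_numeral)
    have 2: "kpair n (kpair i j) \<in>\<^sub>M ?V 8"
      using level_kpair[OF Vm[OF that(6), of 6] 1] by (simp add: eval_nat_numeral)
    have 3: "kpair a (kpair n (kpair i j)) \<in>\<^sub>M ?V 10"
      using level_kpair[OF Vm[OF that(5), of 8] 2] by (simp add: eval_nat_numeral)
    have 4: "code k a n i j \<in>\<^sub>M ?V 12"
      using level_kpair[OF k(1) 3] by (simp add: eval_nat_numeral code_def)
    have "X (code k a n i j)" unfolding code_def
      by (intro X_pair that k(2)) (use Vm[OF 1, of 12] Vm[OF 2, of 12] Vm[OF 3, of 12] 4 in \<open>simp_all add: U_def code_def\<close>)
    moreover have "opval g U (code k a n i j) = r"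
    proof (rule ext)
      fix x
      have "x \<in>\<^sub>M U" if "x \<in>\<^sub>M r"
        using that Vm[OF r(1), of 12] level_transitive[OF T(1)] unfolding U_def transitive_def subset_def by simp
      then show "x \<in>\<^sub>M opval g U (code k a n i j) \<longleftrightarrow> x \<in>\<^sub>M r" unfolding mem_opval r(2)[symmetric] by blast
    qed
    moreover have "r \<in>\<^sub>M U" using Vm[OF r(1), of 12] by (simp add: U_def)
    ultimately show ?thesis using h(6) unfolding X_def by blast
  qed
  have X_e: "X empty" using X_om empty_omega by blast
  have X_L: "X (L \<gamma>)" if "\<gamma> \<in>\<^sub>M \<alpha>" for \<gamma>
  proof (rule X_op[of \<gamma> empty empty empty _ 0])
    show "X \<gamma>" using h(4)[of \<gamma>] that unfolding X_def lam_def by simp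
    have "\<gamma> \<in>\<^sub>M succ \<alpha>" using that by simp
    then show "x \<in>\<^sub>M L \<gamma> \<longleftrightarrow> op_mem g (code 0 \<gamma> empty empty empty) x" for x
      by (simp add: op_mem_def g)
    show "\<gamma> \<in>\<^sub>M ?V 4" using Tt[OF that T'(1)] VT by blast
    show "L \<gamma> \<in>\<^sub>M ?V 4" using that LT VT by simp
  qed (use X_e omT VT empty_omega in blast)+
  \<comment> \<open>Induction along the hierarchy; quantifying over the value l of g keeps the
    statement definable.\<close>
  have main: "\<beta> \<in>\<^sub>M succ \<alpha> --> (\<forall>l. rel g \<beta> l --> (\<forall>x. x \<in>\<^sub>M l --> X x))" if "Ord \<beta>" for \<beta>
    using that
  proof (rule Ord_induct[rotated])
    show "dfn (\<lambda>e. e 0 \<in>\<^sub>M succ \<alpha> --> (\<forall>l. kpair (e 0) l \<in>\<^sub>M g --> (\<forall>x. x \<in>\<^sub>M l --> X x)))"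
      by (intro dfn_intros)
    fix \<beta> assume IH: "\<And>\<gamma>. \<gamma> \<in>\<^sub>M \<beta> ==> \<gamma> \<in>\<^sub>M succ \<alpha> --> (\<forall>l. rel g \<gamma> l --> (\<forall>x. x \<in>\<^sub>M l --> X x))"
    show "\<beta> \<in>\<^sub>M succ \<alpha> --> (\<forall>l. rel g \<beta> l --> (\<forall>x. x \<in>\<^sub>M l --> X x))"
    proof (intro impI allI)
      fix l x assume \<beta>: "\<beta> \<in>\<^sub>M succ \<alpha>" and "rel g \<beta> l" "x \<in>\<^sub>M l"
      then have "x \<in>\<^sub>M L \<beta>" using g by simp
      then obtain \<gamma> where \<gamma>: "\<gamma> \<in>\<^sub>M \<beta>" "definable_subset (L \<gamma>) x" using L[OF \<beta>] by blast
      have \<gamma>\<alpha>: "\<gamma> \<in>\<^sub>M \<alpha>" using \<gamma>(1) \<beta> Ord_trans[OF \<alpha>(1)] by auto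
      define a where "a = L \<gamma>"
      have Xa: "X a" unfolding a_def using X_L[OF \<gamma>\<alpha>] .
      have aT: "a \<in>\<^sub>M T" unfolding a_def using LT \<gamma>\<alpha> by simp
      have X_mem: "X y" if "y \<in>\<^sub>M a" for y
        using IH[OF \<gamma>(1)] g[of \<gamma>] \<gamma>\<alpha> that unfolding a_def by simp
      have s3: "s \<in>\<^sub>M ?V 3" if "tuple a n s" "n \<in>\<^sub>M omega" for s n
      proof -
        have "p \<in>\<^sub>M ?V (Suc (Suc 0))" if ps: "p \<in>\<^sub>M s" for p
        proof -
          obtain i y where p: "i \<in>\<^sub>M n" "p = kpair i y"
            using \<open>tuple a n s\<close> ps unfolding tuple_def fun_on_def by blast
          then have "y \<in>\<^sub>M a" using \<open>tuple a n s\<close> ps unfolding tuple_iff by blast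
          then have "i \<in>\<^sub>M T" "y \<in>\<^sub>M T" using p(1) \<open>n \<in>\<^sub>M omega\<close> Tt omT aT by blast+
          then show ?thesis unfolding p(2) using level_kpair V0 by metis
        qed
        then have "s \<in>\<^sub>M ?V (Suc (Suc (Suc 0)))" unfolding level_Suc[of s] by blast
        then show ?thesis by (simp add: eval_nat_numeral)
      qed
      have v4: "r \<in>\<^sub>M ?V 4" if "\<And>s. s \<in>\<^sub>M r ==> s \<in>\<^sub>M ?V 3" for r
        using that level_Suc[of r T 3] by (simp add: eval_nat_numeral)
      have v3: "s \<in>\<^sub>M ?V 3" if "r \<in>\<^sub>M ?V 4" "s \<in>\<^sub>M r" for r s
        using that level_Suc[of r T 3] by (simp add: eval_nat_numeral)
      have X_tuple: "\<forall>s. tuple a n s --> X s" if "n \<in>\<^sub>M omega" for n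
      proof (rule omega_induct[where P="\<lambda>n. \<forall>s. tuple a n s --> X s"])
        show "dfn (\<lambda>e. \<forall>s. tuple a (e 0) s --> X s)" by (intro dfn_intros)
        have "s = empty" if "tuple a empty s" for s
          using that unfolding tuple_def fun_on_def by (intro ext) auto
        then show "\<forall>s. tuple a empty s --> X s" using X_e by blast
        fix n assume n: "n \<in>\<^sub>M omega" "\<forall>s. tuple a n s --> X s"
        show "\<forall>s. tuple a (succ n) s --> X s"
        proof (intro allI impI)
          fix s assume s: "tuple a (succ n) s"
          obtain t y where t: "tuple a n t" "y \<in>\<^sub>M a" "s = snoc n t y" by (rule tuple_snocE[OF s]) blast
          show "X s"
          proof (rule X_op[of empty n t y _ 6])
            show "x \<in>\<^sub>M s \<longleftrightarrow> op_mem g (code 6 empty n t y) x" for x by (simp add: op_mem_def t(3))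
            show "t \<in>\<^sub>M ?V 4" using s3[OF t(1) n(1)] Vm[of t 3 4] by simp
            show "s \<in>\<^sub>M ?V 4" using s3[OF s succ_omega[OF n(1)]] Vm[of s 3 4] by simp
          qed (use X_e n t X_om X_mem omT VT Tt aT empty_omega in blast)+
        qed
      qed (rule that)
      obtain n s R where R: "n \<in>\<^sub>M omega" "tuple a n s" "Df a (succ n) R"
        "\<And>y. y \<in>\<^sub>M x \<longleftrightarrow> y \<in>\<^sub>M a \<and> snoc n s y \<in>\<^sub>M R"
        using \<gamma>(2) unfolding definable_subset_def a_def by blast
      \<comment> \<open>All pairs of a number and a listed relation. Since \<open>Df\<close> is an
        intersection over closed sets, it is enough that this set is closed; no induction on
        formulas inside the model is needed.\<close>
      obtain D where
        "\<And>p. p \<in>\<^sub>M D \<longleftrightarrow> p \<in>\<^sub>M U \<and> (\<exists>n R. n \<in>\<^sub>M omega \<and> R \<in>\<^sub>M ?V 4 \<and> X R \<and> p = kpair n R)"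
        by (rule separationE, erule that) (intro dfn_intros)
      moreover have "kpair n R \<in>\<^sub>M U" if "n \<in>\<^sub>M omega" "R \<in>\<^sub>M ?V 4" for n R
        using Vm[OF level_kpair[OF VT[OF omT[OF that(1)], of 4] that(2)], of 12] by (simp add: U_def)
      ultimately have D: "kpair n R \<in>\<^sub>M D \<longleftrightarrow> n \<in>\<^sub>M omega \<and> R \<in>\<^sub>M ?V 4 \<and> X R" for n R by auto
      have D_op: "kpair n (the_set P) \<in>\<^sub>M D"
        if "n \<in>\<^sub>M omega" "X n'" "n' \<in>\<^sub>M T" "X i" "i \<in>\<^sub>M ?V 4" "X j" "j \<in>\<^sub>M ?V 4"
          "\<And>s. P s ==> s \<in>\<^sub>M ?V 3" "\<And>s. P s \<longleftrightarrow> op_mem g (code k a n' i j) s" for n n' i j k P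
      proof -
        have P: "s \<in>\<^sub>M the_set P \<longleftrightarrow> P s" for s
          by (rule mem_the_set, rule set_of_bounded[of _ "?V 3"])
            (use that(8) in \<open>auto simp: that(9) intro!: dfn_intros\<close>)
        have 4: "the_set P \<in>\<^sub>M ?V 4" using P that(8) by (blast intro: v4)
        have "X (the_set P)"
          by (rule X_op[of a n' i j _ k]) (use that(1-7) Xa aT VT 4 in \<open>auto simp: P that(9)\<close>)
        then show ?thesis using D that(1) 4 by blast
      qed
      have "Df_closed a D" unfolding Df_closed_def
      proof (intro allI impI conjI)
        fix n assume n: "n \<in>\<^sub>M omega"
        have Xn: "X n" "n \<in>\<^sub>M T" using X_om omT n by blast+
        {
          fix i j assume ij: "i \<in>\<^sub>M n" "j \<in>\<^sub>M n"
          then have "i \<in>\<^sub>M omega" "j \<in>\<^sub>M omega" using n omega_transitive by blast+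
          then have 1: "X i" "X j" "i \<in>\<^sub>M ?V 4" "j \<in>\<^sub>M ?V 4" using X_om omT VT by blast+
          have ap: "ap s i = u \<longleftrightarrow> rel s i u" "ap s j = u \<longleftrightarrow> rel s j u" if "tuple a n s" for s u
            using ap_iff[of s n] that ij unfolding tuple_def by blast+
          have "tuple a n s \<and> ap s i \<in>\<^sub>M ap s j \<longleftrightarrow> op_mem g (code 1 a n i j) s" for s
            by (auto simp: op_mem_def ap[symmetric])
          then show "kpair n (the_set (\<lambda>s. tuple a n s \<and> ap s i \<in>\<^sub>M ap s j)) \<in>\<^sub>M D"
            by (intro D_op[OF n Xn 1(1,3) 1(2,4)]) (use s3 n in blast)+
          have "tuple a n s \<and> ap s i = ap s j \<longleftrightarrow> op_mem g (code 2 a n i j) s" for s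
            by (auto simp: op_mem_def ap[symmetric])
          then show "kpair n (the_set (\<lambda>s. tuple a n s \<and> ap s i = ap s j)) \<in>\<^sub>M D"
            by (intro D_op[OF n Xn 1(1,3) 1(2,4)]) (use s3 n in blast)+
        }
        fix R assume R: "kpair n R \<in>\<^sub>M D"
        show "kpair n (the_set (\<lambda>s. tuple a n s \<and> \<not> s \<in>\<^sub>M R)) \<in>\<^sub>M D"
          by (rule D_op[where i=R and j=R and k=3, OF n Xn]) (use R D s3 n in \<open>auto simp: op_mem_def\<close>)
        fix S assume S: "kpair n S \<in>\<^sub>M D"
        show "kpair n (the_set (\<lambda>s. s \<in>\<^sub>M R \<and> s \<in>\<^sub>M S)) \<in>\<^sub>M D"
          by (rule D_op[where i=R and j=S and k=4, OF n Xn]) (use R S D v3 in \<open>auto simp: op_mem_def\<close>)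
      next
        fix n R assume n: "n \<in>\<^sub>M omega" and R: "kpair (succ n) R \<in>\<^sub>M D"
        have Xn: "X n" "n \<in>\<^sub>M T" using X_om omT n by blast+
        show "kpair n (the_set (\<lambda>s. tuple a n s \<and> (\<exists>x. x \<in>\<^sub>M a \<and> snoc n s x \<in>\<^sub>M R))) \<in>\<^sub>M D"
          by (rule D_op[where i=R and j=R and k=5, OF n Xn]) (use R D s3 n in \<open>auto simp: op_mem_def\<close>)
      qed
      then have "kpair (succ n) R \<in>\<^sub>M D" using R(3) unfolding Df_def by blast
      then have XR: "X R" "R \<in>\<^sub>M ?V 4" using D by blast+
      have s4: "X s" "s \<in>\<^sub>M ?V 4" using X_tuple R(1,2) s3 Vm[of s 3 4] by auto
      show "X x"
      proof (rule X_op[of a n s R _ 7])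
        show "y \<in>\<^sub>M x \<longleftrightarrow> op_mem g (code 7 a n s R) y" for y by (simp add: op_mem_def R(4))
        have "y \<in>\<^sub>M ?V 3" if "y \<in>\<^sub>M x" for y using that R(4) Tt aT VT by blast
        then show "x \<in>\<^sub>M ?V 4" by (rule v4)
      qed (use Xa aT VT X_om omT R(1) s4 XR in blast)+
    qed
  qed
  \<comment> \<open>S appears in the hierarchy as a definable subset of an earlier stage, so its
    members belong to that stage and are listed.\<close>
  obtain \<gamma> where \<gamma>: "\<gamma> \<in>\<^sub>M \<alpha>" "definable_subset (L \<gamma>) S"
    using L[of \<alpha> S] \<alpha>(3) unfolding L_def by auto
  have "X x" if "x \<in>\<^sub>M S" for x
  proof -
    have "x \<in>\<^sub>M L \<gamma>" using \<gamma>(2) that unfolding definable_subset_def by blast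
    then show ?thesis using main[of \<gamma>] Ord_mem[OF \<alpha>(1) \<gamma>(1)] \<gamma>(1) g[of \<gamma>] by simp
  qed
  with h(1-3) show thesis unfolding X_def by (rule that)
qed

text \<open>Among the admissible values, all in S, the one listed earliest is taken. The listing
  need not be injective: the least place determines the value.\<close>

theorem choice:
  assumes V_eq_L "dfn (\<lambda>e. Q (e 0) (e 1))" "\<And>p y. Q p y ==> y \<in>\<^sub>M S"
  obtains c where "\<And>p y z. rel c p y ==> rel c p z ==> y = z"
    "\<And>p y. rel c p y ==> Q p y"
    "\<And>p y. p \<in>\<^sub>M D ==> Q p y ==> \<exists>z. rel c p z"
proof -
  note [dfn_intros] = dfn2[OF assms(2)]
  obtain h \<theta> where h: "Ord \<theta>" "\<And>\<eta> x. rel h \<eta> x ==> \<eta> \<in>\<^sub>M \<theta>"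
    "\<And>\<eta> x y. rel h \<eta> x ==> rel h \<eta> y ==> x = y"
    "\<And>x. x \<in>\<^sub>M S ==> \<exists>\<eta>. rel h \<eta> x" by (rule ex_listing[OF assms(1), where S=S]) blast
  define R where "R p \<eta> \<longleftrightarrow> (\<exists>y. rel h \<eta> y \<and> Q p y)" for p \<eta>
  have R0: "dfn (\<lambda>e. R (e 0) (e 1))" unfolding R_def by (intro dfn_intros)
  note [dfn_intros] = dfn2[OF R0]
  define M where "M p y \<longleftrightarrow> (\<exists>\<eta>. rel h \<eta> y \<and> Q p y \<and> (\<forall>i. i \<in>\<^sub>M \<eta> --> \<not> R p i))" for p y
  have "dfn (\<lambda>e. M (e 0) (e 1))" unfolding M_def by (intro dfn_intros)
  then obtain c where "\<And>p y. rel c p y \<longleftrightarrow> p \<in>\<^sub>M D \<and> y \<in>\<^sub>M S \<and> M p y" by (rule ex_relation) blast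
  then have c: "rel c p y \<longleftrightarrow> p \<in>\<^sub>M D \<and> M p y" for p y using assms(3) unfolding M_def by blast
  show thesis
  proof
    show "y = z" if yz: "rel c p y" "rel c p z" for p y z
    proof -
      obtain \<eta> i where "rel h \<eta> y" "Q p y" "\<forall>i. i \<in>\<^sub>M \<eta> --> \<not> R p i"
        "rel h i z" "Q p z" "\<forall>j. j \<in>\<^sub>M i --> \<not> R p j"
        using yz unfolding c M_def by blast
      moreover from this have "\<eta> = i" using Ord_linear[of \<eta> i] Ord_mem[OF h(1) h(2)] unfolding R_def by blast
      ultimately show ?thesis using h(3) by blast
    qed
    show "Q p y" if "rel c p y" for p y using that unfolding c M_def by blast
    show "\<exists>z. rel c p z" if p: "p \<in>\<^sub>M D" and Q: "Q p y" for p y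
    proof -
      obtain \<eta>0 where \<eta>0: "rel h \<eta>0 y" using h(4)[OF assms(3)[OF Q]] by blast
      obtain \<eta> where \<eta>: "R p \<eta>" "\<And>i. i \<in>\<^sub>M \<eta> ==> \<not> R p i"
      proof (rule Ord_least[of "R p" \<eta>0])
        show "dfn (\<lambda>e. R p (e 0))" by (intro dfn_intros)
        show "Ord \<eta>0" using Ord_mem[OF h(1) h(2)[OF \<eta>0]] .
        show "R p \<eta>0" using \<eta>0 Q unfolding R_def by blast
      qed blast
      then show ?thesis unfolding c M_def R_def using p by blast
    qed
  qed
qed

end

section \<open>Realizability algebras inside a model of ZF\<close>

locale zf_realizability = zf mem + realizability_structure mem A
  for mem :: "'v => 'v => bool" (infix \<open>\<in>\<^sub>M\<close> 50) and A :: "'v ralg" +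
  assumes ra: realizability_algebra
begin

lemma closed [simp, intro]:
  shows app_mem: "\<xi> \<in>\<^sub>M \<Lambda> ==> \<eta> \<in>\<^sub>M \<Lambda> ==> \<xi> \<bullet> \<eta> \<in>\<^sub>M \<Lambda>"
    and push_mem: "\<xi> \<in>\<^sub>M \<Lambda> ==> \<pi> \<in>\<^sub>M \<Pi> ==> \<xi> \<cdot> \<pi> \<in>\<^sub>M \<Pi>"
    and proc_mem: "\<xi> \<in>\<^sub>M \<Lambda> ==> \<pi> \<in>\<^sub>M \<Pi> ==> \<xi> \<star> \<pi> \<in>\<^sub>M Procs A"
    and kont_mem: "\<pi> \<in>\<^sub>M \<Pi> ==> kont A \<pi> \<in>\<^sub>M \<Lambda>"
    and instr_mem: "instr_B A \<in>\<^sub>M \<Lambda>" "instr_C A \<in>\<^sub>M \<Lambda>" "instr_I A \<in>\<^sub>M \<Lambda>" "instr_K A \<in>\<^sub>M \<Lambda>"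
      "instr_W A \<in>\<^sub>M \<Lambda>" "instr_cc A \<in>\<^sub>M \<Lambda>"
  using ra unfolding realizability_algebra_def operation_def by simp_all

lemma val_mem [simp]: "val A t \<in>\<^sub>M \<Lambda>"
  by (induction t) simp_all

abbreviation in_Pole (infix \<open>\<bottom>\<close> 50) where
  "\<xi> \<bottom> \<pi> \<equiv> \<xi> \<star> \<pi> \<in>\<^sub>M Pole A"

lemma anti: "step p q ==> p \<in>\<^sub>M Procs A ==> q \<in>\<^sub>M Pole A ==> p \<in>\<^sub>M Pole A"
  using ra unfolding realizability_algebra_def by blast

text \<open>Anti-execution as one introduction rule per instruction: membership of a process in the
  pole is proved by running it symbolically.\<close>

lemma pole_intros:
  "\<xi> \<bottom> \<eta> \<cdot> \<pi> ==> \<xi> \<in>\<^sub>M \<Lambda> ==> \<eta> \<in>\<^sub>M \<Lambda> ==> \<pi> \<in>\<^sub>M \<Pi> ==> \<xi> \<bullet> \<eta> \<bottom> \<pi>"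
  "\<xi> \<bottom> \<pi> ==> \<xi> \<in>\<^sub>M \<Lambda> ==> \<pi> \<in>\<^sub>M \<Pi> ==> instr_I A \<bottom> \<xi> \<cdot> \<pi>"
  "\<xi> \<bottom> \<pi> ==> \<xi> \<in>\<^sub>M \<Lambda> ==> \<eta> \<in>\<^sub>M \<Lambda> ==> \<pi> \<in>\<^sub>M \<Pi> ==> instr_K A \<bottom> \<xi> \<cdot> \<eta> \<cdot> \<pi>"
  "\<xi> \<bottom> \<eta> \<cdot> \<eta> \<cdot> \<pi> ==> \<xi> \<in>\<^sub>M \<Lambda> ==> \<eta> \<in>\<^sub>M \<Lambda> ==> \<pi> \<in>\<^sub>M \<Pi> ==> instr_W A \<bottom> \<xi> \<cdot> \<eta> \<cdot> \<pi>"
  "\<xi> \<bottom> \<zeta> \<cdot> \<eta> \<cdot> \<pi> ==> \<xi> \<in>\<^sub>M \<Lambda> ==> \<eta> \<in>\<^sub>M \<Lambda> ==> \<zeta> \<in>\<^sub>M \<Lambda> ==> \<pi> \<in>\<^sub>M \<Pi>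
     ==> instr_C A \<bottom> \<xi> \<cdot> \<eta> \<cdot> \<zeta> \<cdot> \<pi>"
  "\<xi> \<bottom> (\<eta> \<bullet> \<zeta>) \<cdot> \<pi> ==> \<xi> \<in>\<^sub>M \<Lambda> ==> \<eta> \<in>\<^sub>M \<Lambda> ==> \<zeta> \<in>\<^sub>M \<Lambda> ==> \<pi> \<in>\<^sub>M \<Pi>
     ==> instr_B A \<bottom> \<xi> \<cdot> \<eta> \<cdot> \<zeta> \<cdot> \<pi>"
  "\<xi> \<bottom> kont A \<pi> \<cdot> \<pi> ==> \<xi> \<in>\<^sub>M \<Lambda> ==> \<pi> \<in>\<^sub>M \<Pi> ==> instr_cc A \<bottom> \<xi> \<cdot> \<pi>"
  "\<xi> \<bottom> \<pi> ==> \<xi> \<in>\<^sub>M \<Lambda> ==> \<pi> \<in>\<^sub>M \<Pi> ==> \<rho> \<in>\<^sub>M \<Pi> ==> kont A \<pi> \<bottom> \<xi> \<cdot> \<rho>"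
  by - (rule anti, (rule step.intros; assumption), simp, assumption)+

section \<open>Definability of falsity values\<close>

text \<open>The operations of the algebra are functions of the metalogic that are known to be sets
  of the model only on the carriers. Restricting the relation to the carriers makes it definable;
  \<open>in_pole\<close> is restricted for the same reason.\<close>

definition is_push :: "'v => 'v => 'v => bool" where
  "is_push \<xi> \<pi> \<rho> \<longleftrightarrow> \<xi> \<in>\<^sub>M \<Lambda> \<and> \<pi> \<in>\<^sub>M \<Pi> \<and> \<rho> = \<xi> \<cdot> \<pi>"

definition in_pole :: "'v => 'v => bool" where
  "in_pole \<xi> \<pi> \<longleftrightarrow> \<xi> \<in>\<^sub>M \<Lambda> \<and> \<pi> \<in>\<^sub>M \<Pi> \<and> \<xi> \<bottom> \<pi>"

lemma operation_graph:
  assumes "operation a b c f"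
  obtains g where "\<And>x y z. rel g (kpair x y) z \<longleftrightarrow> x \<in>\<^sub>M a \<and> y \<in>\<^sub>M b \<and> z = f x y"
proof -
  obtain g where "\<And>p. p \<in>\<^sub>M g \<longleftrightarrow> (\<exists>x y. x \<in>\<^sub>M a \<and> y \<in>\<^sub>M b \<and> p = kpair (kpair x y) (f x y))"
    using assms unfolding operation_def by blast
  then show thesis by (intro that) auto
qed

lemma dfn_is_push [dfn_intros]: "tm t ==> tm u ==> tm v ==> dfn (\<lambda>e. is_push (t e) (u e) (v e))"
proof (rule dfn3)
  have "operation \<Lambda> \<Pi> \<Pi> (push A)" using ra unfolding realizability_algebra_def by blast
  then obtain g where "\<And>x y z. rel g (kpair x y) z \<longleftrightarrow> x \<in>\<^sub>M \<Lambda> \<and> y \<in>\<^sub>M \<Pi> \<and> z = x \<cdot> y"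
    using operation_graph by blast
  then have "is_push x y z \<longleftrightarrow> rel g (kpair x y) z" for x y z by (simp add: is_push_def)
  then show "dfn (\<lambda>e. is_push (e 0) (e 1) (e 2))" by (simp only:) (intro dfn_intros)
qed

lemma dfn_in_pole [dfn_intros]: "tm t ==> tm u ==> dfn (\<lambda>e. in_pole (t e) (u e))"
proof (rule dfn2)
  have "operation \<Lambda> \<Pi> (Procs A) (proc A)" using ra unfolding realizability_algebra_def by blast
  then obtain g where "\<And>x y z. rel g (kpair x y) z \<longleftrightarrow> x \<in>\<^sub>M \<Lambda> \<and> y \<in>\<^sub>M \<Pi> \<and> z = x \<star> y"
    using operation_graph by blast
  then have "in_pole x y \<longleftrightarrow> (\<exists>z. rel g (kpair x y) z \<and> z \<in>\<^sub>M Pole A)" for x y by (auto simp: in_pole_def)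
  then show "dfn (\<lambda>e. in_pole (e 0) (e 1))" by (simp only:) (intro dfn_intros)
qed

definition fdfn :: "((nat => 'v) => 'v set) => bool" where
  "fdfn F \<longleftrightarrow> (\<forall>e. F e \<subseteq> Bot) \<and> dfn (\<lambda>e. e 0 \<in> F (\<lambda>i. e (Suc i)))"

lemma fdfnD: "fdfn F ==> \<pi> \<in> F e ==> \<pi> \<in>\<^sub>M \<Pi>"
  unfolding fdfn_def Bot_def by blast

lemma dfn_fdfn:
  assumes "fdfn F" "tm t" shows "dfn (\<lambda>e. t e \<in> F e)"
proof -
  have "dfn (\<lambda>e. \<exists>x. x = t e \<and> x \<in> F e)"
    using assms by (intro dfn_ex dfn_conj) (simp_all add: fdfn_def tm_def)
  then show ?thesis by simp
qed

lemma fdfn_shift: "fdfn F ==> fdfn (\<lambda>e. F (\<lambda>i. e (Suc i)))"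
  unfolding fdfn_def using dfn_rename[of "case_nat 0 (\<lambda>i. Suc (Suc i))" "\<lambda>e. e 0 \<in> F (\<lambda>i. e (Suc i))"]
  by (simp add: inj_def split: nat.splits)

lemma realizes_iff: "\<xi> \<in>\<^sub>M \<Lambda> ==> F \<subseteq> Bot ==> \<xi> \<tturnstile> F \<longleftrightarrow> (\<forall>\<pi>. \<pi> \<in> F --> in_pole \<xi> \<pi>)"
  unfolding realizes_def in_pole_def Bot_def by blast

lemma dfn_realizes:
  assumes "fdfn F" "tm t" shows "dfn (\<lambda>e. t e \<in>\<^sub>M \<Lambda> \<and> t e \<tturnstile> F e)"
proof -
  have "t e \<in>\<^sub>M \<Lambda> \<and> t e \<tturnstile> F e \<longleftrightarrow> t e \<in>\<^sub>M \<Lambda> \<and> (\<forall>\<pi>. \<pi> \<in> F e --> in_pole (t e) \<pi>)" for e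
    using realizes_iff assms(1) by (auto simp: fdfn_def)
  then show ?thesis
    by (simp only:) (intro dfn_intros assms(2) dfn_fdfn fdfn_shift assms(1) tm_shift)
qed

lemma mem_Imp: "\<pi> \<in> (F \<^bold>\<longrightarrow> G) \<longleftrightarrow> (\<exists>\<xi> \<rho>. \<xi> \<in>\<^sub>M \<Lambda> \<and> \<xi> \<tturnstile> F \<and> \<rho> \<in> G \<and> \<pi> = \<xi> \<cdot> \<rho>)"
  unfolding Imp_def by blast

lemma Imp_sub [simp]: "G \<subseteq> Bot ==> (F \<^bold>\<longrightarrow> G) \<subseteq> Bot"
  unfolding Imp_def Bot_def by auto

lemma fdfn_Imp:
  assumes "fdfn F" "fdfn G" shows "fdfn (\<lambda>e. F e \<^bold>\<longrightarrow> G e)"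
  unfolding fdfn_def
proof
  show "\<forall>e. (F e \<^bold>\<longrightarrow> G e) \<subseteq> Bot" using assms(2) by (simp add: fdfn_def)
  have "\<pi> \<in> (F e \<^bold>\<longrightarrow> G e) \<longleftrightarrow> (\<exists>\<xi> \<rho>. (\<xi> \<in>\<^sub>M \<Lambda> \<and> \<xi> \<tturnstile> F e) \<and> \<rho> \<in> G e \<and> is_push \<xi> \<rho> \<pi>)" for \<pi> e
    unfolding mem_Imp is_push_def using fdfnD[OF assms(2)] by blast
  then show "dfn (\<lambda>e. e 0 \<in> (F (\<lambda>i. e (Suc i)) \<^bold>\<longrightarrow> G (\<lambda>i. e (Suc i))))"
    by (simp only:) (intro dfn_intros dfn_realizes dfn_fdfn fdfn_shift[OF fdfn_shift[OF fdfn_shift]] assms)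
qed

lemma fdfn_All:
  assumes "fdfn (\<lambda>e. F (e 0) (\<lambda>i. e (Suc i)))" shows "fdfn (\<lambda>e. All (\<lambda>a. F a e))"
  unfolding fdfn_def
proof
  have "F a e \<subseteq> Bot" for a e
  proof -
    have "\<forall>e. F (e 0) (\<lambda>i. e (Suc i)) \<subseteq> Bot" using assms by (simp add: fdfn_def)
    from spec[OF this, of "case_nat a e"] show ?thesis by simp
  qed
  then show "\<forall>e. All (\<lambda>a. F a e) \<subseteq> Bot" unfolding All_def by blast
  have "inj (\<lambda>i::nat. if i = 0 then 1 else if i = 1 then 0 else i)" by (rule injI) presburger
  then have "dfn (\<lambda>e. e 1 \<in> F (e 0) (\<lambda>i. e (Suc (Suc i))))"
    using dfn_rename[of "\<lambda>i. if i = 0 then 1 else if i = 1 then 0 else i" "\<lambda>e. e 0 \<in> F (e 1) (\<lambda>i. e (Suc (Suc i)))"] assms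
    unfolding fdfn_def by simp
  then show "dfn (\<lambda>e. e 0 \<in> All (\<lambda>a. F a (\<lambda>i. e (Suc i))))"
    unfolding All_def by (simp add: dfn_ex)
qed

lemma fdfn_Bot: "fdfn (\<lambda>e. Bot)"
  unfolding fdfn_def Bot_def by (simp, intro dfn_intros)

lemma fdfnI2:
  assumes "dfn (\<lambda>e. e 0 \<in> F (e 1) (e 2))" "\<And>x y. F x y \<subseteq> Bot" "tm t" "tm u"
  shows "fdfn (\<lambda>e. F (t e) (u e))"
  unfolding fdfn_def
  using dfn3[of "\<lambda>p x y. p \<in> F x y", OF assms(1) tm_var tm_shift[OF assms(3)] tm_shift[OF assms(4)], of 0] assms(2)
  by blast

lemma fdfnI3:
  assumes "dfn (\<lambda>e. e 0 \<in> F (e 1) (e 2) (e 3))" "\<And>x y z. F x y z \<subseteq> Bot" "tm t" "tm u" "tm v"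
  shows "fdfn (\<lambda>e. F (t e) (u e) (v e))"
  unfolding fdfn_def
  using dfn4[of "\<lambda>p x y z. p \<in> F x y z", OF assms(1) tm_var tm_shift[OF assms(3)] tm_shift[OF assms(4)]
      tm_shift[OF assms(5)], of 0] assms(2)
  by blast

lemma fdfn_not_eps: "tm t ==> tm u ==> fdfn (\<lambda>e. not_eps (t e) (u e))"
proof (rule fdfnI2)
  show "dfn (\<lambda>e. e 0 \<in> not_eps (e 1) (e 2))" unfolding not_eps_def mem_Collect_eq by (intro dfn_intros)
qed (auto simp: not_eps_def Bot_def)

section \<open>Extensional membership\<close>

lemma section_sub [simp]: "section_at s a b \<subseteq> Bot"
  unfolding section_at_def Bot_def by blast

lemma mem_section: "\<pi> \<in> section_at s a b \<longleftrightarrow> \<pi> \<in>\<^sub>M \<Pi> \<and> rel s (kpair a b) \<pi>"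
  unfolding section_at_def by simp

lemma fdfn_section: "tm t ==> tm u ==> tm v ==> fdfn (\<lambda>e. section_at (t e) (u e) (v e))"
  by (rule fdfnI3) (unfold mem_section, intro dfn_intros, rule section_sub)

lemma mem_incl_clause:
  "\<pi> \<in> incl_clause N a b \<longleftrightarrow> (\<exists>\<xi> \<rho> c. is_push \<xi> \<rho> \<pi> \<and> opair c \<rho> \<in>\<^sub>M a \<and> \<xi> \<in>\<^sub>M \<Lambda> \<and> \<xi> \<tturnstile> N c b)"
  unfolding incl_clause_def is_push_def by blast

lemma mem_not_in_clause:
  "\<pi> \<in> not_in_clause S a b \<longleftrightarrow> (\<exists>\<xi> \<xi>' \<rho> \<rho>' c. is_push \<xi>' \<rho>' \<rho> \<and> is_push \<xi> \<rho> \<pi> \<and> opair c \<rho>' \<in>\<^sub>M b \<and>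
     (\<xi> \<in>\<^sub>M \<Lambda> \<and> \<xi> \<tturnstile> S a c) \<and> (\<xi>' \<in>\<^sub>M \<Lambda> \<and> \<xi>' \<tturnstile> S c a))"
  unfolding not_in_clause_def is_push_def by blast

lemma incl_clause_sub [simp]: "incl_clause N a b \<subseteq> Bot"
  unfolding incl_clause_def Bot_def by auto

lemma not_in_clause_sub [simp]: "not_in_clause N a b \<subseteq> Bot"
  unfolding not_in_clause_def Bot_def by auto

lemma incl_clause_cong:
  "(\<And>c \<pi>. opair c \<pi> \<in>\<^sub>M a ==> N c b = N' c b) ==> incl_clause N a b = incl_clause N' a b"
  unfolding incl_clause_def by (intro Collect_cong ex_cong1) auto

lemma not_in_clause_cong:
  "(\<And>c \<pi>. opair c \<pi> \<in>\<^sub>M b ==> S a c = S' a c \<and> S c a = S' c a) ==> not_in_clause S a b = not_in_clause S' a b"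
  unfolding not_in_clause_def by (intro Collect_cong ex_cong1) auto

text \<open>Here \<open>s\<close> is a candidate graph for \<open>incl\<close>; composing both
  clauses gives the operator \<open>incl_of\<close>, whose fixed point is wanted.\<close>

definition not_in_of :: "'v => 'v => 'v => 'v set" where
  "not_in_of s = not_in_clause (section_at s)"

definition incl_of :: "'v => 'v => 'v => 'v set" where
  "incl_of s = incl_clause (not_in_of s)"

lemma fdfn_not_in_of: "tm t ==> tm u ==> tm v ==> fdfn (\<lambda>e. not_in_of (t e) (u e) (v e))"
  by (rule fdfnI3) (unfold not_in_of_def mem_not_in_clause, intro dfn_intros dfn_realizes fdfn_section,
      rule not_in_clause_sub)

lemma fdfn_incl_of: "tm t ==> tm u ==> tm v ==> fdfn (\<lambda>e. incl_of (t e) (u e) (v e))"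
  by (rule fdfnI3) (unfold incl_of_def mem_incl_clause, intro dfn_intros dfn_realizes fdfn_not_in_of,
      rule incl_clause_sub)

lemma realizes_mono: "F \<subseteq> G ==> \<xi> \<tturnstile> G ==> \<xi> \<tturnstile> F"
  unfolding realizes_def by blast

lemma incl_of_mono:
  assumes "\<And>a b. section_at s a b \<subseteq> section_at s' a b" shows "incl_of s a b \<subseteq> incl_of s' a b"
proof -
  have sub: "not_in_of s' c b \<subseteq> not_in_of s c b" for c
    unfolding not_in_of_def subset_iff mem_not_in_clause using realizes_mono[OF assms] by blast
  show ?thesis unfolding incl_of_def subset_iff mem_incl_clause using realizes_mono[OF sub] by blast
qed

text \<open>Since \<open>incl\<close> occurs negatively in \<open>not_in\<close> and vice versa, eliminating \<open>not_in\<close> leaves a monotone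
  recursion for \<open>incl\<close>, whose least fixed point inside the model is an approximation.\<close>

lemma ex_approximation:
  assumes "transitive T" obtains s n where "approximation T s n"
proof -
  define W where "W = prod (prod T T) \<Pi>"
  define cl where "cl s \<longleftrightarrow> (\<forall>a b \<pi>. a \<in>\<^sub>M T --> b \<in>\<^sub>M T --> \<pi> \<in> incl_of s a b --> rel s (kpair a b) \<pi>)" for s
  have c0: "dfn (\<lambda>e. cl (e 0))" unfolding cl_def by (intro dfn_intros dfn_fdfn fdfn_incl_of)
  note [dfn_intros] = dfn1[OF c0]
  \<comment> \<open>The intersection of all closed graphs within \<open>W\<close>, as in the fixed
    point theorem of Knaster and Tarski.\<close>
  obtain s where s: "\<And>p. p \<in>\<^sub>M s \<longleftrightarrow> p \<in>\<^sub>M W \<and> (\<forall>s. cl s --> p \<in>\<^sub>M s)"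
    by (rule separationE, erule that) (intro dfn_intros)
  have below: "incl_of s a b \<subseteq> incl_of s' a b" if "cl s'" for s' a b
    by (rule incl_of_mono) (use s that in \<open>auto simp: mem_section\<close>)
  have \<Pi>: "\<pi> \<in>\<^sub>M \<Pi>" if "\<pi> \<in> incl_of s' a b" for \<pi> s' a b
    using that incl_clause_sub unfolding incl_of_def Bot_def by blast
  have cl: "cl s"
    unfolding cl_def
  proof (intro allI impI)
    fix a b \<pi> assume *: "a \<in>\<^sub>M T" "b \<in>\<^sub>M T" "\<pi> \<in> incl_of s a b"
    have "rel s' (kpair a b) \<pi>" if "cl s'" for s'
      using below[OF that, of a b] * that unfolding cl_def by blast
    then show "rel s (kpair a b) \<pi>" unfolding s using * \<Pi> by (simp add: W_def)
  qed
  have graph: "\<exists>r. \<forall>a b \<pi>. rel r (kpair a b) \<pi> \<longleftrightarrow> a \<in>\<^sub>M T \<and> b \<in>\<^sub>M T \<and> \<pi> \<in> F a b"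
    if "fdfn (\<lambda>e. F (e 0) (e 1))" for F
  proof -
    have *: "dfn (\<lambda>e. e 2 \<in> F (e 0) (e 1))" using dfn_fdfn[OF that tm_var] .
    have "dfn (\<lambda>e. \<exists>a b. e 0 = kpair a b \<and> e 1 \<in> F a b)"
      by (intro dfn_intros dfn3[of "\<lambda>a b \<pi>. \<pi> \<in> F a b", OF *])
    then obtain r where "\<And>p \<pi>. rel r p \<pi> \<longleftrightarrow> p \<in>\<^sub>M prod T T \<and> \<pi> \<in>\<^sub>M \<Pi> \<and> (\<exists>a b. p = kpair a b \<and> \<pi> \<in> F a b)"
      by (rule ex_relation) blast
    then have "rel r (kpair a b) \<pi> \<longleftrightarrow> a \<in>\<^sub>M T \<and> b \<in>\<^sub>M T \<and> \<pi> \<in> F a b" for a b \<pi>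
      using fdfnD[OF that, of \<pi> "case_nat a (\<lambda>_. b)"] by auto
    then show ?thesis by blast
  qed
  \<comment> \<open>The operator applied to the least closed graph \<open>s\<close>. The result lies
    below \<open>s\<close>, hence is closed by monotonicity, and minimality of \<open>s\<close>
    gives the missing half of the fixed point equation.\<close>
  obtain s' where s': "\<And>a b \<pi>. rel s' (kpair a b) \<pi> \<longleftrightarrow> a \<in>\<^sub>M T \<and> b \<in>\<^sub>M T \<and> \<pi> \<in> incl_of s a b"
    using graph[of "incl_of s", OF fdfn_incl_of[OF tm_const tm_var tm_var]] by blast
  have "section_at s' a b \<subseteq> section_at s a b" for a b
    using s' cl unfolding cl_def by (auto simp: mem_section)
  then have "incl_of s' a b \<subseteq> incl_of s a b" for a b by (rule incl_of_mono)
  then have "cl s'" unfolding cl_def s' by blast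
  have fix_s: "section_at s a b = incl_of s a b" if ab: "a \<in>\<^sub>M T" "b \<in>\<^sub>M T" for a b
  proof (intro set_eqI iffI)
    fix \<pi> assume "\<pi> \<in> section_at s a b"
    then have "rel s' (kpair a b) \<pi>" using s \<open>cl s'\<close> unfolding mem_section by blast
    then show "\<pi> \<in> incl_of s a b" unfolding s' by blast
  next
    fix \<pi> assume "\<pi> \<in> incl_of s a b"
    then show "\<pi> \<in> section_at s a b" using cl ab \<Pi> unfolding cl_def mem_section by blast
  qed
  obtain n where "\<And>a b \<pi>. rel n (kpair a b) \<pi> \<longleftrightarrow> a \<in>\<^sub>M T \<and> b \<in>\<^sub>M T \<and> \<pi> \<in> not_in_of s a b"
    using graph[of "not_in_of s", OF fdfn_not_in_of[OF tm_const tm_var tm_var]] by blast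
  then have n: "section_at n a b = not_in_of s a b" if "a \<in>\<^sub>M T" "b \<in>\<^sub>M T" for a b
    using that not_in_clause_sub[of "section_at s" a b]
    by (auto simp: mem_section not_in_of_def Bot_def)
  have "approximation T s n" unfolding approximation_def
  proof (intro conjI allI impI)
    fix a b assume ab: "a \<in>\<^sub>M T" "b \<in>\<^sub>M T"
    show "section_at n a b = not_in_clause (section_at s) a b" using n[OF ab] by (simp add: not_in_of_def)
    have "incl_of s a b = incl_clause (section_at n) a b" unfolding incl_of_def
      by (rule incl_clause_cong) (use n transitive_opair[OF assms ab(1)] ab in auto)
    then show "section_at s a b = incl_clause (section_at n) a b"
      using fix_s[OF ab] by simp
  qed (rule assms)
  then show thesis by (rule that)
qed

text \<open>The recursion goes from a to the first components of pairs in a, so foundation has to be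
  applied across several membership steps.\<close>

lemma opair_induct:
  assumes T: "transitive T" "a \<in>\<^sub>M T" and P: "dfn (\<lambda>e. P (e 0))"
    and step: "\<And>a. a \<in>\<^sub>M T ==> (\<And>c \<pi>. opair c \<pi> \<in>\<^sub>M a ==> P c) ==> P a"
  shows "P a"
proof (rule ccontr)
  assume "\<not> P a"
  \<comment> \<open>A counterexample may also sit one or two steps below u. For minimal u, each pair
    in u is then free of counterexamples down to its first component.\<close>
  obtain C where C: "\<And>u. u \<in>\<^sub>M C \<longleftrightarrow> u \<in>\<^sub>M T \<and>
      (\<not> P u \<or> (\<exists>v. v \<in>\<^sub>M u \<and> \<not> P v) \<or> (\<exists>v w. v \<in>\<^sub>M u \<and> w \<in>\<^sub>M v \<and> \<not> P w))"
    by (rule separationE, erule that) (intro dfn_intros dfn1[OF P])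
  have Tt: "v \<in>\<^sub>M T" if "v \<in>\<^sub>M u" "u \<in>\<^sub>M T" for u v using T(1) that unfolding transitive_def subset_def by blast
  have "a \<in>\<^sub>M C" using \<open>\<not> P a\<close> T(2) C by blast
  then obtain u where u: "u \<in>\<^sub>M C" "\<And>v. v \<in>\<^sub>M u ==> \<not> v \<in>\<^sub>M C" using foundation by blast
  have uT: "u \<in>\<^sub>M T" using u(1) C by blast
  have no: "P v \<and> (\<forall>w. w \<in>\<^sub>M v --> P w) \<and> (\<forall>w x. w \<in>\<^sub>M v --> x \<in>\<^sub>M w --> P x)" if "v \<in>\<^sub>M u" for v
    using u(2)[OF that] Tt[OF that uT] C by blast
  have "P c" if "opair c \<pi> \<in>\<^sub>M u" for c \<pi>
  proof (cases "c = empty \<and> \<pi> = empty")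
    case True
    then have "c = opair c \<pi>" by (simp add: opair_def)
    then show ?thesis using no[OF that] by simp
  next
    case False
    then have "upair c c \<in>\<^sub>M opair c \<pi>" "c \<in>\<^sub>M upair c c" by (auto simp: opair_def kpair_def)
    then show ?thesis using no[OF that] by blast
  qed
  then have "P u" using step[OF uT] by blast
  then show False using u(1) C no by blast
qed

text \<open>Unfolding \<open>incl\<close> twice leads from (a, b) to pairs of a component of a and a
  component of b, in either order. Induction on a alone is therefore enough if both orders are
  treated together.\<close>

lemma approximation_unique:
  assumes ap: "approximation T s n" "approximation T' s' n'"
    and a: "a \<in>\<^sub>M T" "a \<in>\<^sub>M T'" and b: "b \<in>\<^sub>M T" "b \<in>\<^sub>M T'"
  shows "section_at s a b = section_at s' a b"
proof -
  have T: "transitive T" and T': "transitive T'" using ap by (simp_all add: approximation_def)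
  have s: "section_at s a b = incl_clause (section_at n) a b" "section_at n a b = not_in_clause (section_at s) a b"
    if "a \<in>\<^sub>M T" "b \<in>\<^sub>M T" for a b using that ap(1) unfolding approximation_def by blast+
  have s': "section_at s' a b = incl_clause (section_at n') a b" "section_at n' a b = not_in_clause (section_at s') a b"
    if "a \<in>\<^sub>M T'" "b \<in>\<^sub>M T'" for a b using that ap(2) unfolding approximation_def by blast+
  define E where "E a b \<longleftrightarrow> (\<forall>\<pi>. \<pi> \<in> section_at s a b \<longleftrightarrow> \<pi> \<in> section_at s' a b)" for a b
  have E0: "dfn (\<lambda>e. E (e 0) (e 1))" unfolding E_def by (intro dfn_intros dfn_iff dfn_fdfn fdfn_section)
  note [dfn_intros] = dfn2[OF E0]
  have E: "E a b \<longleftrightarrow> section_at s a b = section_at s' a b" for a b unfolding E_def by blast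
  have "a \<in>\<^sub>M T' --> (\<forall>b. b \<in>\<^sub>M T --> b \<in>\<^sub>M T' --> E a b \<and> E b a)"
  proof (rule opair_induct[OF T a(1)])
    show "dfn (\<lambda>e. e 0 \<in>\<^sub>M T' --> (\<forall>b. b \<in>\<^sub>M T --> b \<in>\<^sub>M T' --> E (e 0) b \<and> E b (e 0)))" by (intro dfn_intros)
    fix a assume aT: "a \<in>\<^sub>M T" and IH: "\<And>c \<pi>. opair c \<pi> \<in>\<^sub>M a ==> c \<in>\<^sub>M T' --> (\<forall>b. b \<in>\<^sub>M T --> b \<in>\<^sub>M T' --> E c b \<and> E b c)"
    show "a \<in>\<^sub>M T' --> (\<forall>b. b \<in>\<^sub>M T --> b \<in>\<^sub>M T' --> E a b \<and> E b a)"
    proof (intro impI allI)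
      fix b assume aT': "a \<in>\<^sub>M T'" and b: "b \<in>\<^sub>M T" "b \<in>\<^sub>M T'"
      have c: "c \<in>\<^sub>M T \<and> c \<in>\<^sub>M T' \<and> (\<forall>b. b \<in>\<^sub>M T --> b \<in>\<^sub>M T' --> E c b \<and> E b c)" if "opair c \<pi> \<in>\<^sub>M a" for c \<pi>
        using IH[OF that] transitive_opair[OF T aT that] transitive_opair[OF T' aT' that] by blast
      have d: "c \<in>\<^sub>M T \<and> c \<in>\<^sub>M T'" if "opair c \<pi> \<in>\<^sub>M b" for c \<pi>
        using transitive_opair[OF T b(1) that] transitive_opair[OF T' b(2) that] by blast
      have 1: "section_at n c b = section_at n' c b" if "opair c \<pi> \<in>\<^sub>M a" for c \<pi>
        using c[OF that] b d unfolding s(2)[OF conjunct1[OF c[OF that]] b(1)] s'(2)[OF conjunct1[OF conjunct2[OF c[OF that]]] b(2)]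
        by (intro not_in_clause_cong) (use E in blast)
      have 2: "section_at n c a = section_at n' c a" if "opair c \<pi> \<in>\<^sub>M b" for c \<pi>
        unfolding s(2)[OF conjunct1[OF d[OF that]] aT] s'(2)[OF conjunct2[OF d[OF that]] aT']
        by (intro not_in_clause_cong) (use E c d[OF that] in blast)
      have "section_at s a b = section_at s' a b" unfolding s(1)[OF aT b(1)] s'(1)[OF aT' b(2)]
        by (rule incl_clause_cong) (rule 1)
      moreover have "section_at s b a = section_at s' b a" unfolding s(1)[OF b(1) aT] s'(1)[OF b(2) aT']
        by (rule incl_clause_cong) (rule 2)
      ultimately show "E a b \<and> E b a" unfolding E by blast
    qed
  qed
  then show ?thesis using a b E by blast
qed

lemma approximation_eq:
  assumes "approximation T s n" "a \<in>\<^sub>M T" "b \<in>\<^sub>M T"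
  shows "incl a b = section_at s a b" "not_in a b = section_at n a b"
proof -
  have T: "transitive T" using assms(1) by (simp add: approximation_def)
  show "incl a b = section_at s a b"
    unfolding incl_def using assms approximation_unique[OF _ assms(1)] by blast
  have "section_at n' a b = section_at n a b" if *: "approximation T' s' n'" "a \<in>\<^sub>M T'" "b \<in>\<^sub>M T'" for T' s' n'
  proof -
    have T': "transitive T'" using *(1) by (simp add: approximation_def)
    have "section_at n' a b = not_in_clause (section_at s') a b" "section_at n a b = not_in_clause (section_at s) a b"
      using assms * unfolding approximation_def by blast+
    moreover have "not_in_clause (section_at s') a b = not_in_clause (section_at s) a b"
      by (rule not_in_clause_cong)
        (use approximation_unique[OF *(1) assms(1)] transitive_opair[OF T' *(3)] transitive_opair[OF T assms(3)]
          *(2) assms(2) in blast)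
    ultimately show ?thesis by simp
  qed
  then show "not_in a b = section_at n a b" unfolding not_in_def using assms by blast
qed

lemma ex_approximation_pair:
  obtains T s n where "approximation T s n" "a \<in>\<^sub>M T" "b \<in>\<^sub>M T"
proof -
  obtain T where T: "transitive T" "upair a b \<in>\<^sub>M T" by (rule ex_transitive)
  obtain s n where sn: "approximation T s n" by (rule ex_approximation[OF T(1)])
  show thesis
    by (rule that[OF sn]) (use T in \<open>auto simp: transitive_def subset_def\<close>)
qed

text \<open>Any approximation around a and b computes the value. A pair of c and \<pi> in a means
  that \<pi> is in the falsity value of c not belonging to a, so the clause turns into a
  formula.\<close>

lemma incl_eq: "incl a b = All (\<lambda>c. not_in c b \<^bold>\<longrightarrow> not_eps c a)"
proof -
  obtain T s n where ap: "approximation T s n" "a \<in>\<^sub>M T" "b \<in>\<^sub>M T" by (rule ex_approximation_pair)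
  then have T: "transitive T" by (simp add: approximation_def)
  have "incl a b = incl_clause (section_at n) a b"
    using approximation_eq[OF ap] ap unfolding approximation_def by blast
  also have "\<dots> = incl_clause not_in a b"
    by (rule incl_clause_cong) (use approximation_eq(2)[OF ap(1) transitive_opair[OF T ap(2)] ap(3)] in blast)
  also have "\<dots> = All (\<lambda>c. not_in c b \<^bold>\<longrightarrow> not_eps c a)"
    unfolding incl_clause_def All_def Imp_def not_eps_def by blast
  finally show ?thesis .
qed

lemma not_in_eq: "not_in a b = All (\<lambda>c. incl a c \<^bold>\<longrightarrow> incl c a \<^bold>\<longrightarrow> not_eps c b)"
proof -
  obtain T s n where ap: "approximation T s n" "a \<in>\<^sub>M T" "b \<in>\<^sub>M T" by (rule ex_approximation_pair)
  then have T: "transitive T" by (simp add: approximation_def)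
  have "not_in a b = not_in_clause (section_at s) a b"
    using approximation_eq[OF ap] ap unfolding approximation_def by blast
  also have "\<dots> = not_in_clause incl a b"
    by (rule not_in_clause_cong)
      (use approximation_eq(1)[OF ap(1)] transitive_opair[OF T ap(3)] ap(2) in blast)
  also have "\<dots> = All (\<lambda>c. incl a c \<^bold>\<longrightarrow> incl c a \<^bold>\<longrightarrow> not_eps c b)"
    unfolding not_in_clause_def All_def Imp_def not_eps_def by blast
  finally show ?thesis .
qed

lemma dfn_approximation [dfn_intros]:
  "tm t ==> tm u ==> tm v ==> dfn (\<lambda>e. approximation (t e) (u e) (v e))"
  by (rule dfn3)
    (unfold approximation_def set_eq_iff mem_incl_clause mem_not_in_clause,
     intro dfn_intros dfn_iff dfn_fdfn fdfn_section dfn_realizes)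

lemma incl_sub: "incl a b \<subseteq> Bot" and not_in_sub: "not_in a b \<subseteq> Bot"
  unfolding incl_def not_in_def using section_sub by blast+

lemma fdfn_incl: "tm t ==> tm u ==> fdfn (\<lambda>e. incl (t e) (u e))"
  by (rule fdfnI2) (unfold incl_def mem_Collect_eq, intro dfn_intros dfn_fdfn fdfn_section,
      rule incl_sub[unfolded incl_def])

lemma fdfn_not_in: "tm t ==> tm u ==> fdfn (\<lambda>e. not_in (t e) (u e))"
  by (rule fdfnI2) (unfold not_in_def mem_Collect_eq, intro dfn_intros dfn_fdfn fdfn_section,
      rule not_in_sub[unfolded not_in_def])

end

section \<open>Henkin completeness\<close>

text \<open>Variables are de Bruijn indices; index \<open>0\<close> is bound by the innermost quantifier \<open>Al\<close>.\<close>

datatype 'p form = Fls | Im "'p form" "'p form" | Al "'p form" | At 'p "nat list"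

instance form :: (countable) countable
  by countable_datatype

definition lift :: "(nat => nat) => nat => nat" where
  "lift f = case_nat 0 (\<lambda>i. Suc (f i))"

primrec ren :: "(nat => nat) => 'p form => 'p form" where
  "ren f Fls = Fls"
| "ren f (Im \<phi> \<psi>) = Im (ren f \<phi>) (ren f \<psi>)"
| "ren f (Al \<phi>) = Al (ren (lift f) \<phi>)"
| "ren f (At p xs) = At p (map f xs)"

text \<open>Without function symbols, instantiating a quantifier means renaming: variable 0 becomes
  \<open>k\<close> and the others move down.\<close>

abbreviation inst :: "nat => 'p form => 'p form" where
  "inst k \<equiv> ren (case_nat k id)"

primrec fvs :: "'p form => nat set" where
  "fvs Fls = {}"
| "fvs (Im \<phi> \<psi>) = fvs \<phi> \<union> fvs \<psi>"
| "fvs (Al \<phi>) = {i. Suc i \<in> fvs \<phi>}"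
| "fvs (At p xs) = set xs"

primrec msat :: "('p => 'a list => bool) => 'p form => (nat => 'a) => bool" where
  "msat m Fls e \<longleftrightarrow> False"
| "msat m (Im \<phi> \<psi>) e \<longleftrightarrow> (msat m \<phi> e --> msat m \<psi> e)"
| "msat m (Al \<phi>) e \<longleftrightarrow> (\<forall>a. msat m \<phi> (case_nat a e))"
| "msat m (At p xs) e \<longleftrightarrow> m p (map e xs)"

lemma lift_comp: "lift f (lift g i) = lift (\<lambda>i. f (g i)) i"
  by (cases i) (simp_all add: lift_def)

lemma ren_ren: "ren f (ren g \<phi>) = ren (\<lambda>i. f (g i)) \<phi>"
  by (induction \<phi> arbitrary: f g) (simp_all add: lift_comp)

lemma lift_id: "lift (\<lambda>i. i) = (\<lambda>i. i)"
  by (auto simp: lift_def fun_eq_iff split: nat.splits)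

lemma ren_id: "ren (\<lambda>i. i) \<phi> = \<phi>"
  by (induction \<phi>) (simp_all add: lift_id)

lemma inst_ren_Suc: "inst k (ren Suc \<phi>) = \<phi>"
  by (simp add: ren_ren ren_id)

lemma inst_ren_lift: "inst k (ren (lift f) \<phi>) = ren (case_nat k f) \<phi>"
proof -
  have "(case lift f i of 0 => k | Suc j => id j) = (case i of 0 => k | Suc j => f j)" for i
    by (cases i) (simp_all add: lift_def)
  then show ?thesis by (simp add: ren_ren)
qed

lemma fvs_ren: "fvs (ren f \<phi>) \<subseteq> f ` fvs \<phi>"
proof (induction \<phi> arbitrary: f)
  case (Al \<phi>)
  show ?case
  proof
    fix i assume "i \<in> fvs (ren f (Al \<phi>))"
    then obtain j where "j \<in> fvs \<phi>" "Suc i = lift f j" using Al[of "lift f"] by auto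
    then show "i \<in> f ` fvs (Al \<phi>)" by (cases j) (auto simp: lift_def)
  qed
qed (simp_all, blast)

lemma finite_fvs: "finite (fvs \<phi>)"
proof (induction \<phi>)
  case (Al \<phi>)
  have "fvs (Al \<phi>) = Suc -` fvs \<phi>" by auto
  with Al show ?case by (simp add: finite_vimageI)
qed simp_all

text \<open>\<open>R\<close> stands for realizability by a closed term. It plays the role of provability in Henkin's
  construction, so no proof calculus is needed.\<close>

locale henkin =
  fixes R :: "'p::countable form => bool"
  assumes mp: "R (Im \<phi> \<psi>) ==> R \<phi> ==> R \<psi>"
    and K: "R (Im \<phi> (Im \<psi> \<phi>))"
    and S: "R (Im (Im \<phi> (Im \<psi> \<chi>)) (Im (Im \<phi> \<psi>) (Im \<phi> \<chi>)))"
    and dne: "R (Im (Im (Im \<phi> Fls) Fls) \<phi>)"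
    and spec: "R (Im (Al \<phi>) (inst k \<phi>))"
    and gen: "k \<notin> fvs (Al \<phi>) ==> R (inst k \<phi>) ==> R (Al \<phi>)"
    and pull: "R (Im (Al (Im (ren Suc \<phi>) \<psi>)) (Im \<phi> (Al \<psi>)))"
begin

text \<open>Derivability from hypotheses is an iterated implication, so that the deduction theorem
  holds by definition.\<close>

primrec D :: "'p form list => 'p form => bool" where
  "D [] \<phi> = R \<phi>"
| "D (\<delta> # \<Delta>) \<phi> = D \<Delta> (Im \<delta> \<phi>)"

lemma D_mp: "D \<Delta> (Im \<phi> \<psi>) ==> D \<Delta> \<phi> ==> D \<Delta> \<psi>"
  and D_R: "R \<phi> ==> D \<Delta> \<phi>"
proof (induction \<Delta> arbitrary: \<phi> \<psi>)
  case Nil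
  { case 1 then show ?case using mp by simp next case 2 then show ?case by simp }
next
  case (Cons \<delta> \<Delta>)
  {
    case 1
    then show ?case using Cons.IH(1)[OF Cons.IH(1)[OF Cons.IH(2)[OF S]]] by simp
  next
    case 2
    then show ?case using Cons.IH(1)[OF Cons.IH(2)[OF K]] Cons.IH(2) by simp
  }
qed

lemma D_weaken: "D \<Delta> \<phi> ==> D (\<delta> # \<Delta>) \<phi>"
  using D_mp[OF D_R[OF K]] by simp

lemma D_head: "D (\<delta> # \<Delta>) \<delta>"
  using D_mp[OF D_mp[OF D_R[OF S] D_R[OF K]] D_R[OF K]] by simp

lemma D_dne: "D \<Delta> (Im (Im \<phi> Fls) Fls) ==> D \<Delta> \<phi>"
  by (rule D_mp[OF D_R[OF dne]])

text \<open>Each hypothesis is put under the quantifier, where the fresh variable does not see it,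
  and taken out again by \<open>pull\<close>.\<close>

lemma D_gen:
  "k \<notin> \<Union> (fvs ` set \<Delta>) ==> k \<notin> fvs (Al \<phi>) ==> D \<Delta> (inst k \<phi>) ==> D \<Delta> (Al \<phi>)"
proof (induction \<Delta> arbitrary: \<phi>)
  case Nil
  then show ?case using gen by simp
next
  case (Cons \<delta> \<Delta>)
  have "D \<Delta> (Al (Im (ren Suc \<delta>) \<phi>))"
  proof (rule Cons.IH)
    show "k \<notin> fvs (Al (Im (ren Suc \<delta>) \<phi>))" using Cons.prems fvs_ren[of Suc \<delta>] by auto
    show "D \<Delta> (inst k (Im (ren Suc \<delta>) \<phi>))" using Cons.prems(3) inst_ren_Suc[of k \<delta>] by simp
  qed (use Cons.prems in auto)
  then show ?case using D_mp[OF D_R[OF pull]] by simp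
qed

abbreviation "cons \<Delta> \<equiv> \<not> D \<Delta> Fls"

definition fresh :: "'p form list => nat" where
  "fresh \<Delta> = (SOME k. k \<notin> \<Union> (fvs ` set \<Delta>))"

lemma fresh: "fresh \<Delta> \<notin> \<Union> (fvs ` set \<Delta>)"
proof -
  have "finite (\<Union> (fvs ` set \<Delta>))" by (simp add: finite_fvs)
  then have "\<exists>k. k \<notin> \<Union> (fvs ` set \<Delta>)" by (metis ex_new_if_finite infinite_UNIV_nat)
  then show ?thesis unfolding fresh_def by (rule someI_ex)
qed

text \<open>One step of the Lindenbaum construction. A rejected universal formula receives a
  counterexample at once; a variable not yet used serves as Henkin witness, since the list is
  finite.\<close>

definition extend :: "'p form list => 'p form => 'p form list" where
  "extend \<Delta> \<phi> = (if cons (\<phi> # \<Delta>) then \<phi> # \<Delta> else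
     case \<phi> of Al \<psi> => Im (inst (fresh (\<phi> # \<Delta>)) \<psi>) Fls # \<Delta> | _ => \<Delta>)"

lemma extend_mono: "D \<Delta> \<psi> ==> D (extend \<Delta> \<phi>) \<psi>"
  unfolding extend_def using D_weaken by (auto split: form.split simp del: D.simps)

lemma extend_cons:
  assumes "cons \<Delta>" shows "cons (extend \<Delta> \<phi>)"
proof (cases "cons (\<phi> # \<Delta>)")
  case True
  then show ?thesis by (simp add: extend_def del: D.simps)
next
  case False
  show ?thesis
  proof (cases \<phi>)
    case (Al \<psi>)
    let ?k = "fresh (\<phi> # \<Delta>)"
    have "cons (Im (inst ?k \<psi>) Fls # \<Delta>)"
    proof
      assume "D (Im (inst ?k \<psi>) Fls # \<Delta>) Fls"
      then have "D \<Delta> (inst ?k \<psi>)" using D_dne by simp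
      then have "D \<Delta> \<phi>" using D_gen[of ?k \<Delta> \<psi>] fresh[of "\<phi> # \<Delta>"] unfolding Al by auto
      moreover have "D \<Delta> (Im \<phi> Fls)" using False by simp
      ultimately show False using D_mp assms by blast
    qed
    then show ?thesis using False Al by (simp add: extend_def del: D.simps)
  qed (use False assms in \<open>simp_all add: extend_def del: D.simps\<close>)
qed

primrec chain :: "'p form => nat => 'p form list" where
  "chain \<phi> 0 = [Im \<phi> Fls]"
| "chain \<phi> (Suc n) = extend (chain \<phi> n) (from_nat n)"

definition true_in :: "'p form => 'p form => bool" where
  "true_in \<phi>0 \<phi> \<longleftrightarrow> (\<exists>n. D (chain \<phi>0 n) \<phi>)"

lemma chain_mono: "m \<le> n ==> D (chain \<phi> m) \<psi> ==> D (chain \<phi> n) \<psi>"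
  by (induction rule: dec_induct) (auto intro: extend_mono)

lemma true_mp: "true_in \<phi>0 (Im \<phi> \<psi>) ==> true_in \<phi>0 \<phi> ==> true_in \<phi>0 \<psi>"
  unfolding true_in_def by (metis D_mp chain_mono nat_le_linear)

lemma true_R: "R \<phi> ==> true_in \<phi>0 \<phi>"
  unfolding true_in_def using D_R by blast

context
  fixes \<phi>0 assumes \<phi>0: "\<not> R \<phi>0"
begin

lemma chain_cons: "cons (chain \<phi>0 n)"
proof (induction n)
  case 0
  then show ?case using \<phi>0 mp[OF dne] by auto
qed (simp add: extend_cons)

lemma true_Fls: "\<not> true_in \<phi>0 Fls"
  unfolding true_in_def using chain_cons by blast

lemma true_goal: "\<not> true_in \<phi>0 \<phi>0"
proof
  have "true_in \<phi>0 (Im \<phi>0 Fls)" unfolding true_in_def using D_head[of _ "[]"] by (metis chain.simps(1))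
  then show "true_in \<phi>0 \<phi>0 ==> False" using true_mp true_Fls by blast
qed

lemma true_complete: "true_in \<phi>0 \<phi> \<or> true_in \<phi>0 (Im \<phi> Fls)"
proof -
  let ?n = "to_nat \<phi>"
  have "D (chain \<phi>0 (Suc ?n)) \<phi> \<or> D (chain \<phi>0 ?n) (Im \<phi> Fls)"
    using D_head[of \<phi> "chain \<phi>0 ?n"] by (auto simp: extend_def simp del: D.simps) simp
  then show ?thesis unfolding true_in_def by blast
qed

lemma true_Im: "true_in \<phi>0 (Im \<phi> \<psi>) \<longleftrightarrow> (true_in \<phi>0 \<phi> --> true_in \<phi>0 \<psi>)"
proof
  assume *: "true_in \<phi>0 \<phi> --> true_in \<phi>0 \<psi>"
  show "true_in \<phi>0 (Im \<phi> \<psi>)"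
  proof (cases "true_in \<phi>0 \<psi>")
    case True
    then show ?thesis using true_mp[OF true_R[OF K]] by blast
  next
    case False
    then have "true_in \<phi>0 (Im \<phi> Fls)" using * true_complete by blast
    \<comment> \<open>Ex falso: under the hypothesis \<open>Fls\<close>, \<open>K\<close> gives the
      double negation of \<open>\<psi>\<close>, which \<open>dne\<close> removes.\<close>
    moreover have "R (Im Fls \<psi>)"
      using D_mp[of "[Fls]" "Im (Im \<psi> Fls) Fls" \<psi>, OF D_R[OF dne]] D_mp[of "[Fls]" Fls "Im (Im \<psi> Fls) Fls", OF D_R[OF K]]
        D_head[of Fls "[]"] by simp
    ultimately have "true_in \<phi>0 (Im \<phi> (Im Fls \<psi>))" "true_in \<phi>0 (Im \<phi> Fls)"
      using true_R mp[OF K] by blast+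
    then show ?thesis using true_mp true_mp[OF true_R[OF S]] by blast
  qed
qed (use true_mp in blast)

lemma true_Al: "true_in \<phi>0 (Al \<phi>) \<longleftrightarrow> (\<forall>k. true_in \<phi>0 (inst k \<phi>))"
proof
  show "\<forall>k. true_in \<phi>0 (inst k \<phi>)" if "true_in \<phi>0 (Al \<phi>)"
    using that true_mp true_R[OF spec] by blast
  assume *: "\<forall>k. true_in \<phi>0 (inst k \<phi>)"
  let ?n = "to_nat (Al \<phi>)"
  let ?\<Delta> = "chain \<phi>0 ?n"
  show "true_in \<phi>0 (Al \<phi>)"
  proof (cases "cons (Al \<phi> # ?\<Delta>)")
    case True
    then have "chain \<phi>0 (Suc ?n) = Al \<phi> # ?\<Delta>" by (simp add: extend_def del: D.simps)
    then show ?thesis unfolding true_in_def by (metis D_head)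
  next
    case False
    then have "chain \<phi>0 (Suc ?n) = Im (inst (fresh (Al \<phi> # ?\<Delta>)) \<phi>) Fls # ?\<Delta>"
      by (simp add: extend_def del: D.simps)
    then have "true_in \<phi>0 (Im (inst (fresh (Al \<phi> # ?\<Delta>)) \<phi>) Fls)"
      unfolding true_in_def by (metis D_head)
    with * show ?thesis using true_mp true_Fls by blast
  qed
qed

text \<open>The truth lemma for the structure whose individuals are the variables: an assignment is
  a renaming.\<close>

lemma true_msat: "true_in \<phi>0 (ren e \<phi>) \<longleftrightarrow> msat (\<lambda>p xs. true_in \<phi>0 (At p xs)) \<phi> e"
  by (induction \<phi> arbitrary: e) (simp_all add: true_Fls true_Im true_Al inst_ren_lift)

end

text \<open>An unrealized formula fails in the structure built on variables. Realized formulas hold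
  there under every assignment because an assignment acts as a renaming, which explains the second
  hypothesis.\<close>

theorem completeness:
  assumes "\<And>m :: 'p => nat list => bool. (\<And>\<phi> e. R \<phi> ==> msat m \<phi> e) ==> msat m \<phi>0 id"
    and "\<And>\<phi> f. R \<phi> ==> R (ren f \<phi>)"
  shows "R \<phi>0"
proof (rule ccontr)
  assume *: "\<not> R \<phi>0"
  have "msat (\<lambda>p xs. true_in \<phi>0 (At p xs)) \<phi>0 id"
    using true_R assms(2) true_msat[OF *] by (intro assms(1)) blast
  then have "true_in \<phi>0 (ren id \<phi>0)" using true_msat[OF *] by blast
  then show False using true_goal[OF *] by (simp add: ren_id id_def)
qed

end

section \<open>Two-valued models\<close>

text \<open>Nonmembership is atomic, as it is what has a falsity value of its own; membership is its
  negation. The pair function is absorbed into the ternary \<open>NotEpsPair\<close>, so variables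
  are the only terms.\<close>

datatype pred = NotEps | NotEpsPair | Incl | NotIn | NotGimel | NotChoice | NotStart

instance pred :: countable
  by countable_datatype

abbreviation "ne i j \<equiv> At NotEps [i, j]"
abbreviation "np i j k \<equiv> At NotEpsPair [i, j, k]"
abbreviation "inc i j \<equiv> At Incl [i, j]"
abbreviation "ni i j \<equiv> At NotIn [i, j]"
abbreviation "ng i \<equiv> At NotGimel [i]"
abbreviation "nch i j k l \<equiv> At NotChoice [i, j, k, l]"
abbreviation "nw i \<equiv> At NotStart [i]"

definition "Ng \<phi> = Im \<phi> Fls"
definition "An \<phi> \<psi> = Im (Im \<phi> (Im \<psi> Fls)) Fls"
definition "Orr \<phi> \<psi> = Im (Im \<phi> Fls) (Im (Im \<psi> Fls) Fls)"
definition "Eqv \<phi> \<psi> = An (Im \<phi> \<psi>) (Im \<psi> \<phi>)"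
definition "Exi \<phi> = Im (Al (Im \<phi> Fls)) Fls"
definition "leib i j = Al (Im (ne (Suc i) 0) (ne (Suc j) 0))"
definition "exteq i j = An (inc i j) (inc j i)"

lemma msat_derived:
  "msat m (Ng \<phi>) e \<longleftrightarrow> \<not> msat m \<phi> e"
  "msat m (An \<phi> \<psi>) e \<longleftrightarrow> msat m \<phi> e \<and> msat m \<psi> e"
  "msat m (Orr \<phi> \<psi>) e \<longleftrightarrow> msat m \<phi> e \<or> msat m \<psi> e"
  "msat m (Eqv \<phi> \<psi>) e \<longleftrightarrow> (msat m \<phi> e \<longleftrightarrow> msat m \<psi> e)"
  "msat m (Exi \<phi>) e \<longleftrightarrow> (\<exists>a. msat m \<phi> (case_nat a e))"
  by (auto simp: Ng_def An_def Orr_def Eqv_def Exi_def)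

definition inductive_fm :: "nat => pred form" where
  "inductive_fm w = An (Exi (An (Ng (ni 0 (w+1))) (Al (ni 0 1))))
     (Al (Im (Ng (ni 0 (w+1))) (Exi (An (Ng (ni 0 (w+2)))
       (Al (Eqv (Ng (ni 0 1)) (Orr (Ng (ni 0 2)) (exteq 0 2))))))))"

definition natural_fm :: "nat => pred form" where
  "natural_fm n = Al (Im (inductive_fm 0) (Ng (ni (n+1) 0)))"

definition countable_fm :: "pred form" where
  "countable_fm = Exi (An (Al (Im (Ng (ng 0)) (Exi (An (natural_fm 0) (Ng (np 1 0 2))))))
     (An (Al (Al (Al (Im (Ng (np 2 1 3)) (Im (Ng (np 2 0 3)) (exteq 1 0))))))
       (Al (Al (Al (Al (Im (Ng (np 3 1 4)) (Im (Ng (np 2 0 4)) (Im (exteq 1 0) (leib 3 2))))))))))"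

definition neac_fm :: "pred form" where
  "neac_fm = Al (Exi (An (Al (Im (ne 0 2) (ne 0 1)))
     (An (Al (Al (Al (Im (Ng (np 2 1 3)) (Im (Ng (np 2 0 3)) (leib 1 0))))))
       (Al (Al (Exi (Im (Ng (np 2 1 4)) (Ng (np 2 0 3)))))))))"

definition skip :: "nat => nat => nat" where
  "skip n i = (if i < n then i else Suc i)"

text \<open>The schemes are chosen so that each has a simple realizer not depending on the
  parameters. Comprehension is bounded, by \<open>NotStart\<close> or by a given set.
  \<open>start_empty\<close> and \<open>start_succ\<close> make the first bound large enough for an
  inductive set. \<open>choice_fun\<close> is contraposed: distinct values cannot both be attached
  to Leibniz-equal indices.\<close>

inductive ax :: "pred form => bool" where
  incl_unfold: "ax (Eqv (inc 0 1) (Al (Im (ni 0 2) (ne 0 1))))"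
| not_in_unfold: "ax (Eqv (ni 0 1) (Al (Im (inc 1 0) (Im (inc 0 1) (ne 0 2)))))"
| comprehension: "ax (Exi (Al (Eqv (ne 0 1) (Im (ren (skip 1) \<phi>) (nw 0)))))"
| pair_comprehension: "ax (Exi (An (Al (Im (ne 0 (k+2)) (ne 0 1)))
    (Al (Al (Eqv (np 1 0 2) (Im (ren (skip 2) \<phi>) (np 1 0 (k+3))))))))"
| eps_induction: "ax (Im (Al (Im (Al (Im (Ng (ren (skip 1) \<phi>)) (ne 0 1))) \<phi>)) (Al \<phi>))"
| choice_ax: "ax (Exi (Al (Al (Im (Al (Al (Im (Ng (nch 4 3 1 0)) (Im (Ng (np 3 0 5)) (ng 1))))) (np 1 0 3)))))"
| choice_fun: "ax (Im (Ng (leib 0 1)) (Im (leib 2 3) (Im (Ng (nch 4 5 2 0)) (nch 4 5 3 1))))"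
| start_empty: "ax (Exi (An (Ng (nw 0)) (Al (ne 0 1))))"
| start_succ: "ax (Exi (An (Im (nw 0) (nw 1)) (An (Al (Im (ne 0 1) (ne 0 2)))
    (An (Ng (ne 1 0)) (Al (Im (ne 0 2) (Im (Ng (leib 0 2)) (ne 0 1))))))))"

locale two_valued =
  fixes m :: "pred => 'a list => bool"
  assumes ax: "\<And>\<phi> e. ax \<phi> ==> msat m \<phi> e"
begin

definition eps (infix \<open>\<epsilon>\<close> 50) where "x \<epsilon> y \<longleftrightarrow> \<not> m NotEps [x, y]"
definition pair_eps where "pair_eps x y z \<longleftrightarrow> \<not> m NotEpsPair [x, y, z]"
definition sub where "sub x y \<longleftrightarrow> m Incl [x, y]"
definition elem (infix \<open>\<in>\<in>\<close> 50) where "x \<in>\<in> y \<longleftrightarrow> \<not> m NotIn [x, y]"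
definition gim where "gim x \<longleftrightarrow> \<not> m NotGimel [x]"
definition ch where "ch c x \<nu> y \<longleftrightarrow> \<not> m NotChoice [c, x, \<nu>, y]"
definition start where "start x \<longleftrightarrow> \<not> m NotStart [x]"
definition same (infix \<open>\<approx>\<close> 50) where "x \<approx> y \<longleftrightarrow> sub x y \<and> sub y x"
definition leq (infix \<open>\<doteq>\<close> 50) where "x \<doteq> y \<longleftrightarrow> (\<forall>z. y \<epsilon> z --> x \<epsilon> z)"

lemmas defs = eps_def pair_eps_def sub_def elem_def gim_def ch_def start_def

lemma msat_atoms:
  "msat m (ne i j) e \<longleftrightarrow> \<not> e i \<epsilon> e j"
  "msat m (np i j k) e \<longleftrightarrow> \<not> pair_eps (e i) (e j) (e k)"
  "msat m (inc i j) e \<longleftrightarrow> sub (e i) (e j)"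
  "msat m (ni i j) e \<longleftrightarrow> \<not> e i \<in>\<in> e j"
  "msat m (ng i) e \<longleftrightarrow> \<not> gim (e i)"
  "msat m (nch i j k l) e \<longleftrightarrow> \<not> ch (e i) (e j) (e k) (e l)"
  "msat m (nw i) e \<longleftrightarrow> \<not> start (e i)"
  by (simp_all add: defs)

lemma msat_leib: "msat m (leib i j) e \<longleftrightarrow> e i \<doteq> e j"
  unfolding leib_def leq_def by (auto simp: msat_atoms simp del: msat.simps(4))

lemma msat_exteq: "msat m (exteq i j) e \<longleftrightarrow> e i \<approx> e j"
  unfolding exteq_def msat_derived msat_atoms same_def ..

lemmas msat_unfold = msat_leib msat_exteq msat_derived msat.simps(2,3) msat_atoms not_not

lemma msat_ren: "msat m (ren f \<phi>) e = msat m \<phi> (\<lambda>i. e (f i))"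
proof (induction \<phi> arbitrary: f e)
  case (Al \<phi>)
  have "(\<lambda>i. case_nat a e (lift f i)) = case_nat a (\<lambda>i. e (f i))" for a
    by (auto simp: lift_def fun_eq_iff split: nat.splits)
  with Al show ?case by simp
qed (simp_all add: comp_def)

lemma skip1: "(\<lambda>i. case_nat a (case_nat b e) (skip 1 i)) = case_nat a e"
  by (auto simp: skip_def fun_eq_iff split: nat.splits)

lemma skip2: "(\<lambda>i. case_nat a (case_nat b (case_nat c e)) (skip 2 i)) = case_nat a (case_nat b e)"
  by (auto simp: skip_def fun_eq_iff split: nat.splits) 

lemma sub_iff: "sub a b \<longleftrightarrow> (\<forall>c. c \<epsilon> a --> c \<in>\<in> b)"
  using ax[OF incl_unfold, of "case_nat a (\<lambda>_. b)"] unfolding msat_unfold by (auto simp: numeral_2_eq_2)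

lemma elem_iff: "a \<in>\<in> b \<longleftrightarrow> (\<exists>c. a \<approx> c \<and> c \<epsilon> b)"
  using ax[OF not_in_unfold, of "case_nat a (\<lambda>_. b)"] unfolding msat_unfold same_def
  by (auto simp: numeral_2_eq_2)

lemma compr: "\<exists>w. \<forall>x. x \<epsilon> w \<longleftrightarrow> msat m \<phi> (case_nat x e) \<and> start x"
  using ax[OF comprehension[of \<phi>], of e] unfolding msat_unfold msat_ren skip1 by auto

lemma pair_compr: "\<exists>f. (\<forall>w. w \<epsilon> f --> w \<epsilon> e k) \<and>
    (\<forall>x y. pair_eps x y f \<longleftrightarrow> msat m \<phi> (case_nat y (case_nat x e)) \<and> pair_eps x y (e k))"
  using ax[OF pair_comprehension[of k \<phi>], of e] unfolding msat_unfold msat_ren skip2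
  by (auto simp: eval_nat_numeral)

lemma eps_ind:
  assumes "\<And>x. (\<And>y. y \<epsilon> x ==> msat m \<phi> (case_nat y e)) ==> msat m \<phi> (case_nat x e)"
  shows "msat m \<phi> (case_nat x e)"
proof -
  have "(\<forall>x. (\<forall>y. \<not> msat m \<phi> (case_nat y e) --> \<not> y \<epsilon> x) --> msat m \<phi> (case_nat x e))
      --> (\<forall>x. msat m \<phi> (case_nat x e))"
    using ax[OF eps_induction[of \<phi>], of e] unfolding msat_unfold msat_ren skip1 by (simp (no_asm_use))
  then show ?thesis using assms by blast
qed

lemma choice_ex: "\<exists>c. \<forall>x y. pair_eps x y z --> (\<exists>\<nu> y'. ch c x \<nu> y' \<and> pair_eps x y' z \<and> gim \<nu>)"
proof -
  have "\<exists>c. \<forall>x y. (\<forall>\<nu> y'. ch c x \<nu> y' --> pair_eps x y' z --> \<not> gim \<nu>) --> \<not> pair_eps x y z"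
    using ax[OF choice_ax, of "\<lambda>_. z"] unfolding msat_unfold by (simp add: eval_nat_numeral)
  then show ?thesis by blast
qed

lemma choice_eq: "\<nu> \<doteq> \<nu>' ==> ch c x \<nu> y ==> ch c x \<nu>' y' ==> y \<doteq> y'"
  using ax[OF choice_fun, of "\<lambda>i. [y, y', \<nu>, \<nu>', c, x] ! i"] unfolding msat_unfold
  by (simp add: eval_nat_numeral)

lemma start_0: "\<exists>e. start e \<and> (\<forall>u. \<not> u \<epsilon> e)"
  using ax[OF start_empty, of undefined] unfolding msat_unfold by simp

lemma start_Suc: "\<exists>y. (start x --> start y) \<and> (\<forall>u. u \<epsilon> x --> u \<epsilon> y) \<and> x \<epsilon> y \<and> (\<forall>u. u \<epsilon> y --> u \<epsilon> x \<or> u \<doteq> x)"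
proof -
  have "\<exists>y. (\<not> start y --> \<not> start x) \<and> (\<forall>u. \<not> u \<epsilon> y --> \<not> u \<epsilon> x) \<and> x \<epsilon> y \<and>
    (\<forall>u. \<not> u \<epsilon> x --> \<not> u \<doteq> x --> \<not> u \<epsilon> y)"
    using ax[OF start_succ, of "\<lambda>_. x"] unfolding msat_unfold by (simp add: eval_nat_numeral)
  then show ?thesis by blast
qed

lemma same_sym: "x \<approx> y ==> y \<approx> x"
  by (simp add: same_def)

lemma same_refl: "x \<approx> x"
proof -
  have "msat m (inc 0 0) (case_nat x undefined)"
  proof (rule eps_ind)
    fix x assume IH: "\<And>y. y \<epsilon> x ==> msat m (inc 0 0) (case_nat y undefined)"
    then have "y \<approx> y" if "y \<epsilon> x" for y using that by (simp add: same_def sub_def)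
    then have "sub x x" unfolding sub_iff elem_iff by blast
    then show "msat m (inc 0 0) (case_nat x undefined)" by (simp add: sub_def)
  qed
  then show ?thesis by (simp add: same_def sub_def)
qed

lemma same_trans: "x \<approx> y ==> y \<approx> z ==> x \<approx> z"
proof -
  \<comment> \<open>Induction is a scheme over formulas, so the statement, with y and z quantified,
    is written out as syntax.\<close>
  define \<phi> where "\<phi> = Al (Al (Im (exteq 2 1) (Im (exteq 1 0) (exteq 2 0))))"
  have \<phi>: "msat m \<phi> (case_nat x e) \<longleftrightarrow> (\<forall>y z. x \<approx> y --> y \<approx> z --> x \<approx> z)" for x e
    unfolding \<phi>_def msat_unfold by (simp add: numeral_2_eq_2)
  have "msat m \<phi> (case_nat x undefined)"
  proof (rule eps_ind)
    fix x assume IH: "\<And>y. y \<epsilon> x ==> msat m \<phi> (case_nat y undefined)"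
    have "c \<approx> e" if "c \<epsilon> x" "c \<approx> d" "d \<approx> e" for c d e using IH[OF that(1)] that unfolding \<phi> by blast
    then have "x \<approx> z" if "x \<approx> y" "y \<approx> z" for y z
      using that unfolding same_def[of x] same_def[of y] sub_iff elem_iff using same_sym by meson
    then show "msat m \<phi> (case_nat x undefined)" unfolding \<phi> by blast
  qed
  then show "x \<approx> y ==> y \<approx> z ==> x \<approx> z" unfolding \<phi> by blast
qed

lemma elem_left: "x \<in>\<in> b ==> x \<approx> y ==> y \<in>\<in> b"
  unfolding elem_iff using same_trans same_sym by blast

lemma elem_sub: "x \<in>\<in> a ==> sub a b ==> x \<in>\<in> b"
  using elem_left same_sym sub_iff elem_iff[of x a] by blast

lemma elem_right: "x \<in>\<in> a ==> a \<approx> b ==> x \<in>\<in> b"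
  using elem_sub by (simp add: same_def)

lemma eps_elem: "x \<epsilon> a ==> x \<in>\<in> a"
  unfolding elem_iff using same_refl by blast

text \<open>Leibniz equality gives what a set can separate. The set of all v extensionally equal to
  y is available only inside \<open>start\<close>, hence the hypothesis on y.\<close>

lemma leq_same:
  assumes "x \<doteq> y" "start y" shows "x \<approx> y"
proof -
  obtain w where "\<And>v. v \<epsilon> w \<longleftrightarrow> v \<approx> y \<and> start v"
    using compr[of "exteq 0 1" "\<lambda>_. y"] unfolding msat_unfold by auto
  then show ?thesis using assms same_refl unfolding leq_def by blast
qed

section \<open>Extensional ordinals and natural numbers of a two-valued structure\<close>

definition "tran x \<longleftrightarrow> (\<forall>y z. y \<in>\<in> x --> z \<in>\<in> y --> z \<in>\<in> x)"
definition "ord x \<longleftrightarrow> tran x \<and> (\<forall>y. y \<in>\<in> x --> tran y)"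

definition tran_fm :: "nat => pred form" where
  "tran_fm x = Al (Al (Im (Ng (ni 1 (x+2))) (Im (Ng (ni 0 1)) (Ng (ni 0 (x+2))))))"

definition ord_fm :: "nat => pred form" where
  "ord_fm x = An (tran_fm x) (Al (Im (Ng (ni 0 (x+1))) (tran_fm 0)))"

lemma msat_tran: "msat m (tran_fm i) e \<longleftrightarrow> tran (e i)"
  unfolding tran_fm_def tran_def msat_unfold by simp

lemma msat_ord: "msat m (ord_fm i) e \<longleftrightarrow> ord (e i)"
  unfolding ord_fm_def ord_def msat_unfold msat_tran by simp

lemma tran_same: "tran x ==> x \<approx> y ==> tran y"
  unfolding tran_def using elem_right same_sym by meson

lemma ord_same: "ord x ==> x \<approx> y ==> ord y"
  unfolding ord_def using tran_same elem_right same_sym by meson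

lemma ord_elem: "ord x ==> y \<in>\<in> x ==> ord y"
  unfolding ord_def tran_def by meson

text \<open>The usual double induction. It runs along nonextensional membership, which suffices
  because every extensional member is extensionally equal to a nonextensional one.\<close>

lemma ord_linear:
  assumes "ord a" "ord b" shows "a \<in>\<in> b \<or> a \<approx> b \<or> b \<in>\<in> a"
proof -
  define \<psi> where "\<psi> = (\<lambda>a b. Im (ord_fm b) (Orr (Ng (ni a b)) (Orr (exteq a b) (Ng (ni b a)))))"
  have \<psi>: "msat m (\<psi> i j) e \<longleftrightarrow> (ord (e j) --> e i \<in>\<in> e j \<or> e i \<approx> e j \<or> e j \<in>\<in> e i)" for i j e
    unfolding \<psi>_def msat_unfold msat_ord ..
  define \<phi> where "\<phi> = Im (ord_fm 0) (Al (\<psi> 1 0))"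
  have \<phi>: "msat m \<phi> (case_nat a e) \<longleftrightarrow> (ord a --> (\<forall>b. ord b --> a \<in>\<in> b \<or> a \<approx> b \<or> b \<in>\<in> a))" for a e
    unfolding \<phi>_def msat_unfold msat_ord \<psi> by simp
  have "msat m \<phi> (case_nat a undefined)"
  proof (rule eps_ind)
    fix a assume IH: "\<And>y. y \<epsilon> a ==> msat m \<phi> (case_nat y undefined)"
    show "msat m \<phi> (case_nat a undefined)"
      unfolding \<phi>
    proof (intro impI allI)
      fix b assume a: "ord a" and "ord b"
      have "msat m (\<psi> 1 0) (case_nat b (\<lambda>_. a))"
      proof (rule eps_ind)
        fix b assume IH': "\<And>y. y \<epsilon> b ==> msat m (\<psi> 1 0) (case_nat y (\<lambda>_. a))"
        show "msat m (\<psi> 1 0) (case_nat b (\<lambda>_. a))"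
          unfolding \<psi>
        proof (simp, intro impI)
          assume b: "ord b"
          have 1: "y \<in>\<in> b \<or> b \<in>\<in> a" if "y \<epsilon> a" for y
          proof -
            have "y \<in>\<in> a" using that by (rule eps_elem)
            moreover have "y \<in>\<in> b \<or> y \<approx> b \<or> b \<in>\<in> y"
              using IH[OF that] ord_elem[OF a calculation] b unfolding \<phi> by blast
            ultimately show ?thesis using a elem_left unfolding ord_def tran_def by blast
          qed
          have 2: "y \<in>\<in> a \<or> a \<in>\<in> b" if "y \<epsilon> b" for y
          proof -
            have "y \<in>\<in> b" using that by (rule eps_elem)
            moreover have "a \<in>\<in> y \<or> a \<approx> y \<or> y \<in>\<in> a"
              using IH'[OF that] ord_elem[OF b calculation] unfolding \<psi> by simp
            ultimately show ?thesis using b elem_left same_sym unfolding ord_def tran_def by blast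
          qed
          show "a \<in>\<in> b \<or> a \<approx> b \<or> b \<in>\<in> a"
            using 1 2 unfolding same_def sub_iff by blast
        qed
      qed
      then show "a \<in>\<in> b \<or> a \<approx> b \<or> b \<in>\<in> a" using \<open>ord b\<close> unfolding \<psi> by simp
    qed
  qed
  then show ?thesis using assms unfolding \<phi> by blast
qed

definition "induct w \<longleftrightarrow> (\<exists>e. e \<in>\<in> w \<and> (\<forall>u. \<not> u \<in>\<in> e)) \<and>
  (\<forall>x. x \<in>\<in> w --> (\<exists>y. y \<in>\<in> w \<and> (\<forall>u. u \<in>\<in> y \<longleftrightarrow> u \<in>\<in> x \<or> u \<approx> x)))"

lemma msat_inductive: "msat m (inductive_fm i) e \<longleftrightarrow> induct (e i)"
  unfolding inductive_fm_def induct_def msat_unfold by (simp add: eval_nat_numeral)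

definition "natural n \<longleftrightarrow> (\<forall>w. induct w --> n \<in>\<in> w)"

lemma msat_natural: "msat m (natural_fm i) e \<longleftrightarrow> natural (e i)"
  unfolding natural_fm_def natural_def msat_unfold msat_inductive by simp

text \<open>The ordinals inside \<open>start\<close> form an inductive set, so every natural number
  is extensionally equal to one of them.\<close>

lemma natural_ord:
  assumes "natural n" shows "ord n"
proof -
  obtain w where w: "\<And>x. x \<epsilon> w \<longleftrightarrow> ord x \<and> start x"
    using compr[of "ord_fm 0" undefined] by (auto simp: msat_ord)
  have "induct w" unfolding induct_def
  proof (intro conjI allI impI)
    obtain e where "start e" "\<And>u. \<not> u \<epsilon> e" using start_0 by blast
    moreover from this have "\<not> u \<in>\<in> e" for u unfolding elem_iff by blast
    moreover from this have "ord e" unfolding ord_def tran_def by blast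
    ultimately show "\<exists>e. e \<in>\<in> w \<and> (\<forall>u. \<not> u \<in>\<in> e)" using w eps_elem by blast
  next
    fix x assume "x \<in>\<in> w"
    then obtain x' where x': "x \<approx> x'" "ord x'" "start x'" unfolding elem_iff w by blast
    obtain y where y: "start y" "\<And>u. u \<epsilon> x' ==> u \<epsilon> y" "x' \<epsilon> y" "\<And>u. u \<epsilon> y ==> u \<epsilon> x' \<or> u \<doteq> x'"
      using start_Suc[of x'] x'(3) by blast
    have y': "u \<in>\<in> y \<longleftrightarrow> u \<in>\<in> x' \<or> u \<approx> x'" for u
    proof
      assume "u \<in>\<in> y"
      then obtain c where "u \<approx> c" "c \<epsilon> y" unfolding elem_iff by blast
      then show "u \<in>\<in> x' \<or> u \<approx> x'" using y(4) leq_same[OF _ x'(3)] same_trans unfolding elem_iff by blast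
    next
      assume "u \<in>\<in> x' \<or> u \<approx> x'"
      then show "u \<in>\<in> y" using y(2,3) unfolding elem_iff by blast
    qed
    have "tran u" if "u \<in>\<in> y" for u
      using that x'(2) tran_same same_sym unfolding y' ord_def by blast
    moreover have "tran y" unfolding tran_def
      using x'(2) elem_right unfolding y' ord_def tran_def by blast
    ultimately have "y \<epsilon> w" using w y(1) unfolding ord_def by blast
    moreover have "u \<in>\<in> y \<longleftrightarrow> u \<in>\<in> x \<or> u \<approx> x" for u
      unfolding y' using x'(1) elem_right same_sym same_trans by blast
    ultimately show "\<exists>y. y \<in>\<in> w \<and> (\<forall>u. u \<in>\<in> y \<longleftrightarrow> u \<in>\<in> x \<or> u \<approx> x)" using eps_elem by blast
  qed
  then have "n \<in>\<in> w" using assms unfolding natural_def by blast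
  then show ?thesis unfolding elem_iff w using ord_same same_sym by blast
qed

section \<open>From a numbering of the indices to a choice function\<close>

lemma msat_countable: "msat m countable_fm e \<longleftrightarrow> (\<exists>g.
    (\<forall>x. gim x --> (\<exists>n. natural n \<and> pair_eps x n g)) \<and>
    (\<forall>x n n'. pair_eps x n g --> pair_eps x n' g --> n \<approx> n') \<and>
    (\<forall>x x' n n'. pair_eps x n g --> pair_eps x' n' g --> n \<approx> n' --> x \<doteq> x'))"
  unfolding countable_fm_def msat_unfold msat_natural by (simp add: eval_nat_numeral)

lemma msat_neac: "msat m neac_fm e \<longleftrightarrow> (\<forall>z. \<exists>f. (\<forall>w. \<not> w \<epsilon> z --> \<not> w \<epsilon> f) \<and>
    (\<forall>x y y'. pair_eps x y f --> pair_eps x y' f --> y \<doteq> y') \<and>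
    (\<forall>x y. \<exists>y'. pair_eps x y z --> pair_eps x y' f))"
  unfolding neac_fm_def msat_unfold by (simp add: eval_nat_numeral)

theorem countable_imp_neac: "msat m (Im countable_fm neac_fm) e"
proof -
  have "\<exists>f. (\<forall>w. \<not> w \<epsilon> z --> \<not> w \<epsilon> f) \<and>
    (\<forall>x y y'. pair_eps x y f --> pair_eps x y' f --> y \<doteq> y') \<and>
    (\<forall>x y. \<exists>y'. pair_eps x y z --> pair_eps x y' f)"
    if total: "\<And>x. gim x ==> \<exists>n. natural n \<and> pair_eps x n g"
      and inj: "\<And>x x' n n'. pair_eps x n g ==> pair_eps x' n' g ==> n \<approx> n' ==> x \<doteq> x'" for g z
  proof -
    obtain c where c: "\<And>x y. pair_eps x y z ==> \<exists>\<nu> y'. ch c x \<nu> y' \<and> pair_eps x y' z \<and> gim \<nu>"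
      using choice_ex by blast
    \<comment> \<open>An index is successful for x if the value chosen at it really lies in the
      fibre of z over x.\<close>
    define S where "S x \<nu> \<longleftrightarrow> (\<exists>y. ch c x \<nu> y \<and> pair_eps x y z)" for x \<nu>
    define S_fm where "S_fm = (\<lambda>c z x \<nu>. Exi (An (Ng (nch (c+1) (x+1) (\<nu>+1) 0)) (Ng (np (x+1) 0 (z+1)))))"
    have S_fm: "msat m (S_fm i j k l) e \<longleftrightarrow> S (e k) (e l)" if "e i = c" "e j = z" for i j k l e
      using that unfolding S_fm_def S_def msat_unfold by simp
    \<comment> \<open>The value y comes from an index whose number is extensionally minimal among
      the numbers of successful indices. Success of the index itself is ensured later by
      intersecting with z.\<close>
    define P where "P x y \<longleftrightarrow> (\<exists>\<nu> n. ch c x \<nu> y \<and> pair_eps \<nu> n g \<and> ord n \<and>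
      (\<forall>\<nu>' n'. pair_eps \<nu>' n' g --> ord n' --> n' \<in>\<in> n --> \<not> S x \<nu>'))" for x y
    define P_fm where "P_fm = Exi (Exi (An (Ng (nch 4 3 1 2)) (An (Ng (np 1 0 5)) (An (ord_fm 0)
      (Al (Al (Im (Ng (np 1 0 7)) (Im (ord_fm 0) (Im (Ng (ni 0 2)) (Ng (S_fm 6 8 5 1)))))))))))"
    define e where "e = (\<lambda>i. [c, g, z] ! i)"
    have P_fm: "msat m P_fm (case_nat y (case_nat x e)) \<longleftrightarrow> P x y" for x y
      unfolding P_fm_def P_def msat_unfold msat_ord by (simp add: S_fm e_def eval_nat_numeral)
    obtain f where f: "\<And>w. w \<epsilon> f ==> w \<epsilon> z" "\<And>x y. pair_eps x y f \<longleftrightarrow> P x y \<and> pair_eps x y z"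
      using pair_compr[of e 2 P_fm] unfolding P_fm by (auto simp: e_def)
    have PS: "\<exists>\<nu> n. ch c x \<nu> y \<and> pair_eps \<nu> n g \<and> ord n \<and> S x \<nu> \<and>
        (\<forall>\<nu>' n'. pair_eps \<nu>' n' g --> ord n' --> n' \<in>\<in> n --> \<not> S x \<nu>')" if y: "pair_eps x y f" for x y
    proof -
      have "P x y" "pair_eps x y z" using y f(2) by blast+
      then obtain \<nu> n where "ch c x \<nu> y" "pair_eps \<nu> n g" "ord n"
          "\<forall>\<nu>' n'. pair_eps \<nu>' n' g --> ord n' --> n' \<in>\<in> n --> \<not> S x \<nu>'"
        unfolding P_def by (elim exE conjE)
      moreover have "S x \<nu>" unfolding S_def using \<open>ch c x \<nu> y\<close> \<open>pair_eps x y z\<close> by blast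
      ultimately show ?thesis by blast
    qed
    have "y \<doteq> y'" if y: "pair_eps x y f" "pair_eps x y' f" for x y y'
    proof -
      obtain \<nu> n where 1: "ch c x \<nu> y" "pair_eps \<nu> n g" "ord n" "S x \<nu>"
          "\<forall>\<nu>' n'. pair_eps \<nu>' n' g --> ord n' --> n' \<in>\<in> n --> \<not> S x \<nu>'"
        using PS[OF y(1)] by (elim exE conjE)
      obtain \<nu>' n' where 2: "ch c x \<nu>' y'" "pair_eps \<nu>' n' g" "ord n'" "S x \<nu>'"
          "\<forall>\<nu> k. pair_eps \<nu> k g --> ord k --> k \<in>\<in> n' --> \<not> S x \<nu>"
        using PS[OF y(2)] by (elim exE conjE)
      have "n \<approx> n'" using ord_linear[OF 1(3) 2(3)] 1 2 by blast
      \<comment> \<open>Extensionally equal numbers belong to Leibniz-equal indices, and these carry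
        Leibniz-equal values.\<close>
      then show ?thesis using choice_eq[OF inj[OF 1(2) 2(2)] 1(1) 2(1)] by blast
    qed
    moreover have "\<exists>y'. pair_eps x y z --> pair_eps x y' f" for x y
    proof (rule ccontr)
      assume "\<nexists>y'. pair_eps x y z --> pair_eps x y' f"
      then have xy: "pair_eps x y z" and no: "\<And>y'. \<not> pair_eps x y' f" by blast+
      obtain \<nu> y' where \<nu>: "ch c x \<nu> y'" "pair_eps x y' z" "gim \<nu>" using c[OF xy] by blast
      obtain n where n: "natural n" "pair_eps \<nu> n g" using total[OF \<nu>(3)] by blast
      \<comment> \<open>Induction showing that no number belongs to a successful index. It covers
        all ordinals extensionally equal to the induction variable, because smaller numbers are
        reached only up to extensional equality.\<close>
      define \<phi> where "\<phi> = Al (Al (Im (Ng (np 1 0 4)) (Im (ord_fm 0) (Im (exteq 0 2) (Ng (S_fm 3 5 6 1))))))"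
      define e where "e = (\<lambda>i. [c, g, z, x] ! i)"
      have \<phi>: "msat m \<phi> (case_nat n e) \<longleftrightarrow> (\<forall>\<nu> n'. pair_eps \<nu> n' g --> ord n' --> n' \<approx> n --> \<not> S x \<nu>)" for n
        unfolding \<phi>_def msat_unfold msat_ord by (simp add: S_fm e_def eval_nat_numeral)
      have "msat m \<phi> (case_nat n e)"
      proof (rule eps_ind)
        fix n assume IH: "\<And>k. k \<epsilon> n ==> msat m \<phi> (case_nat k e)"
        show "msat m \<phi> (case_nat n e)" unfolding \<phi>
        proof (intro allI impI notI)
          fix \<nu> n' assume *: "pair_eps \<nu> n' g" "ord n'" "n' \<approx> n" "S x \<nu>"
          obtain y'' where y'': "ch c x \<nu> y''" "pair_eps x y'' z" using *(4) unfolding S_def by blast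
          have "\<not> S x \<nu>'" if "pair_eps \<nu>' k g" "ord k" "k \<in>\<in> n'" for \<nu>' k
          proof -
            have "k \<in>\<in> n" using elem_right[OF that(3) *(3)] .
            then show ?thesis using IH that(1,2) unfolding elem_iff \<phi> by blast
          qed
          then have "pair_eps x y'' f" unfolding f P_def using * y'' by blast
          with no show False by blast
        qed
      qed
      then show False using \<nu>(1,2) n natural_ord same_refl unfolding \<phi> S_def by blast
    qed
    ultimately show ?thesis using f(1) by blast
  qed
  then show ?thesis unfolding msat.simps msat_countable msat_neac by blast
qed

end

section \<open>Realizing the axioms\<close>

context set_structure
begin

text \<open>All but the first \<open>k\<close> variables become parameters. This admits an arbitrary
  external assignment of the free variables, even though it need not be an object of the
  model.\<close>

lemma dfn_fix:
  assumes "dfn P" shows "dfn (\<lambda>e. P (\<lambda>i. if i < k then e i else c i))"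
proof -
  obtain \<phi> p where \<phi>: "\<And>e. sat (mix e p) \<phi> = P e"
    using assms by (auto simp: dfn_def)
  \<comment> \<open>Old parameters go to the places 4j+1 and the fixed variables to 4j+3, matching
    the storage order of \<open>mix p c\<close>.\<close>
  define f where "f i = (if odd i then 2 * i - 1 else if i div 2 < k then i else 2 * i + 3)" for i :: nat
  have "inj f" unfolding f_def by (rule injI; simp split: if_splits; presburger)
  moreover have "mix e (mix p c) (f i) = mix (\<lambda>i. if i < k then e i else c i) p i" for e i
  proof (cases "odd i")
    case True
    then obtain j where j: "i = 2 * j + 1" by (elim oddE)
    have "f i = Suc (2 * (2 * j))" by (simp add: f_def j)
    then show ?thesis by (simp add: mix_def j del: mult_Suc_right)
  next
    case False
    then have "even i" by simp
    then obtain j where j: "i = 2 * j" by (rule evenE)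
    have "f i = (if j < k then 2 * j else Suc (2 * Suc (2 * j)))" by (simp add: f_def j)
    then show ?thesis by (simp add: mix_def j del: mult_Suc_right)
  qed
  ultimately have "sat (mix e (mix p c)) (rename f \<phi>) = P (\<lambda>i. if i < k then e i else c i)" for e
    by (simp add: sat_rename \<phi>)
  then show ?thesis unfolding dfn_def by blast
qed

end

text \<open>The explicit default keeps atoms with too few arguments definable, so that
  \<open>interp\<close> needs no arity condition.\<close>

definition arg :: "'a list => nat => 'a" where
  "arg xs k = (if k < length xs then xs ! k else undefined)"

context zf_realizability
begin

lemma realizes_Imp_iff:
  "\<xi> \<tturnstile> (F \<^bold>\<longrightarrow> G) \<longleftrightarrow> (\<forall>\<eta> \<pi>. \<eta> \<in>\<^sub>M \<Lambda> --> \<eta> \<tturnstile> F --> \<pi> \<in> G --> \<xi> \<bottom> \<eta> \<cdot> \<pi>)"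
  unfolding realizes_def Imp_def by blast

lemma realizesI: "(\<And>\<pi>. \<pi> \<in> F ==> \<xi> \<bottom> \<pi>) ==> \<xi> \<tturnstile> F"
  unfolding realizes_def by blast

lemma realizesD: "\<xi> \<tturnstile> F ==> \<pi> \<in> F ==> \<xi> \<bottom> \<pi>"
  unfolding realizes_def by blast

lemma realizes_ImpD: "\<xi> \<tturnstile> (F \<^bold>\<longrightarrow> G) ==> \<eta> \<in>\<^sub>M \<Lambda> ==> \<eta> \<tturnstile> F ==> \<pi> \<in> G ==> \<xi> \<bottom> \<eta> \<cdot> \<pi>"
  unfolding realizes_Imp_iff by blast

lemma realizes_All: "\<xi> \<tturnstile> All F \<longleftrightarrow> (\<forall>a. \<xi> \<tturnstile> F a)"
  unfolding realizes_def All_def by blast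

lemma mem_Bot [simp]: "\<pi> \<in> Bot \<longleftrightarrow> \<pi> \<in>\<^sub>M \<Pi>"
  unfolding Bot_def by simp

lemma realizes_app:
  assumes "\<xi> \<tturnstile> (F \<^bold>\<longrightarrow> G)" "\<eta> \<tturnstile> F" "\<xi> \<in>\<^sub>M \<Lambda>" "\<eta> \<in>\<^sub>M \<Lambda>" "G \<subseteq> Bot"
  shows "\<xi> \<bullet> \<eta> \<tturnstile> G"
proof (rule realizesI)
  fix \<pi> assume "\<pi> \<in> G"
  then show "\<xi> \<bullet> \<eta> \<bottom> \<pi>"
    using assms by (intro pole_intros) (auto simp: realizes_Imp_iff)
qed

lemma realizes_I: "G \<subseteq> F ==> G \<subseteq> Bot ==> val A I \<tturnstile> (F \<^bold>\<longrightarrow> G)"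
  unfolding realizes_Imp_iff val.simps
  by (intro allI impI pole_intros) (auto dest: realizesD)

lemma realizes_K:
  assumes "F \<subseteq> Bot" shows "val A K \<tturnstile> (F \<^bold>\<longrightarrow> G \<^bold>\<longrightarrow> F)"
proof (rule realizesI, elim mem_Imp[THEN iffD1, elim_format] exE conjE, clarify)
  fix \<xi> \<eta> \<pi> assume *: "\<xi> \<in>\<^sub>M \<Lambda>" "\<xi> \<tturnstile> F" "\<eta> \<in>\<^sub>M \<Lambda>" "\<pi> \<in> F"
  have "\<pi> \<in>\<^sub>M \<Pi>" using * assms by auto
  moreover have "\<xi> \<bottom> \<pi>" using * by (blast dest: realizesD)
  ultimately show "val A K \<bottom> \<xi> \<cdot> \<eta> \<cdot> \<pi>"
    using * unfolding val.simps by (intro pole_intros)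
qed

text \<open>The combinator S expressed by B, C and W, namely B (B (B W) C) (B B).\<close>

definition S_tm :: cterm where
  "S_tm = App (App B (App (App B (App B W)) C)) (App B B)"

lemma realizes_S:
  assumes "F \<subseteq> Bot" "G \<subseteq> Bot" "H \<subseteq> Bot"
  shows "val A S_tm \<tturnstile> ((F \<^bold>\<longrightarrow> G \<^bold>\<longrightarrow> H) \<^bold>\<longrightarrow> (F \<^bold>\<longrightarrow> G) \<^bold>\<longrightarrow> F \<^bold>\<longrightarrow> H)"
proof (rule realizesI, elim mem_Imp[THEN iffD1, elim_format] exE conjE, clarify)
  fix \<xi> \<eta> \<zeta> \<pi>
  assume *: "\<xi> \<in>\<^sub>M \<Lambda>" "\<xi> \<tturnstile> (F \<^bold>\<longrightarrow> G \<^bold>\<longrightarrow> H)" "\<eta> \<in>\<^sub>M \<Lambda>" "\<eta> \<tturnstile> (F \<^bold>\<longrightarrow> G)" "\<zeta> \<in>\<^sub>M \<Lambda>" "\<zeta> \<tturnstile> F" "\<pi> \<in> H"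
  have \<pi>: "\<pi> \<in>\<^sub>M \<Pi>" using *(7) assms by auto
  have "\<eta> \<bullet> \<zeta> \<tturnstile> G" using * assms by (intro realizes_app)
  then have "(\<eta> \<bullet> \<zeta>) \<cdot> \<pi> \<in> (G \<^bold>\<longrightarrow> H)" unfolding mem_Imp using * by blast
  then have "\<xi> \<bottom> \<zeta> \<cdot> (\<eta> \<bullet> \<zeta>) \<cdot> \<pi>" using *(5,6) by (intro realizes_ImpD[OF *(2)])
  then show "val A S_tm \<bottom> \<xi> \<cdot> \<eta> \<cdot> \<zeta> \<cdot> \<pi>"
    using * \<pi> unfolding S_tm_def val.simps by (intro pole_intros closed)
qed

text \<open>For \<pi> in the falsity value of F, the continuation of \<pi> realizes the negation of
  F: it discards the current stack and puts its argument in front of \<pi>.\<close>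

lemma realizes_cc:
  assumes "F \<subseteq> Bot" shows "val A CC \<tturnstile> (((F \<^bold>\<longrightarrow> Bot) \<^bold>\<longrightarrow> Bot) \<^bold>\<longrightarrow> F)"
  unfolding realizes_Imp_iff[of _ _ F]
proof (intro allI impI)
  fix \<xi> \<pi> assume *: "\<xi> \<in>\<^sub>M \<Lambda>" "\<xi> \<tturnstile> ((F \<^bold>\<longrightarrow> Bot) \<^bold>\<longrightarrow> Bot)" "\<pi> \<in> F"
  have \<pi>: "\<pi> \<in>\<^sub>M \<Pi>" using *(3) assms by auto
  have "kont A \<pi> \<tturnstile> (F \<^bold>\<longrightarrow> Bot)"
    unfolding realizes_Imp_iff using \<pi> *(3) by (auto intro!: pole_intros dest: realizesD)
  then have "\<xi> \<bottom> kont A \<pi> \<cdot> \<pi>" using * \<pi> by (intro realizes_ImpD[OF *(2)]) auto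
  then show "val A CC \<bottom> \<xi> \<cdot> \<pi>" using * \<pi> unfolding val.simps by (intro pole_intros)
qed

text \<open>The term \<open>\<lambda>\<xi>. \<xi> t\<close>: an existential statement is a doubly
  negated one, and the witness itself leaves no trace in the realizer.\<close>

definition ex_tm :: "cterm => cterm" where
  "ex_tm t = App (App C I) t"

text \<open>The pairing \<open>\<lambda>\<xi>. \<xi> t u\<close>.\<close>

definition and_tm :: "cterm => cterm => cterm" where
  "and_tm t u = App (App C (App (App C I) t)) u"

lemma realizes_Ex: "val A t \<tturnstile> F a ==> val A (ex_tm t) \<tturnstile> (All (\<lambda>a. F a \<^bold>\<longrightarrow> Bot) \<^bold>\<longrightarrow> Bot)"
  unfolding realizes_Imp_iff[of _ _ Bot] ex_tm_def val.simps realizes_All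
  by (intro allI impI pole_intros closed) (auto intro: realizes_ImpD)

lemma realizes_And:
  assumes "val A t \<tturnstile> F" "val A u \<tturnstile> G" shows "val A (and_tm t u) \<tturnstile> ((F \<^bold>\<longrightarrow> G \<^bold>\<longrightarrow> Bot) \<^bold>\<longrightarrow> Bot)"
  unfolding realizes_Imp_iff[of _ _ Bot]
proof (intro allI impI)
  fix \<xi> \<pi> assume *: "\<xi> \<in>\<^sub>M \<Lambda>" "\<xi> \<tturnstile> (F \<^bold>\<longrightarrow> G \<^bold>\<longrightarrow> Bot)" "\<pi> \<in> Bot"
  then have "val A u \<cdot> \<pi> \<in> (G \<^bold>\<longrightarrow> Bot)" unfolding mem_Imp using assms * by (intro exI conjI) auto
  then have "\<xi> \<bottom> val A t \<cdot> val A u \<cdot> \<pi>" using assms by (intro realizes_ImpD[OF *(2)]) auto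
  then show "val A (and_tm t u) \<bottom> \<xi> \<cdot> \<pi>"
    using * unfolding and_tm_def val.simps(1-6) val.simps(7)[of A "App C (App (App C I) t)"]
      val.simps(7)[of A C] val.simps(7)[of A "App C I"] by (intro pole_intros closed val_mem) auto
qed

primrec fval :: "('p => 'v list => 'v set) => 'p form => (nat => 'v) => 'v set" where
  "fval J Fls e = Bot"
| "fval J (Im \<phi> \<psi>) e = (fval J \<phi> e \<^bold>\<longrightarrow> fval J \<psi> e)"
| "fval J (Al \<phi>) e = All (\<lambda>a. fval J \<phi> (case_nat a e))"
| "fval J (At p xs) e = J p (map e xs)"

lemma fval_ren: "fval J (ren f \<phi>) e = fval J \<phi> (\<lambda>i. e (f i))"
proof (induction \<phi> arbitrary: f e)
  case (Al \<phi>)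
  have "(\<lambda>i. case_nat a e (lift f i)) = case_nat a (\<lambda>i. e (f i))" for a
    by (auto simp: lift_def fun_eq_iff split: nat.splits)
  with Al show ?case by simp
qed (simp_all add: comp_def)

lemma fval_cong: "(\<And>i. i \<in> fvs \<phi> ==> e i = e' i) ==> fval J \<phi> e = fval J \<phi> e'"
proof (induction \<phi> arbitrary: e e')
  case (Al \<phi>)
  have "fval J \<phi> (case_nat a e) = fval J \<phi> (case_nat a e')" for a
    using Al.prems by (intro Al.IH) (auto split: nat.splits)
  then show ?case by simp
next
  case (Im \<phi> \<psi>)
  have "fval J \<phi> e = fval J \<phi> e'" by (rule Im.IH(1)) (use Im.prems in simp)
  moreover have "fval J \<psi> e = fval J \<psi> e'" by (rule Im.IH(2)) (use Im.prems in simp)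
  ultimately show ?case by simp
next
  case (At p xs)
  then have "map e xs = map e' xs" by simp
  then show ?case unfolding fval.simps by (rule arg_cong)
qed simp

lemma fdfn_fval:
  assumes "\<And>p xs. fdfn (\<lambda>e. J p (map e xs))" shows "fdfn (fval J \<phi>)"
proof (induction \<phi>)
  case (Al \<phi>)
  have "case_nat (e 0) (\<lambda>i. e (Suc i)) = e" for e :: "nat => 'v" by (auto split: nat.splits)
  then have "fdfn (\<lambda>e. All (\<lambda>a. fval J \<phi> (case_nat a e)))"
    using Al by (intro fdfn_All) simp
  then show ?case by simp
qed (simp_all add: fdfn_Bot fdfn_Imp assms)

text \<open>The term is fixed before the assignment. This makes generalization possible with the
  same term, by changing the value of the fresh variable. Instantiation and \<open>pull\<close> are
  realized by I, because the falsity values involved are included in one another or equal.\<close>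

lemma realizability_henkin:
  assumes "\<And>p xs. J p xs \<subseteq> Bot"
  shows "henkin (\<lambda>\<phi> :: 'p :: countable form. \<exists>t. \<forall>e. val A t \<tturnstile> fval J \<phi> e)"
proof -
  have sub: "fval J \<phi> e \<subseteq> Bot" for \<phi> :: "'p form" and e
  proof (induction \<phi> arbitrary: e)
    case (Al \<phi>)
    then show ?case unfolding fval.simps All_def by blast
  qed (simp_all add: assms)
  show ?thesis
  proof (unfold_locales, goal_cases)
    case (1 \<phi> \<psi>)
    then obtain t u where "\<forall>e. val A t \<tturnstile> fval J (Im \<phi> \<psi>) e" "\<forall>e. val A u \<tturnstile> fval J \<phi> e" by blast
    then have "\<forall>e. val A (App t u) \<tturnstile> fval J \<psi> e"
      using realizes_app[OF _ _ val_mem val_mem sub] by (metis fval.simps(2) val.simps(7))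
    then show ?case by blast
  next
    case (2 \<phi> \<psi>)
    show ?case unfolding fval.simps using realizes_K[OF sub] by blast
  next
    case (3 \<phi> \<psi> \<chi>)
    show ?case unfolding fval.simps using realizes_S[OF sub sub sub] by blast
  next
    case (4 \<phi>)
    show ?case unfolding fval.simps using realizes_cc[OF sub] by blast
  next
    case (5 \<phi> k)
    have "(\<lambda>i. e (case i of 0 => k | Suc j => id j)) = case_nat (e k) e" for e :: "nat => 'v"
      by (auto split: nat.splits)
    then have "fval J (inst k \<phi>) e \<subseteq> fval J (Al \<phi>) e" for e
      unfolding fval_ren fval.simps All_def by auto
    then have "val A I \<tturnstile> fval J (Im (Al \<phi>) (inst k \<phi>)) e" for e
      using realizes_I sub by simp
    then show ?case by blast
  next
    case (6 k \<phi>)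
    then obtain t where t: "\<And>e. val A t \<tturnstile> fval J (inst k \<phi>) e" by blast
    have "val A t \<tturnstile> fval J (Al \<phi>) e" for e
      unfolding fval.simps realizes_All
    proof
      fix a
      have "fval J (inst k \<phi>) (e(k := a)) = fval J \<phi> (case_nat a e)"
        unfolding fval_ren using 6(1) by (intro fval_cong) (auto split: nat.splits)
      then show "val A t \<tturnstile> fval J \<phi> (case_nat a e)" using t by metis
    qed
    then show ?case by blast
  next
    case (7 \<phi> \<psi>)
    have "fval J (Al (Im (ren Suc \<phi>) \<psi>)) e = fval J (Im \<phi> (Al \<psi>)) e" for e
      by (auto simp: fval_ren All_def Imp_def)
    then have "val A I \<tturnstile> fval J (Im (Al (Im (ren Suc \<phi>) \<psi>)) (Im \<phi> (Al \<psi>))) e" for e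
      by (subst fval.simps(2), intro realizes_I sub) blast
    then show ?case by blast
  qed
qed

section \<open>Individuals with prescribed falsity values\<close>

lemma ex_family:
  assumes "dfn (\<lambda>e. e 1 \<in> D (e 0))" "\<And>x. D x \<subseteq> Bot" "\<And>x \<pi>. \<pi> \<in> D x ==> x \<in>\<^sub>M T"
  shows "\<exists>w. \<forall>p. p \<in>\<^sub>M w \<longleftrightarrow> (\<exists>x \<pi>. \<pi> \<in> D x \<and> p = opair x \<pi>)"
proof (rule set_of_bounded)
  note [dfn_intros] = dfn2[of "\<lambda>x \<pi>. \<pi> \<in> D x", OF assms(1)]
  show "dfn (\<lambda>e. \<exists>x \<pi>. \<pi> \<in> D x \<and> e 0 = opair x \<pi>)" by (intro dfn_intros)
  fix p assume "\<exists>x \<pi>. \<pi> \<in> D x \<and> p = opair x \<pi>"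
  then obtain x \<pi> where "x \<in>\<^sub>M T" "\<pi> \<in>\<^sub>M \<Pi>" "p = opair x \<pi>" using assms(2,3) by fastforce
  then show "p \<in>\<^sub>M un (pow (pow (un T \<Pi>))) (upair empty empty)"
    by (auto simp: opair_def kpair_def subset_def)
qed

lemma not_eps_family:
  assumes "\<forall>p. p \<in>\<^sub>M w \<longleftrightarrow> (\<exists>x \<pi>. \<pi> \<in> D x \<and> p = opair x \<pi>)" "\<And>x. D x \<subseteq> Bot"
  shows "not_eps x w = D x"
  unfolding not_eps_def using assms(1) by (auto dest: subsetD[OF assms(2)])

lemma not_eps_transitive: "transitive T ==> a \<in>\<^sub>M T ==> \<pi> \<in> not_eps x a ==> x \<in>\<^sub>M T"
  unfolding not_eps_def using transitive_opair by blast

lemma dfn_fval_fix: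
  assumes "fdfn (fval J \<phi>)"
  shows "dfn (\<lambda>d. d 0 \<in> fval J \<phi> (\<lambda>i. if i < k then d (Suc i) else c i))"
proof -
  have "dfn (\<lambda>d. d 0 \<in> fval J \<phi> (\<lambda>i. d (Suc i)))" using assms unfolding fdfn_def by blast
  from dfn_fix[OF this, of "Suc k" "case_nat undefined c"] show ?thesis by (simp cong: if_cong)
qed

lemma dfn_fval1:
  assumes "fdfn (fval J \<phi>)" "tm t" "tm u" shows "dfn (\<lambda>d. t d \<in> fval J \<phi> (case_nat (u d) e))"
proof -
  have "(\<lambda>i. if i < 1 then d (Suc i) else case_nat undefined e i) = case_nat (d 1) e" for d :: "nat => 'v"
    by (auto split: nat.splits)
  then have "dfn (\<lambda>d. d 0 \<in> fval J \<phi> (case_nat (d 1) e))"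
    using dfn_fval_fix[OF assms(1), of 1 "case_nat undefined e"] by simp
  then show ?thesis by (rule dfn2[of "\<lambda>x y. x \<in> fval J \<phi> (case_nat y e)", OF _ assms(2,3)])
qed

lemma dfn_fval2:
  assumes "fdfn (fval J \<phi>)" "tm t" "tm u" "tm v"
  shows "dfn (\<lambda>d. t d \<in> fval J \<phi> (case_nat (u d) (case_nat (v d) e)))"
proof -
  have "(\<lambda>i. if i < 2 then d (Suc i) else case_nat undefined (case_nat undefined e) i) =
      case_nat (d 1) (case_nat (d 2) e)" for d :: "nat => 'v"
    by (auto simp: numeral_2_eq_2 split: nat.splits)
  then have "dfn (\<lambda>d. d 0 \<in> fval J \<phi> (case_nat (d 1) (case_nat (d 2) e)))"
    using dfn_fval_fix[OF assms(1), of 2 "case_nat undefined (case_nat undefined e)"] by simp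
  then show ?thesis
    by (rule dfn3[of "\<lambda>x y z. x \<in> fval J \<phi> (case_nat y (case_nat z e))", OF _ assms(2-4)])
qed

lemma mem_Imp_iff:
  assumes "F \<subseteq> Bot" "G \<subseteq> Bot"
  shows "\<pi> \<in> (F \<^bold>\<longrightarrow> G) \<longleftrightarrow>
    (\<exists>\<xi> \<rho>. is_push \<xi> \<rho> \<pi> \<and> (\<forall>\<sigma>. \<sigma> \<in> F --> in_pole \<xi> \<sigma>) \<and> \<rho> \<in> G)"
  unfolding mem_Imp is_push_def using realizes_iff assms by (metis mem_Bot subsetD)

text \<open>The falsity value of nonmembership in w is made literally equal to that of an
  implication, so both directions of the equivalence are realized by I.\<close>

lemma ex_comprehension:
  assumes "fdfn (fval J \<phi>)"
  shows "\<exists>w. \<forall>x. not_eps x w = (fval J \<phi> (case_nat x e) \<^bold>\<longrightarrow> not_eps x a)"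
proof -
  define D where "D x = (fval J \<phi> (case_nat x e) \<^bold>\<longrightarrow> not_eps x a)" for x
  obtain T where T: "transitive T" "a \<in>\<^sub>M T" by (rule ex_transitive)
  have sub: "fval J \<phi> d \<subseteq> Bot" "not_eps x a \<subseteq> Bot" for d x
    using assms by (auto simp: fdfn_def not_eps_def)
  have "\<exists>w. \<forall>p. p \<in>\<^sub>M w \<longleftrightarrow> (\<exists>x \<pi>. \<pi> \<in> D x \<and> p = opair x \<pi>)"
  proof (rule ex_family)
    show "dfn (\<lambda>d. d 1 \<in> D (d 0))"
      unfolding D_def mem_Imp_iff[OF sub]
      by (intro dfn_intros dfn_fval1 assms dfn_fdfn fdfn_not_eps)
    show "D x \<subseteq> Bot" for x unfolding D_def using sub by simp
    show "x \<in>\<^sub>M T" if "\<pi> \<in> D x" for x \<pi>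
      using that not_eps_transitive[OF T] unfolding D_def mem_Imp by blast
  qed
  then obtain w where "\<forall>p. p \<in>\<^sub>M w \<longleftrightarrow> (\<exists>x \<pi>. \<pi> \<in> D x \<and> p = opair x \<pi>)" ..
  then have "not_eps x w = D x" for x by (rule not_eps_family) (simp add: D_def sub)
  then show ?thesis unfolding D_def by blast
qed

text \<open>The set f receives pairs only. Each of its stacks is a term pushed on a stack of
  nonmembership in a; skipping that term, K realizes that f is included in a.\<close>

lemma ex_pair_comprehension:
  assumes "fdfn (fval J \<phi>)"
  shows "\<exists>f. (\<forall>x y. not_eps (opair x y) f = (fval J \<phi> (case_nat y (case_nat x e)) \<^bold>\<longrightarrow> not_eps (opair x y) a)) \<and>
    (\<forall>w \<pi>. \<pi> \<in> not_eps w f --> (\<exists>\<xi> \<rho>. \<xi> \<in>\<^sub>M \<Lambda> \<and> \<pi> = \<xi> \<cdot> \<rho> \<and> \<rho> \<in> not_eps w a))"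
proof -
  define D where "D p = {\<pi>. \<exists>x y. p = opair x y \<and> \<pi> \<in> (fval J \<phi> (case_nat y (case_nat x e)) \<^bold>\<longrightarrow> not_eps p a)}" for p
  obtain T where T: "transitive T" "a \<in>\<^sub>M T" by (rule ex_transitive)
  have sub: "fval J \<phi> d \<subseteq> Bot" "not_eps x a \<subseteq> Bot" for d x
    using assms by (auto simp: fdfn_def not_eps_def)
  have D: "D p \<subseteq> Bot" for p unfolding D_def using Imp_sub[OF sub(2)] by blast
  have "\<exists>w. \<forall>p. p \<in>\<^sub>M w \<longleftrightarrow> (\<exists>x \<pi>. \<pi> \<in> D x \<and> p = opair x \<pi>)"
  proof (rule ex_family)
    show "dfn (\<lambda>d. d 1 \<in> D (d 0))"
      unfolding D_def mem_Collect_eq mem_Imp_iff[OF sub]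
      by (intro dfn_intros dfn_fval2 assms dfn_fdfn fdfn_not_eps)
    show "x \<in>\<^sub>M T" if "\<pi> \<in> D x" for x \<pi>
      using that not_eps_transitive[OF T] unfolding D_def mem_Imp by blast
  qed (rule D)
  then obtain f where "\<forall>p. p \<in>\<^sub>M f \<longleftrightarrow> (\<exists>x \<pi>. \<pi> \<in> D x \<and> p = opair x \<pi>)" ..
  then have f: "not_eps p f = D p" for p by (rule not_eps_family) (rule D)
  show ?thesis
  proof (rule exI[of _ f], intro conjI allI impI)
    show "not_eps (opair x y) f = (fval J \<phi> (case_nat y (case_nat x e)) \<^bold>\<longrightarrow> not_eps (opair x y) a)" for x y
      unfolding f D_def by auto
    show "\<exists>\<xi> \<rho>. \<xi> \<in>\<^sub>M \<Lambda> \<and> \<pi> = \<xi> \<cdot> \<rho> \<and> \<rho> \<in> not_eps w a" if "\<pi> \<in> not_eps w f" for w \<pi>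
      using that unfolding f D_def mem_Imp by blast
  qed
qed

text \<open>\<open>A_tm a f \<succ> f (\<lambda>u. u (a a f))\<close>, so \<open>A_tm A_tm\<close> is Turing's fixed point combinator up to the abstraction.\<close>

definition A_tm :: cterm where
  "A_tm = App (App B W) (App (App B (App C B)) (App (App B (App B (App C I))) (App W I)))"

text \<open>The fixed point passes \<open>\<xi>\<close> a term that makes the recursive call. The
  proof is by induction inside the model: a stack of y not belonging to x comes with a pair in x, so
  the call already realizes the claim at y.\<close>

lemma realizes_induction:
  assumes "fdfn (fval J \<phi>)"
  shows "val A (App A_tm A_tm) \<tturnstile>
    (All (\<lambda>x. All (\<lambda>y. (fval J \<phi> (case_nat y e) \<^bold>\<longrightarrow> Bot) \<^bold>\<longrightarrow> not_eps y x) \<^bold>\<longrightarrow> fval J \<phi> (case_nat x e))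
      \<^bold>\<longrightarrow> All (\<lambda>x. fval J \<phi> (case_nat x e)))"
  unfolding realizes_Imp_iff[of "val A (App A_tm A_tm)"]
proof (intro allI impI)
  define F where "F x = fval J \<phi> (case_nat x e)" for x
  have sub: "F x \<subseteq> Bot" for x using assms by (auto simp: fdfn_def F_def)
  fix \<xi> \<pi>
  assume \<xi>: "\<xi> \<in>\<^sub>M \<Lambda>" "\<xi> \<tturnstile> All (\<lambda>x. All (\<lambda>y. (fval J \<phi> (case_nat y e) \<^bold>\<longrightarrow> Bot) \<^bold>\<longrightarrow> not_eps y x) \<^bold>\<longrightarrow> fval J \<phi> (case_nat x e))"
    and \<pi>: "\<pi> \<in> All (\<lambda>x. fval J \<phi> (case_nat x e))"
  let ?a = "val A A_tm"
  \<comment> \<open>\<open>?v\<close> runs as \<open>A_tm A_tm \<xi>\<close>, and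
    \<open>?\<theta>\<close> as the term \<open>\<lambda>u. u ?v\<close>.\<close>
  let ?v = "instr_W A \<bullet> instr_I A \<bullet> ?a \<bullet> \<xi>"
  let ?\<theta> = "instr_B A \<bullet> (instr_B A \<bullet> (instr_C A \<bullet> instr_I A)) \<bullet> (instr_W A \<bullet> instr_I A) \<bullet> ?a \<bullet> \<xi>"
  have v: "?v \<in>\<^sub>M \<Lambda>" using \<xi>(1) by simp
  have step: "?a \<bottom> ?a \<cdot> \<xi> \<cdot> \<rho>"
    if IH: "\<And>c \<pi>. opair c \<pi> \<in>\<^sub>M x ==> ?v \<tturnstile> F c" and \<rho>: "\<rho> \<in> F x" for x \<rho>
  proof -
    have \<rho>': "\<rho> \<in>\<^sub>M \<Pi>" using subsetD[OF sub \<rho>] by simp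
    have "?\<theta> \<tturnstile> All (\<lambda>y. (F y \<^bold>\<longrightarrow> Bot) \<^bold>\<longrightarrow> not_eps y x)"
      unfolding realizes_All realizes_Imp_iff[of ?\<theta>]
    proof (intro allI impI)
      fix y u \<sigma> assume u: "u \<in>\<^sub>M \<Lambda>" "u \<tturnstile> (F y \<^bold>\<longrightarrow> Bot)" and \<sigma>: "\<sigma> \<in> not_eps y x"
      have \<sigma>': "\<sigma> \<in>\<^sub>M \<Pi>" "opair y \<sigma> \<in>\<^sub>M x" using \<sigma> by (auto simp: not_eps_def)
      have "u \<bottom> ?v \<cdot> \<sigma>" using IH[OF \<sigma>'(2)] \<sigma>' v by (intro realizes_ImpD[OF u(2)]) auto
      then show "?\<theta> \<bottom> u \<cdot> \<sigma>" using u(1) \<sigma>'(1) \<xi>(1) by (intro pole_intros closed val_mem)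
    qed
    moreover have "?\<theta> \<in>\<^sub>M \<Lambda>" using \<xi>(1) by simp
    ultimately have "\<xi> \<bottom> ?\<theta> \<cdot> \<rho>"
      using \<rho> unfolding F_def by (intro realizes_ImpD[OF spec[OF \<xi>(2)[unfolded realizes_All[of \<xi>]], of x]])
    then show ?thesis
      using \<xi>(1) \<rho>' by (subst A_tm_def, unfold val.simps) (intro pole_intros closed val_mem)
  qed
  have v_step: "?v \<bottom> \<rho>" if "?a \<bottom> ?a \<cdot> \<xi> \<cdot> \<rho>" "\<rho> \<in>\<^sub>M \<Pi>" for \<rho>
    using that \<xi>(1) by (intro pole_intros closed val_mem)
  have main: "?v \<tturnstile> F x" for x
  proof -
    obtain T where T: "transitive T" "x \<in>\<^sub>M T" by (rule ex_transitive)
    have "\<forall>\<rho>. \<rho> \<in> fval J \<phi> (case_nat x e) --> in_pole ?v \<rho>"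
    proof (rule opair_induct[OF T])
      show "dfn (\<lambda>d. \<forall>\<rho>. \<rho> \<in> fval J \<phi> (case_nat (d 0) e) --> in_pole ?v \<rho>)"
        by (intro dfn_intros dfn_fval1 assms)
      fix x assume IH: "\<And>c \<pi>. opair c \<pi> \<in>\<^sub>M x ==> \<forall>\<rho>. \<rho> \<in> fval J \<phi> (case_nat c e) --> in_pole ?v \<rho>"
      have "?v \<tturnstile> F c" if "opair c \<pi> \<in>\<^sub>M x" for c \<pi>
        using IH[OF that] realizes_iff[OF v sub] unfolding F_def by blast
      then have "?v \<bottom> \<rho>" if "\<rho> \<in> F x" for \<rho>
        using v_step[OF step[OF _ that]] subsetD[OF sub that] by simp
      then have "?v \<tturnstile> F x" by (rule realizesI)
      then show "\<forall>\<rho>. \<rho> \<in> fval J \<phi> (case_nat x e) --> in_pole ?v \<rho>"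
        using realizes_iff[OF v sub] unfolding F_def by blast
    qed
    then show ?thesis using realizes_iff[OF v sub] unfolding F_def by blast
  qed
  obtain x where x: "\<pi> \<in> F x" using \<pi> unfolding All_def F_def by blast
  have "?a \<bottom> ?a \<cdot> \<xi> \<cdot> \<pi>" "\<pi> \<in>\<^sub>M \<Pi>"
    using step[OF main x] subsetD[OF sub x] by simp_all
  then show "val A (App A_tm A_tm) \<bottom> \<xi> \<cdot> \<pi>"
    using \<xi>(1) unfolding val.simps(7) by (intro pole_intros closed val_mem)
qed

end

section \<open>The intended interpretation and realizers of the set-theoretic axioms\<close>

context zf_realizability
begin

lemma not_eps_sub: "not_eps x a \<subseteq> Bot"
  by (auto simp: not_eps_def)

definition const_sub :: "'v => 'v => 'v set" where
  "const_sub T x = (if x \<in>\<^sub>M T then Bot else {})"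

lemma gimel_iff: "\<forall>p. p \<in>\<^sub>M gimel T \<longleftrightarrow> (\<exists>x \<pi>. \<pi> \<in> const_sub T x \<and> p = opair x \<pi>)"
proof -
  have eq: "(\<exists>x \<pi>. x \<in>\<^sub>M T \<and> \<pi> \<in>\<^sub>M \<Pi> \<and> p = opair x \<pi>) \<longleftrightarrow> (\<exists>x \<pi>. \<pi> \<in> const_sub T x \<and> p = opair x \<pi>)" for p
    by (auto simp: const_sub_def split: if_splits)
  have "\<exists>w. \<forall>p. p \<in>\<^sub>M w \<longleftrightarrow> (\<exists>x \<pi>. \<pi> \<in> const_sub T x \<and> p = opair x \<pi>)"
  proof (rule ex_family)
    have "\<pi> \<in> const_sub T x \<longleftrightarrow> \<pi> \<in>\<^sub>M \<Pi> \<and> x \<in>\<^sub>M T" for \<pi> x by (auto simp: const_sub_def)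
    then show "dfn (\<lambda>e. e 1 \<in> const_sub T (e 0))" by (simp only:) (intro dfn_intros)
  qed (auto simp: const_sub_def split: if_splits)
  then show ?thesis unfolding gimel_def eq by (intro allI mem_the_set)
qed

lemma not_eps_gimel: "not_eps x (gimel T) = (if x \<in>\<^sub>M T then Bot else {})"
  using not_eps_family[OF gimel_iff] by (auto simp: const_sub_def)

text \<open>The successor \<open>x \<union> {x}\<close> of the realizability model. The leading terms \<open>K\<close> and \<open>K I\<close> of a stack
  tell a realizer from which of the two parts the stack comes.\<close>

definition succ_sub :: "'v => 'v => 'v set" where
  "succ_sub x u = {\<sigma>. \<exists>\<pi>. (is_push (val A K) \<pi> \<sigma> \<and> \<pi> \<in> not_eps u x) \<or> (is_push (val A (App K I)) \<pi> \<sigma> \<and> u = x)}"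

definition eps_succ :: "'v => 'v" where
  "eps_succ x = the_set (\<lambda>p. \<exists>u \<sigma>. \<sigma> \<in> succ_sub x u \<and> p = opair u \<sigma>)"

lemma succ_sub_Bot: "succ_sub x u \<subseteq> Bot"
  unfolding succ_sub_def is_push_def using val_mem by auto

lemma dfn_succ_sub [dfn_intros]:
  "tm t ==> tm u ==> tm v ==> dfn (\<lambda>e. t e \<in> succ_sub (u e) (v e))"
  by (rule dfn3) (unfold succ_sub_def mem_Collect_eq, intro dfn_intros dfn_fdfn fdfn_not_eps)

lemma ex_eps_succ: "\<exists>w. \<forall>p. p \<in>\<^sub>M w \<longleftrightarrow> (\<exists>u \<sigma>. \<sigma> \<in> succ_sub x u \<and> p = opair u \<sigma>)"
proof -
  obtain T where T: "transitive T" "x \<in>\<^sub>M T" by (rule ex_transitive)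
  show ?thesis
  proof (rule ex_family)
    show "dfn (\<lambda>e. e 1 \<in> succ_sub x (e 0))" by (intro dfn_intros)
    show "u \<in>\<^sub>M T" if "\<sigma> \<in> succ_sub x u" for u \<sigma>
      using that not_eps_transitive[OF T] T(2) unfolding succ_sub_def by blast
  qed (rule succ_sub_Bot)
qed

lemma not_eps_succ: "not_eps u (eps_succ x) = succ_sub x u"
  by (rule not_eps_family) (use mem_the_set[OF ex_eps_succ] succ_sub_Bot in \<open>auto simp: eps_succ_def\<close>)

lemma tm_eps_succ: "tm (\<lambda>e. eps_succ (e 0))"
  unfolding eps_succ_def by (rule tm_the_set[OF ex_eps_succ]) (intro dfn_intros)

text \<open>Uniqueness of the value is part of the relation, so the functionality axiom is realized
  for every individual \<open>c\<close>, whether or not it is a function.\<close>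

definition chosen :: "'v => 'v => 'v => 'v => bool" where
  "chosen c x \<nu> y \<longleftrightarrow> rel c (kpair x \<nu>) y \<and> (\<forall>z. rel c (kpair x \<nu>) z --> z = y)"

lemma dfn_chosen [dfn_intros]:
  "tm t ==> tm u ==> tm v ==> tm w ==> dfn (\<lambda>e. chosen (t e) (u e) (v e) (w e))"
  by (rule dfn4) (unfold chosen_def, intro dfn_intros)

text \<open>\<open>k\<close> is the index set of the choice function; \<open>T\<close> contains \<open>empty\<close> and is closed under \<open>eps_succ\<close>, so
  \<open>gimel T\<close> bounds an inductive set.\<close>

primrec interp :: "'v => 'v => pred => 'v list => 'v set" where
  "interp k T NotEps xs = not_eps (arg xs 0) (arg xs 1)"
| "interp k T NotEpsPair xs = not_eps (opair (arg xs 0) (arg xs 1)) (arg xs 2)"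
| "interp k T Incl xs = incl (arg xs 0) (arg xs 1)"
| "interp k T NotIn xs = not_in (arg xs 0) (arg xs 1)"
| "interp k T NotGimel xs = not_eps (arg xs 0) (gimel k)"
| "interp k T NotChoice xs = {\<pi>. \<pi> \<in>\<^sub>M \<Pi> \<and> chosen (arg xs 0) (arg xs 1) (arg xs 2) (arg xs 3)}"
| "interp k T NotStart xs = not_eps (arg xs 0) (gimel T)"

lemma tm_arg [dfn_intros]: "tm (\<lambda>e. arg (map e xs) k)"
proof (cases "k < length xs")
  case True
  then show ?thesis unfolding arg_def by (simp, intro dfn_intros)
next
  case False
  then show ?thesis unfolding arg_def by (simp, intro dfn_intros)
qed

lemma fdfn_interp: "fdfn (\<lambda>e. interp k T p (map e xs))"
proof (cases p)
  case NotChoice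
  have "fdfn (\<lambda>e. {\<pi>. \<pi> \<in>\<^sub>M \<Pi> \<and> chosen (arg (map e xs) 0) (arg (map e xs) 1) (arg (map e xs) 2) (arg (map e xs) 3)})"
    unfolding fdfn_def mem_Collect_eq by (intro conjI allI dfn_intros tm_shift[OF tm_arg]) auto
  then show ?thesis by (simp add: NotChoice)
qed (simp_all, (intro fdfn_not_eps fdfn_incl fdfn_not_in dfn_intros)+)

lemma fdfn_fval_interp: "fdfn (fval (interp k T) \<phi>)"
  by (rule fdfn_fval) (rule fdfn_interp)

lemma interp_Bot: "interp k T p xs \<subseteq> Bot"
  by (cases p) (auto simp: not_eps_def incl_sub not_in_sub)

lemma fval_derived:
  "fval J (Ng \<phi>) e = (\<^bold>\<not> fval J \<phi> e)"
  "fval J (An \<phi> \<psi>) e = (fval J \<phi> e \<^bold>\<and> fval J \<psi> e)"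
  "fval J (Orr \<phi> \<psi>) e = (fval J \<phi> e \<^bold>\<or> fval J \<psi> e)"
  "fval J (Eqv \<phi> \<psi>) e = (fval J \<phi> e \<^bold>\<longleftrightarrow> fval J \<psi> e)"
  "fval J (Exi \<phi>) e = Ex (\<lambda>a. fval J \<phi> (case_nat a e))"
  by (simp_all add: Ng_def An_def Orr_def Eqv_def Exi_def Not_def And_def Or_def Iff_def Ex_def)

lemma fval_atoms:
  "fval (interp k T) (ne i j) e = not_eps (e i) (e j)"
  "fval (interp k T) (np i j l) e = not_eps (opair (e i) (e j)) (e l)"
  "fval (interp k T) (inc i j) e = incl (e i) (e j)"
  "fval (interp k T) (ni i j) e = not_in (e i) (e j)"
  "fval (interp k T) (ng i) e = not_eps (e i) (gimel k)"
  "fval (interp k T) (nch i j l n) e = (if chosen (e i) (e j) (e l) (e n) then Bot else {})"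
  "fval (interp k T) (nw i) e = not_eps (e i) (gimel T)"
  by (auto simp: arg_def eval_nat_numeral)

lemma fval_eq:
  "fval (interp k T) (leib i j) e = eq (e i) (e j)"
  "fval (interp k T) (exteq i j) e = ext_eq (e i) (e j)"
  unfolding leib_def exteq_def fval_derived fval.simps(3) fval.simps(2) fval_atoms eq_def ext_eq_def by simp_all

lemmas fval_unfold = fval_eq fval_derived fval.simps(1-3) fval_atoms

lemma fval_countable: "fval (interp k T) countable_fm e = Countable (gimel k)"
  unfolding countable_fm_def natural_fm_def inductive_fm_def Countable_def Natural_def Inductive_def
    fval_unfold ext_in_def eps_def by (simp add: eval_nat_numeral)

lemma fval_neac: "fval (interp k T) neac_fm e = NEAC"
  unfolding neac_fm_def NEAC_def Func_def eps_subset_def fval_unfold eps_def by (simp add: eval_nat_numeral)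

lemma realizes_Iff: "F = G ==> G \<subseteq> Bot ==> val A (and_tm I I) \<tturnstile> (F \<^bold>\<longleftrightarrow> G)"
  unfolding Iff_def And_def by (intro realizes_And realizes_I) auto

lemma realizes_exists: "val A t \<tturnstile> F a ==> val A (ex_tm t) \<tturnstile> Ex F"
  unfolding Ex_def Not_def by (rule realizes_Ex)

lemma realizes_conj: "val A t \<tturnstile> F ==> val A u \<tturnstile> G ==> val A (and_tm t u) \<tturnstile> (F \<^bold>\<and> G)"
  unfolding And_def by (rule realizes_And)

lemma realizes_eq_refl: "val A I \<tturnstile> eq x x"
  unfolding eq_def realizes_All by (intro allI realizes_I not_eps_sub order_refl)

text \<open>A separating set for \<open>y\<close> and \<open>y'\<close> yields one for \<open>\<nu>\<close> and \<open>\<nu>'\<close>.\<close>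

lemma eq_chosen:
  assumes "\<nu> = \<nu>' ==> y = y'" shows "eq y y' \<subseteq> eq \<nu> \<nu>'"
proof
  fix \<pi> assume "\<pi> \<in> eq y y'"
  then obtain w where w: "\<pi> \<in> (not_eps y w \<^bold>\<longrightarrow> not_eps y' w)" unfolding eq_def All_def by blast
  \<comment> \<open>The falsity values of y and y' in w are moved to the indices. If the indices
    coincide, so do y and y', and the two clauses do not interfere.\<close>
  define D where "D x = {\<pi>. (x = \<nu> \<and> \<pi> \<in> not_eps y w) \<or> (x = \<nu>' \<and> \<pi> \<in> not_eps y' w)}" for x
  have D_sub: "D x \<subseteq> Bot" for x unfolding D_def using not_eps_sub by blast
  have "\<exists>v. \<forall>p. p \<in>\<^sub>M v \<longleftrightarrow> (\<exists>x \<pi>. \<pi> \<in> D x \<and> p = opair x \<pi>)"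
  proof (rule ex_family)
    show "dfn (\<lambda>e. e 1 \<in> D (e 0))" unfolding D_def mem_Collect_eq
      by (intro dfn_intros dfn_fdfn fdfn_not_eps)
    show "x \<in>\<^sub>M upair \<nu> \<nu>'" if "\<pi> \<in> D x" for x \<pi> using that by (auto simp: D_def)
  qed (rule D_sub)
  then obtain v where "\<forall>p. p \<in>\<^sub>M v \<longleftrightarrow> (\<exists>x \<pi>. \<pi> \<in> D x \<and> p = opair x \<pi>)" ..
  then have v: "not_eps x v = D x" for x by (rule not_eps_family) (rule D_sub)
  have "D \<nu> = not_eps y w" "D \<nu>' = not_eps y' w" using assms by (auto simp: D_def)
  then have "\<pi> \<in> (not_eps \<nu> v \<^bold>\<longrightarrow> not_eps \<nu>' v)" using w v by simp
  then show "\<pi> \<in> eq \<nu> \<nu>'" unfolding eq_def All_def by blast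
qed

text \<open>\<open>\<lambda>\<xi>. cc (\<xi> I)\<close>\<close>

definition choice_tm :: cterm where
  "choice_tm = App (App B CC) (App (App C I) I)"

text \<open>The ground model chooses y from x and an index \<nu> of the stack \<pi>, with \<pi>
  witnessing the pair (x, y) in z. The chosen y' keeps the same \<pi>, since \<open>h\<close>
  determines the stack from \<nu>.\<close>

lemma ex_choice:
  assumes V_eq_L and h: "\<And>\<nu> \<pi> \<rho>. rel h \<nu> \<pi> ==> rel h \<nu> \<rho> ==> \<pi> = \<rho>"
    "\<And>\<pi>. \<pi> \<in>\<^sub>M \<Pi> ==> \<exists>\<nu>. \<nu> \<in>\<^sub>M k \<and> rel h \<nu> \<pi>"
  shows "\<exists>c. \<forall>x y \<pi>. \<pi> \<in> not_eps (opair x y) z -->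
    (\<exists>\<nu> y'. \<nu> \<in>\<^sub>M k \<and> chosen c x \<nu> y' \<and> \<pi> \<in> not_eps (opair x y') z)"
proof -
  \<comment> \<open>The empty set is put into T because it is its own pair, whose components are not
    reached by going down from z.\<close>
  obtain T where T: "transitive T" "upair empty z \<in>\<^sub>M T" by (rule ex_transitive)
  have Tt: "x \<in>\<^sub>M T" if "x \<in>\<^sub>M y" "y \<in>\<^sub>M T" for x y
    using T(1) that unfolding transitive_def subset_def by blast
  have T': "empty \<in>\<^sub>M T" "z \<in>\<^sub>M T" using Tt[OF _ T(2)] by auto
  have comp: "x \<in>\<^sub>M T \<and> y \<in>\<^sub>M T" if z: "opair (opair x y) \<pi> \<in>\<^sub>M z" for x y \<pi>
  proof (cases "x = empty \<and> y = empty")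
    case False
    have "opair x y \<in>\<^sub>M T" using transitive_opair[OF T(1) T'(2) z] .
    moreover have "upair x y \<in>\<^sub>M opair x y" using False by (auto simp: opair_def kpair_def)
    ultimately have "upair x y \<in>\<^sub>M T" using Tt by blast
    then show ?thesis using Tt[of _ "upair x y"] by simp
  qed (use T' in simp)
  define Q where "Q p y \<longleftrightarrow> (\<exists>x \<nu> \<pi>. p = kpair x \<nu> \<and> rel h \<nu> \<pi> \<and> \<pi> \<in>\<^sub>M \<Pi> \<and> opair (opair x y) \<pi> \<in>\<^sub>M z)" for p y
  have Q0: "dfn (\<lambda>e. Q (e 0) (e 1))" unfolding Q_def by (intro dfn_intros)
  have QT: "y \<in>\<^sub>M T" if "Q p y" for p y using that comp unfolding Q_def by blast
  obtain c where c: "\<And>p y z. rel c p y ==> rel c p z ==> y = z"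
    "\<And>p y. rel c p y ==> Q p y"
    "\<And>p y. p \<in>\<^sub>M prod T k ==> Q p y ==> \<exists>z. rel c p z"
    by (rule choice[OF assms(1) Q0, where S=T and D="prod T k"]) (rule QT | blast)+
  have "\<exists>\<nu> y'. \<nu> \<in>\<^sub>M k \<and> chosen c x \<nu> y' \<and> \<pi> \<in> not_eps (opair x y') z" if \<pi>: "\<pi> \<in> not_eps (opair x y) z" for x y \<pi>
  proof -
    have \<pi>': "\<pi> \<in>\<^sub>M \<Pi>" "opair (opair x y) \<pi> \<in>\<^sub>M z" using \<pi> by (auto simp: not_eps_def)
    obtain \<nu> where \<nu>: "\<nu> \<in>\<^sub>M k" "rel h \<nu> \<pi>" using h(2)[OF \<pi>'(1)] by blast
    have "Q (kpair x \<nu>) y" unfolding Q_def using \<pi>' \<nu> by blast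
    moreover have "kpair x \<nu> \<in>\<^sub>M prod T k" using comp[OF \<pi>'(2)] \<nu>(1) by simp
    ultimately obtain y' where y': "rel c (kpair x \<nu>) y'" using c(3) by blast
    then have "opair (opair x y') \<pi> \<in>\<^sub>M z" using c(2)[OF y'] h(1)[OF \<nu>(2)] unfolding Q_def by auto
    moreover have "chosen c x \<nu> y'" unfolding chosen_def using y' c(1) by blast
    ultimately show ?thesis using \<nu>(1) \<pi>'(1) unfolding not_eps_def by blast
  qed
  then show ?thesis by blast
qed

text \<open>\<open>\<lambda>u \<xi> a. a (u \<xi>)\<close>\<close>

definition eq_tm :: cterm where
  "eq_tm = App B (App C I)"

text \<open>\<open>\<lambda>\<xi> \<eta> t. t \<xi> (\<eta> I)\<close>\<close>

definition succ_tm :: cterm where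
  "succ_tm = App (App C (App (App B B) (App (App B C) (App C I)))) (App (App C I) I)"

text \<open>The stack \<pi> provides \<nu> and y'. Its continuation realizes that (x, y') belongs to
  z, and \<pi> itself lies in the falsity value for \<nu>, which is all of \<open>\<Pi>\<close>. So
  cc supplies exactly what \<open>\<xi>\<close> expects.\<close>

lemma realizes_choice:
  assumes c: "\<forall>x y \<pi>. \<pi> \<in> not_eps (opair x y) z -->
    (\<exists>\<nu> y'. \<nu> \<in>\<^sub>M k \<and> chosen c x \<nu> y' \<and> \<pi> \<in> not_eps (opair x y') z)"
  shows "val A choice_tm \<tturnstile> (All (\<lambda>\<nu>. All (\<lambda>y'. (\<^bold>\<not> (if chosen c x \<nu> y' then Bot else {})) \<^bold>\<longrightarrow>
    (\<^bold>\<not> not_eps (opair x y') z) \<^bold>\<longrightarrow> not_eps \<nu> (gimel k))) \<^bold>\<longrightarrow> not_eps (opair x y) z)"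
  unfolding realizes_Imp_iff[of "val A choice_tm"]
proof (intro allI impI)
  fix \<xi> \<pi>
  assume \<xi>: "\<xi> \<in>\<^sub>M \<Lambda>" "\<xi> \<tturnstile> All (\<lambda>\<nu>. All (\<lambda>y'. (\<^bold>\<not> (if chosen c x \<nu> y' then Bot else {})) \<^bold>\<longrightarrow>
    (\<^bold>\<not> not_eps (opair x y') z) \<^bold>\<longrightarrow> not_eps \<nu> (gimel k)))" and \<pi>: "\<pi> \<in> not_eps (opair x y) z"
  obtain \<nu> y' where \<nu>: "\<nu> \<in>\<^sub>M k" "chosen c x \<nu> y'" "\<pi> \<in> not_eps (opair x y') z" using c \<pi> by blast
  have \<pi>': "\<pi> \<in>\<^sub>M \<Pi>" using \<pi> by (simp add: not_eps_def)
  have 1: "\<xi> \<tturnstile> ((\<^bold>\<not> Bot) \<^bold>\<longrightarrow> (\<^bold>\<not> not_eps (opair x y') z) \<^bold>\<longrightarrow> Bot)"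
    using \<xi>(2)[unfolded realizes_All, THEN spec, THEN spec, of \<nu> y'] \<nu> by (simp add: not_eps_gimel)
  have "val A I \<tturnstile> (\<^bold>\<not> Bot)" unfolding Not_def by (rule realizes_I) auto
  moreover have "kont A \<pi> \<tturnstile> (\<^bold>\<not> not_eps (opair x y') z)"
    unfolding Not_def realizes_Imp_iff using \<pi>' \<nu>(3) by (auto intro!: pole_intros dest: realizesD)
  then have "kont A \<pi> \<cdot> \<pi> \<in> ((\<^bold>\<not> not_eps (opair x y') z) \<^bold>\<longrightarrow> Bot)" unfolding mem_Imp using \<pi>' by auto
  ultimately have "\<xi> \<bottom> val A I \<cdot> kont A \<pi> \<cdot> \<pi>" by (intro realizes_ImpD[OF 1 val_mem])
  then show "val A choice_tm \<bottom> \<xi> \<cdot> \<pi>"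
    using \<xi>(1) \<pi>' unfolding choice_tm_def val.simps by (intro pole_intros closed)
qed

lemma realizes_choice_fun:
  "val A eq_tm \<tturnstile> ((\<^bold>\<not> eq y y') \<^bold>\<longrightarrow> eq \<nu> \<nu>' \<^bold>\<longrightarrow> (\<^bold>\<not> (if chosen c x \<nu> y then Bot else {})) \<^bold>\<longrightarrow>
    (if chosen c x \<nu>' y' then Bot else {}))"
proof (rule realizesI, elim mem_Imp[THEN iffD1, elim_format] exE conjE, clarify)
  fix u \<xi> a \<pi>
  assume *: "u \<in>\<^sub>M \<Lambda>" "u \<tturnstile> (\<^bold>\<not> eq y y')" "\<xi> \<in>\<^sub>M \<Lambda>" "\<xi> \<tturnstile> eq \<nu> \<nu>'" "a \<in>\<^sub>M \<Lambda>"
    "a \<tturnstile> (\<^bold>\<not> (if chosen c x \<nu> y then Bot else {}))" and "\<pi> \<in> (if chosen c x \<nu>' y' then Bot else {})"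
  then have \<pi>: "\<pi> \<in>\<^sub>M \<Pi>" "chosen c x \<nu>' y'" by (auto split: if_splits)
  have "u \<bullet> \<xi> \<tturnstile> (if chosen c x \<nu> y then Bot else {})"
  proof (cases "chosen c x \<nu> y")
    \<comment> \<open>have\<close>
    case True
    have "\<xi> \<tturnstile> eq y y'" by (rule realizes_mono[OF eq_chosen *(4)]) (use True \<pi>(2) in \<open>auto simp: chosen_def\<close>)
    then show ?thesis using True * unfolding Not_def by (simp add: realizes_app)
  qed (simp add: realizes_def)
  then have "a \<bottom> (u \<bullet> \<xi>) \<cdot> \<pi>" using * \<pi> unfolding Not_def by (intro realizes_ImpD[OF *(6)[unfolded Not_def]]) auto
  then show "val A eq_tm \<bottom> u \<cdot> \<xi> \<cdot> a \<cdot> \<pi>"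
    using * \<pi> unfolding eq_tm_def val.simps by (intro pole_intros closed)
qed

lemma realizes_succ:
  shows "val A (App (App C I) K) \<tturnstile> (not_eps u (eps_succ x) \<^bold>\<longrightarrow> not_eps u x)" (is ?P1)
    and "val A (App (App C I) (App K I)) \<tturnstile> (\<^bold>\<not> not_eps x (eps_succ x))" (is ?P2)
    and "val A succ_tm \<tturnstile> (not_eps u x \<^bold>\<longrightarrow> (\<^bold>\<not> eq u x) \<^bold>\<longrightarrow> not_eps u (eps_succ x))" (is ?P3)
proof -
  show ?P1 unfolding realizes_Imp_iff not_eps_succ
  proof (intro allI impI)
    fix \<xi> \<pi> assume *: "\<xi> \<in>\<^sub>M \<Lambda>" "\<xi> \<tturnstile> succ_sub x u" "\<pi> \<in> not_eps u x"
    have \<pi>: "\<pi> \<in>\<^sub>M \<Pi>" using *(3) by (simp add: not_eps_def)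
    have "val A K \<cdot> \<pi> \<in> succ_sub x u" unfolding succ_sub_def is_push_def using * \<pi> val_mem by blast
    then have "\<xi> \<bottom> val A K \<cdot> \<pi>" by (rule realizesD[OF *(2)])
    then show "val A (App (App C I) K) \<bottom> \<xi> \<cdot> \<pi>"
      using *(1) \<pi> unfolding val.simps by (intro pole_intros closed)
  qed
  show ?P2 unfolding Not_def realizes_Imp_iff not_eps_succ
  proof (intro allI impI)
    fix \<xi> \<pi> assume *: "\<xi> \<in>\<^sub>M \<Lambda>" "\<xi> \<tturnstile> succ_sub x x" "\<pi> \<in> Bot"
    have "val A (App K I) \<cdot> \<pi> \<in> succ_sub x x" unfolding succ_sub_def is_push_def using * val_mem by auto
    then have "\<xi> \<bottom> val A (App K I) \<cdot> \<pi>" by (rule realizesD[OF *(2)])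
    then show "val A (App (App C I) (App K I)) \<bottom> \<xi> \<cdot> \<pi>"
      using * unfolding val.simps by (intro pole_intros closed) auto
  qed
  show ?P3 unfolding not_eps_succ
  proof (rule realizesI, elim mem_Imp[THEN iffD1, elim_format] exE conjE, clarify)
    fix \<xi> \<eta> \<sigma> assume *: "\<xi> \<in>\<^sub>M \<Lambda>" "\<xi> \<tturnstile> not_eps u x" "\<eta> \<in>\<^sub>M \<Lambda>" "\<eta> \<tturnstile> (\<^bold>\<not> eq u x)" "\<sigma> \<in> succ_sub x u"
    let ?\<eta> = "\<eta> \<bullet> instr_I A"
    have lift: "val A succ_tm \<bottom> \<xi> \<cdot> \<eta> \<cdot> t \<cdot> \<pi>"
      if "t \<bottom> \<xi> \<cdot> (instr_C A \<bullet> instr_I A \<bullet> instr_I A \<bullet> \<eta>) \<cdot> \<pi>" "t \<in>\<^sub>M \<Lambda>" "\<pi> \<in>\<^sub>M \<Pi>" for t \<pi>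
      using that *(1,3) unfolding succ_tm_def val.simps by (intro pole_intros closed)
    from *(5) consider \<pi> where "is_push (val A K) \<pi> \<sigma>" "\<pi> \<in> not_eps u x"
      | \<pi> where "is_push (val A (App K I)) \<pi> \<sigma>" "u = x" unfolding succ_sub_def by blast
    then show "val A succ_tm \<bottom> \<xi> \<cdot> \<eta> \<cdot> \<sigma>"
    proof cases
      case 1
      then have \<pi>: "\<pi> \<in>\<^sub>M \<Pi>" "\<sigma> = instr_K A \<cdot> \<pi>" by (simp_all add: is_push_def)
      have "\<xi> \<bottom> \<pi>" using realizesD[OF *(2) 1(2)] .
      then show ?thesis unfolding \<pi>(2) using * \<pi>(1) by (intro lift pole_intros closed)
    next
      case 2
      then have \<pi>: "\<pi> \<in>\<^sub>M \<Pi>" "\<sigma> = (instr_K A \<bullet> instr_I A) \<cdot> \<pi>" by (simp_all add: is_push_def)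
      have "\<eta> \<bottom> instr_I A \<cdot> \<pi>"
        using realizes_ImpD[OF *(4)[unfolded Not_def] _ _, of "val A I" \<pi>] realizes_eq_refl 2(2) \<pi>(1) by simp
      then show ?thesis unfolding \<pi>(2) using * \<pi>(1) by (intro lift pole_intros closed)
    qed
  qed
qed

lemma realizes_ax:
  assumes V_eq_L and h: "\<And>\<nu> \<pi> \<rho>. rel h \<nu> \<pi> ==> rel h \<nu> \<rho> ==> \<pi> = \<rho>"
    "\<And>\<pi>. \<pi> \<in>\<^sub>M \<Pi> ==> \<exists>\<nu>. \<nu> \<in>\<^sub>M k \<and> rel h \<nu> \<pi>"
    and T: "empty \<in>\<^sub>M T" "\<And>x. x \<in>\<^sub>M T ==> eps_succ x \<in>\<^sub>M T"
    and "ax \<phi>"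
  shows "\<exists>t. \<forall>e. val A t \<tturnstile> fval (interp k T) \<phi> e"
  using assms(6)
proof cases
  case incl_unfold
  have "val A (and_tm I I) \<tturnstile> fval (interp k T) \<phi> e" for e
    unfolding incl_unfold fval_unfold
    by (rule realizes_Iff) (use incl_eq[of "e 0" "e 1"] incl_sub[of "e 0" "e 1"] in \<open>simp_all add: numeral_2_eq_2\<close>)
  then show ?thesis by blast
next
  case not_in_unfold
  have "val A (and_tm I I) \<tturnstile> fval (interp k T) \<phi> e" for e
    unfolding not_in_unfold fval_unfold
    by (rule realizes_Iff) (use not_in_eq[of "e 0" "e 1"] not_in_sub[of "e 0" "e 1"] in \<open>simp_all add: numeral_2_eq_2\<close>)
  then show ?thesis by blast
next
  case (comprehension \<psi>)
  have "val A (ex_tm (and_tm I I)) \<tturnstile> fval (interp k T) \<phi> e" for e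
  proof -
    obtain w where w: "\<forall>x. not_eps x w = (fval (interp k T) \<psi> (case_nat x e) \<^bold>\<longrightarrow> not_eps x (gimel T))"
      using ex_comprehension[OF fdfn_fval_interp] by blast
    show ?thesis unfolding comprehension fval_unfold
    proof (rule realizes_exists[of _ _ w], unfold realizes_All, intro allI realizes_Iff)
      fix x
      have "(\<lambda>i. case_nat x (case_nat w e) (skip 1 i)) = case_nat x e"
        by (auto simp: skip_def fun_eq_iff split: nat.splits)
      then show "not_eps (case_nat x (case_nat w e) 0) (case_nat x (case_nat w e) 1) =
          (fval (interp k T) (ren (skip 1) \<psi>) (case_nat x (case_nat w e)) \<^bold>\<longrightarrow> not_eps (case_nat x (case_nat w e) 0) (gimel T))"
        using w unfolding fval_ren by simp
    qed (intro Imp_sub not_eps_sub)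
  qed
  then show ?thesis by blast
next
  case (pair_comprehension n \<psi>)
  have "val A (ex_tm (and_tm K (and_tm I I))) \<tturnstile> fval (interp k T) \<phi> e" for e
  proof -
    obtain f where f: "\<forall>x y. not_eps (opair x y) f =
        (fval (interp k T) \<psi> (case_nat y (case_nat x e)) \<^bold>\<longrightarrow> not_eps (opair x y) (e n))"
      "\<And>w \<pi>. \<pi> \<in> not_eps w f ==> \<exists>\<xi> \<rho>. \<xi> \<in>\<^sub>M \<Lambda> \<and> \<pi> = \<xi> \<cdot> \<rho> \<and> \<rho> \<in> not_eps w (e n)"
      using ex_pair_comprehension[OF fdfn_fval_interp, of k T \<psi> e "e n"] by blast
    have 1: "val A K \<tturnstile> (not_eps w (e n) \<^bold>\<longrightarrow> not_eps w f)" for w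
      unfolding realizes_Imp_iff
    proof (intro allI impI)
      fix \<eta> \<pi> assume \<eta>: "\<eta> \<in>\<^sub>M \<Lambda>" "\<eta> \<tturnstile> not_eps w (e n)" and "\<pi> \<in> not_eps w f"
      then obtain \<xi> \<rho> where \<rho>: "\<xi> \<in>\<^sub>M \<Lambda>" "\<pi> = \<xi> \<cdot> \<rho>" "\<rho> \<in> not_eps w (e n)" using f(2) by blast
      then have "\<eta> \<bottom> \<rho>" "\<rho> \<in>\<^sub>M \<Pi>" using \<eta> by (auto dest: realizesD simp: not_eps_def)
      then show "val A K \<bottom> \<eta> \<cdot> \<pi>" using \<eta> \<rho>(1) unfolding \<rho>(2) val.simps by (intro pole_intros)
    qed
    have 2: "val A (and_tm I I) \<tturnstile> (not_eps (opair x y) f \<^bold>\<longleftrightarrow>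
        (fval (interp k T) (ren (skip 2) \<psi>) (case_nat y (case_nat x (case_nat f e))) \<^bold>\<longrightarrow> not_eps (opair x y) (e n)))" for x y
    proof (rule realizes_Iff)
      have "(\<lambda>i. case_nat y (case_nat x (case_nat f e)) (skip 2 i)) = case_nat y (case_nat x e)"
        by (auto simp: skip_def fun_eq_iff split: nat.splits)
      then show "not_eps (opair x y) f =
        (fval (interp k T) (ren (skip 2) \<psi>) (case_nat y (case_nat x (case_nat f e))) \<^bold>\<longrightarrow> not_eps (opair x y) (e n))"
        using f(1) unfolding fval_ren by simp
    qed (intro Imp_sub not_eps_sub)
    show ?thesis unfolding pair_comprehension fval_unfold
      by (rule realizes_exists[of _ _ f], rule realizes_conj)
        (use 1 2 in \<open>simp_all add: realizes_All eval_nat_numeral\<close>)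
  qed
  then show ?thesis by blast
next
  case (eps_induction \<psi>)
  have "val A (App A_tm A_tm) \<tturnstile> fval (interp k T) \<phi> e" for e
  proof -
    have "(\<lambda>i. case_nat y (case_nat x e) (skip 1 i)) = case_nat y e" for x y
      by (auto simp: skip_def fun_eq_iff split: nat.splits)
    then show ?thesis
      using realizes_induction[OF fdfn_fval_interp, of k T \<psi> e]
      unfolding eps_induction fval_unfold fval_ren Not_def by simp
  qed
  then show ?thesis by blast
next
  case choice_ax
  have "val A (ex_tm choice_tm) \<tturnstile> fval (interp k T) \<phi> e" for e
  proof -
    obtain c where c: "\<forall>x y \<pi>. \<pi> \<in> not_eps (opair x y) (e 0) -->
        (\<exists>\<nu> y'. \<nu> \<in>\<^sub>M k \<and> chosen c x \<nu> y' \<and> \<pi> \<in> not_eps (opair x y') (e 0))"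
      using ex_choice[OF assms(1), of h k "e 0"] h by blast
    show ?thesis unfolding choice_ax fval_unfold
      by (rule realizes_exists[of _ _ c]) (use realizes_choice[OF c] in \<open>simp add: realizes_All eval_nat_numeral\<close>)
  qed
  then show ?thesis by blast
next
  case choice_fun
  have "val A eq_tm \<tturnstile> fval (interp k T) \<phi> e" for e
    unfolding choice_fun fval_unfold by (rule realizes_choice_fun)
  then show ?thesis by blast
next
  case start_empty
  have "val A (ex_tm (and_tm I I)) \<tturnstile> fval (interp k T) \<phi> e" for e
    unfolding start_empty fval_unfold
  proof (rule realizes_exists[of _ _ empty], rule realizes_conj)
    show "val A I \<tturnstile> (\<^bold>\<not> not_eps (case_nat empty e 0) (gimel T))"
      unfolding Not_def by (rule realizes_I) (auto simp: not_eps_gimel T(1))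
    show "val A I \<tturnstile> All (\<lambda>a. not_eps (case_nat a (case_nat empty e) 0) (case_nat a (case_nat empty e) 1))"
      by (simp add: realizes_def not_eps_def All_def)
  qed
  then show ?thesis by blast
next
  case start_succ
  have "val A (ex_tm (and_tm I (and_tm (App (App C I) K) (and_tm (App (App C I) (App K I)) succ_tm))))
      \<tturnstile> fval (interp k T) \<phi> e" for e
    unfolding start_succ fval_unfold
  proof (rule realizes_exists[of _ _ "eps_succ (e 0)"], intro realizes_conj)
    show "val A I \<tturnstile> (not_eps (case_nat (eps_succ (e 0)) e 0) (gimel T) \<^bold>\<longrightarrow> not_eps (case_nat (eps_succ (e 0)) e 1) (gimel T))"
      by (rule realizes_I) (use T(2)[of "e 0"] in \<open>auto simp: not_eps_gimel\<close>)
  qed (use realizes_succ in \<open>simp_all add: realizes_All numeral_2_eq_2\<close>)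
  then show ?thesis by blast
qed

theorem countable_gimel_imp_neac:
  assumes V_eq_L and "is_kappa \<kappa>"
  shows "\<exists>H. val A H \<tturnstile> (Countable (gimel \<kappa>) \<^bold>\<longrightarrow> NEAC)"
proof -
  have "the_set (\<lambda>x. x \<in>\<^sub>M \<Lambda> \<or> x \<in>\<^sub>M \<Pi> \<or> x \<in>\<^sub>M omega) = un \<Lambda> (un \<Pi> omega)"
    by (rule the_set_eq) simp
  then obtain h where h: "bijection h \<kappa> (un \<Lambda> (un \<Pi> omega))"
    using assms(2) unfolding is_kappa_def is_card_def by auto
  then have fun_h: "fun_on h \<kappa>" by (simp add: bijection_def)
  have h1: "\<pi> = \<rho>" if "rel h \<nu> \<pi>" "rel h \<nu> \<rho>" for \<nu> \<pi> \<rho>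
    using that ap_iff[OF fun_h fun_on_fun[OF fun_h that(1)]] by simp
  have h2: "\<exists>\<nu>. \<nu> \<in>\<^sub>M \<kappa> \<and> rel h \<nu> \<pi>" if "\<pi> \<in>\<^sub>M \<Pi>" for \<pi>
  proof -
    have "\<exists>!\<nu>. \<nu> \<in>\<^sub>M \<kappa> \<and> ap h \<nu> = \<pi>" using h that unfolding bijection_def by simp
    then show ?thesis using ap_iff[OF fun_h] by blast
  qed
  obtain T where T: "empty \<in>\<^sub>M T" "\<And>x. x \<in>\<^sub>M T ==> eps_succ x \<in>\<^sub>M T"
    using ex_closed[OF tm_eps_succ] by blast
  define R where "R \<phi> \<longleftrightarrow> (\<exists>t. \<forall>e. val A t \<tturnstile> fval (interp \<kappa> T) \<phi> e)" for \<phi>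
  interpret henkin R unfolding R_def by (rule realizability_henkin) (rule interp_Bot)
  have "R (Im countable_fm neac_fm)"
  proof (rule completeness)
    fix m :: "pred => nat list => bool" assume "\<And>\<phi> e. R \<phi> ==> msat m \<phi> e"
    moreover have "R \<phi>" if "ax \<phi>" for \<phi>
      unfolding R_def by (rule realizes_ax[OF assms(1), where h=h]) (fact h1 h2 T that)+
    ultimately have "two_valued m" by unfold_locales blast
    then show "msat m (Im countable_fm neac_fm) id" by (rule two_valued.countable_imp_neac)
  next
    fix \<phi> f assume "R \<phi>"
    then show "R (ren f \<phi>)" unfolding R_def fval_ren by blast
  qed
  then show ?thesis unfolding R_def by (simp add: fval_countable fval_neac)
qed

end

theorem theorem30:
  fixes mem :: "'v \<Rightarrow> 'v \<Rightarrow> bool" and A :: "'v ralg" and \<kappa> :: 'v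
  assumes "set_structure.ZF mem" and "set_structure.V_eq_L mem"
    and "realizability_structure.realizability_algebra mem A" and "realizability_structure.coherent mem A"
    and "realizability_structure.is_kappa mem A \<kappa>"
  shows "\<exists>H :: cterm. realizability_structure.realizes mem A (val A H)
           (realizability_structure.Imp mem A
              (realizability_structure.Countable mem A (realizability_structure.gimel mem A \<kappa>))
              (realizability_structure.NEAC mem A))"
proof -
  interpret zf_realizability mem A
    using assms(1,3) by unfold_locales
  show ?thesis using assms(2,5) by (rule countable_gimel_imp_neac)
qed

end
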